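(* Let $\varepsilon<1$ be fixed. Let $\mathcal{E}$ be an ensemble of depth-$d$ circuits implementing orthogonal $n$-qubit unitaries such that the state ensemble $\{U|0^n\rangle\}_{U\sim\mathcal{E}}$ (with second moment $\Phi_{\mathcal{E}}(|0^n\rangle\langle 0^n|^{\otimes 2})$) is a relative-error $\varepsilon$-approximate orthogonal state $2$-design. Then: 1. If the architecture has diameter $\mathrm{dia}$ and $\mathcal{E}$ is locally independent, then $d=\Omega(\mathrm{dia})$. 2. If $\mathcal{E}$ is a generalized random brickwork over the orthogonal group, then $d=\Omega(n)$ (for any architecture). The implied constants do not depend on $n$ (they may depend on $\varepsilon$ and on the constant gate-size $r$).
   Context: $\mathrm{O}(2^n)$ is the group of real unitary matrices on $(\mathbb{C}^2)^{\otimes n}$. For an ensemble (probability distribution) $\mathcal{E}$ of unitaries, $\Phi_{\mathcal{E}}(A)=\Phi^{(k)}_{\mathcal{E}}(A)=\mathbb{E}_{U\sim\mathcal{E}}U^{\otimes k}A\,U^{\dagger,\otimes k}$. For a group $G$, "$|\psi\rangle\sim G$" means $|\psi\rangle=U|0^n\rangle$ with $U$ Haar-random in $G$. An ensemble $\mathcal{E}'$ of pure states is a relative-error $\varepsilon$-approximate state $k$-design over $G$ (for $G=\mathrm{O}(2^n)$: an orthogonal state $k$-design) if $(1-\varepsilon)\,\mathbb{E}_{\psi\sim G}|\psi\rangle\langle\psi|^{\otimes k}\preceq\mathbb{E}_{\psi\sim\mathcal{E}'}|\psi\rangle\langle\psi|^{\otimes k}\preceq(1+\varepsilon)\,\mathbb{E}_{\psi\sim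 G}|\psi\rangle\langle\psi|^{\otimes k}$ in the positive-semidefinite order. An architecture is a graph whose vertices are the $n$ qubits. A depth-$d$ circuit is a product of $d$ layers; each layer is a product of gates with disjoint supports, each acting on at most a constant number $r$ of qubits that are connected in the graph. The depth of an ensemble is the maximal depth of its circuits. The diameter $\mathrm{dia}$ is the largest graph distance between two qubits. Locally independent ensemble: for a circuit $U$ let $S_x(U)$ be the set of local gates of $U$ that act on qubit $x$. $\mathcal{E}$ is locally independent if for every pair of qubits $x,y$ at graph distance at least $\mathrm{dia}/2$, $S_x(U)$ and $S_y(U)$ are independent random variables when $U\sim\mathcal{E}$. Generalized random brickwork: let $A_1,\dots,A_L$ be partitions of $[n]$ whose parts $a_{i,j}\in A_i$ have size at most a constant $r$ and consist of qubits connected in the architecture. For each $a_{i,j}$, either draw (independently) a Haar-random element of the group (here $\mathrm{O}(2^{|a_{i,j}|})$) on the qubits $a_{i,j}$, or apply the identity. The ensemble of circuits obtained by composing these in $L$ layers is a fixed brickwork (of depth $L$). A generalized random brickwork is a convex combination of fixed brickworks. *)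

theory Defs
  imports
    "HOL-Probability.Probability"
    "Graph_Theory.Graph_Theory"
    "Jordan_Normal_Form.Schur_Decomposition"
begin

hide_const (open) Finite_Cartesian_Product.mat Finite_Cartesian_Product.vec
no_notation vec_nth (infixl \<open>$\<close> 90)

section \<open>Matrices\<close>

definition unitary_group :: "nat \<Rightarrow> complex mat set" where
  "unitary_group N = {U \<in> carrier_mat N N. mat_adjoint U * U = 1\<^sub>m N}"

definition orthogonal_group :: "nat \<Rightarrow> complex mat set" where
  "orthogonal_group N = {U \<in> unitary_group N. elements_mat U \<subseteq> \<real>}"

definition tensor_mat :: "complex mat \<Rightarrow> complex mat \<Rightarrow> complex mat" where
  "tensor_mat A B = Matrix.mat (dim_row A * dim_row B) (dim_col A * dim_col B)
     (\<lambda>(i, j). A $$ (i div dim_row B, j div dim_col B) * B $$ (i mod dim_row B, j mod dim_col B))"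

fun tensor_power :: "nat \<Rightarrow> complex mat \<Rightarrow> complex mat" where
  "tensor_power 0 A = 1\<^sub>m 1"
| "tensor_power (Suc k) A = tensor_mat A (tensor_power k A)"

definition ketbra :: "complex Matrix.vec \<Rightarrow> complex mat" where
  "ketbra \<psi> = Matrix.mat (dim_vec \<psi>) (dim_vec \<psi>) (\<lambda>(i, j). \<psi> $ i * cnj (\<psi> $ j))"

text \<open>On \<^typ>\<open>complex\<close>, \<open>0 \<le> z\<close> means that \<open>z\<close> is real and nonnegative.\<close>

definition psd :: "complex mat \<Rightarrow> bool" where
  "psd A \<longleftrightarrow> dim_row A = dim_col A \<and> (\<forall>v \<in> carrier_vec (dim_row A). 0 \<le> (A *\<^sub>v v) \<bullet>c v)"

definition loewner_le :: "complex mat \<Rightarrow> complex mat \<Rightarrow> bool" (infix \<open>\<preceq>\<^sub>L\<close> 50) where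
  "A \<preceq>\<^sub>L B \<longleftrightarrow> psd (B - A)"

text \<open>The \<open>\<sigma>\<close>-algebra generated by the entries.\<close>

definition mat_borel :: "nat \<Rightarrow> complex mat measure" where
  "mat_borel N = vimage_algebra (carrier_mat N N)
     (\<lambda>A. \<lambda>p \<in> {..<N} \<times> {..<N}. A $$ p) (\<Pi>\<^sub>M p \<in> {..<N} \<times> {..<N}. borel)"


section \<open>Haar measure and state designs\<close>

text \<open>A probability measure with these properties exists and is unique, so quantifying
  existentially over it below amounts to speaking about \<^emph>\<open>the\<close> Haar measure.\<close>

definition is_haar_orthogonal :: "nat \<Rightarrow> complex mat measure \<Rightarrow> bool" where
  "is_haar_orthogonal N H \<longleftrightarrow>
     prob_space H \<and> sets H = sets (restrict_space (mat_borel N) (orthogonal_group N)) \<and>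
     (\<forall>V \<in> orthogonal_group N. distr H H (\<lambda>U. V * U) = H \<and> distr H H (\<lambda>U. U * V) = H)"

text \<open>\<open>k\<close>-th moment of a random state vector \<open>\<psi>\<close> of dimension \<open>N\<close> on the probability space
  \<open>M\<close>; for \<open>\<psi> = U|0\<rangle>\<close> this is the expectation of
  \<open>U\<^sup>\<otimes>\<^sup>k |0\<rangle>\<langle>0|\<^sup>\<otimes>\<^sup>k U\<^sup>\<dagger>\<^sup>\<otimes>\<^sup>k\<close>.\<close>

definition state_moment ::
  "nat \<Rightarrow> nat \<Rightarrow> 'w measure \<Rightarrow> ('w \<Rightarrow> complex Matrix.vec) \<Rightarrow> complex mat" where
  "state_moment N k M \<psi> = Matrix.mat (N ^ k) (N ^ k)
     (\<lambda>p. LINT \<omega>|M. tensor_power k (ketbra (\<psi> \<omega>)) $$ p)"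

abbreviation zero_ket :: "nat \<Rightarrow> complex Matrix.vec" where
  "zero_ket n \<equiv> unit_vec (2 ^ n) 0"

definition orthogonal_state_design ::
  "nat \<Rightarrow> nat \<Rightarrow> real \<Rightarrow> 'w measure \<Rightarrow> ('w \<Rightarrow> complex Matrix.vec) \<Rightarrow> bool" where
  "orthogonal_state_design k n \<epsilon> M \<psi> \<longleftrightarrow>
     (\<exists>H. is_haar_orthogonal (2 ^ n) H \<and>
       (let \<rho> = state_moment (2 ^ n) k H (\<lambda>U. U *\<^sub>v zero_ket n);
            \<sigma> = state_moment (2 ^ n) k M \<psi>
        in complex_of_real (1 - \<epsilon>) \<cdot>\<^sub>m \<rho> \<preceq>\<^sub>L \<sigma> \<and> \<sigma> \<preceq>\<^sub>L complex_of_real (1 + \<epsilon>) \<cdot>\<^sub>m \<rho>))"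


section \<open>Architectures\<close>

text \<open>Simple undirected graphs on the qubits \<open>0, \<dots>, n - 1\<close> (symmetric, loop-free).\<close>

definition architecture :: "nat \<Rightarrow> nat pair_pre_digraph \<Rightarrow> bool" where
  "architecture n G \<longleftrightarrow> pair_graph G \<and> pverts G = {..<n}"

definition graph_dist :: "nat pair_pre_digraph \<Rightarrow> nat \<Rightarrow> nat \<Rightarrow> ereal" where
  "graph_dist G = wf_digraph.\<mu> (with_proj G) (\<lambda>_. 1)"

definition graph_diameter :: "nat pair_pre_digraph \<Rightarrow> ereal" where
  "graph_diameter G = (SUP (x, y) \<in> pverts G \<times> pverts G. graph_dist G x y)"

definition connected_qubits :: "nat pair_pre_digraph \<Rightarrow> nat set \<Rightarrow> bool" where
  "connected_qubits G a \<longleftrightarrow>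
     a \<subseteq> pverts G \<and> Digraph_Component.connected (with_proj G \<restriction> a)"


section \<open>Circuits\<close>

text \<open>A circuit is the set of its gates \<open>(i, a, g)\<close>: layer \<open>i\<close>, support \<open>a\<close>, and the matrix
  \<open>g\<close> of dimension \<open>2 ^ card a\<close>. Layer \<open>0\<close> is applied first.
  Qubit \<open>q\<close> corresponds to bit \<open>q\<close> of a basis index; a basis index of the
  subsystem \<open>a\<close> is obtained by keeping the bits in \<open>a\<close>, in increasing order.\<close>

type_synonym circuit = "(nat \<times> nat set \<times> complex mat) set"

definition subindex :: "nat set \<Rightarrow> nat \<Rightarrow> nat" where
  "subindex a i = horner_sum of_bool 2 (map (bit i) (sorted_list_of_set a))"

text \<open>Product of gates with disjoint supports: the tensor product of all of them with the
  identity on the remaining qubits.\<close>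

definition layer_mat :: "nat \<Rightarrow> (nat set \<times> complex mat) set \<Rightarrow> complex mat" where
  "layer_mat n S = Matrix.mat (2 ^ n) (2 ^ n) (\<lambda>(i, j).
     if \<forall>q<n. q \<notin> \<Union> (fst ` S) \<longrightarrow> bit i q = bit j q
     then \<Prod>(a, g) \<in> S. g $$ (subindex a i, subindex a j) else 0)"

fun circuit_mat :: "nat \<Rightarrow> nat \<Rightarrow> circuit \<Rightarrow> complex mat" where
  "circuit_mat n 0 C = 1\<^sub>m (2 ^ n)"
| "circuit_mat n (Suc d) C = layer_mat n {s. (d, s) \<in> C} * circuit_mat n d C"

text \<open>Layers may be empty, so circuits of smaller depth are included.\<close>

definition circuits :: "nat pair_pre_digraph \<Rightarrow> nat \<Rightarrow> nat \<Rightarrow> circuit set" where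
  "circuits G r d = {C.
     (\<forall>(i, a, g) \<in> C. i < d \<and> connected_qubits G a \<and> card a \<le> r \<and> g \<in> unitary_group (2 ^ card a)) \<and>
     (\<forall>(i, a, g) \<in> C. \<forall>(i', a', g') \<in> C. i = i' \<longrightarrow> (a, g) = (a', g') \<or> a \<inter> a' = {})}"

text \<open>Random finite sets of gates: the \<open>\<sigma>\<close>-algebras generated by the events that the set
  contains a gate at a given location whose matrix lies in a given Borel set.\<close>

definition circuit_borel :: "nat pair_pre_digraph \<Rightarrow> nat \<Rightarrow> nat \<Rightarrow> circuit measure" where
  "circuit_borel G r d = sigma (circuits G r d)
     {{C \<in> circuits G r d. \<exists>g \<in> B. (i, a, g) \<in> C} | i a B. B \<in> sets (mat_borel (2 ^ card a))}"

definition gate_set_borel :: "(nat set \<times> complex mat) set measure" where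
  "gate_set_borel = sigma UNIV
     {{S. \<exists>g \<in> B. (a, g) \<in> S} | a B. B \<in> sets (mat_borel (2 ^ card a))}"

text \<open>Ensembles of circuits of depth at most \<open>d\<close> whose overall unitary is orthogonal; individual
  gates may be complex.\<close>

definition orthogonal_ensemble ::
  "nat \<Rightarrow> nat pair_pre_digraph \<Rightarrow> nat \<Rightarrow> nat \<Rightarrow> circuit measure \<Rightarrow> bool" where
  "orthogonal_ensemble n G r d E \<longleftrightarrow>
     prob_space E \<and> sets E = sets (circuit_borel G r d) \<and>
     (AE C in E. circuit_mat n d C \<in> orthogonal_group (2 ^ n))"

definition gates_on :: "nat \<Rightarrow> circuit \<Rightarrow> (nat set \<times> complex mat) set" where
  "gates_on x C = {(a, g). x \<in> a \<and> (\<exists>i. (i, a, g) \<in> C)}"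

definition locally_independent :: "nat pair_pre_digraph \<Rightarrow> circuit measure \<Rightarrow> bool" where
  "locally_independent G E \<longleftrightarrow>
     (\<forall>x \<in> pverts G. \<forall>y \<in> pverts G. graph_dist G x y \<ge> graph_diameter G / 2 \<longrightarrow>
        prob_space.indep_var E gate_set_borel (gates_on x) gate_set_borel (gates_on y))"


section \<open>Brickworks\<close>

text \<open>Each layer is given by a partition of the qubits together with the parts on which a
  Haar-random gate is drawn; the identity is applied on the other parts.\<close>

type_synonym layout = "(nat set set \<times> nat set set) list"

definition layouts :: "nat pair_pre_digraph \<Rightarrow> nat \<Rightarrow> nat \<Rightarrow> layout set" where
  "layouts G r d = {b. length b \<le> d \<and>
     (\<forall>(A, R) \<in> set b. partition_on (pverts G) A \<and> R \<subseteq> A \<and>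
        (\<forall>a \<in> A. card a \<le> r \<and> connected_qubits G a))}"

text \<open>\<open>haar m\<close> is the distribution of the random gates on \<open>m\<close> qubits.\<close>

definition fixed_brickwork ::
  "nat pair_pre_digraph \<Rightarrow> nat \<Rightarrow> nat \<Rightarrow> (nat \<Rightarrow> complex mat measure) \<Rightarrow> layout \<Rightarrow> circuit measure" where
  "fixed_brickwork G r d haar b =
     (let I = (SIGMA i:{..<length b}. snd (b ! i))
      in distr (Pi\<^sub>M I (\<lambda>(i, a). haar (card a))) (circuit_borel G r d)
           (\<lambda>\<omega>. {(i, a, \<omega> (i, a)) | i a. (i, a) \<in> I}))"

text \<open>There are finitely many layouts, so \<open>w\<close> ranges over all their convex combinations.\<close>

definition generalized_random_brickwork ::
  "nat pair_pre_digraph \<Rightarrow> nat \<Rightarrow> nat \<Rightarrow> circuit measure \<Rightarrow> bool" where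
  "generalized_random_brickwork G r d E \<longleftrightarrow>
     sets E = sets (circuit_borel G r d) \<and>
     (\<exists>haar w. (\<forall>m. is_haar_orthogonal (2 ^ m) (haar m)) \<and>
        (\<forall>b \<in> layouts G r d. 0 \<le> w b) \<and> (\<Sum>b \<in> layouts G r d. w b) = 1 \<and>
        (\<forall>A \<in> sets E. measure E A =
           (\<Sum>b \<in> layouts G r d. w b * measure (fixed_brickwork G r d haar b) A)))"

end

(*
  Both parts test the design with the quadratic form of the vectorization of a real symmetric,
  traceless involution A: the Loewner bounds give
    (1 - eps) * 2 / (2^n + 2) <= E |<psi|A|psi>|^2 <= (1 + eps) * 2 / (2^n + 2).

  Part 1 takes A = J_x J_y with J = i Y real antisymmetric. An orthogonal circuit U prepares a real
  state, so <J_x> = <J_y> = 0; as long as the lightcones of x and y are disjoint, <J_x J_y> factorizes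
  and vanishes for every circuit, contradicting the lower bound.

  Part 2 takes A = Z on one qubit. Evolved backwards through a Haar gate on m <= r qubits, Z keeps
  weight at least 4^(-r) on itself, so E <Z>^2 >= 4^(-r d), which contradicts the upper bound
  unless d is linear in n.
*)
theory Submission
  imports Defs
begin

section \<open>Adjoints, unitary and orthogonal matrices\<close>

section \<open>Matrices\<close>

text \<open>For real psi the overlap of psi tensor psi with the vectorization of A is psi^T A psi,
  so the quadratic form of the second moment at that vector is E (psi^T A psi)^2; reality of the
  prepared state enters already here. The value 2 / (2^n + 2) is the average (2 tr A^2 + (tr A)^2) /
  (N (N + 2)) over real unit vectors, with N = 2^n, tr A = 0 and tr A^2 = N. It is obtained from
  invariance under coordinate reflections alone.

  Part 1 wants one-qubit observables whose expectation vanishes in every real state, which forces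
  antisymmetry, while an antisymmetric A would make the test trivial. A product of two commuting
  antisymmetric matrices is symmetric and escapes this. Only the total unitary has to be real, so
  complex gates do no harm.

  In Part 2 the evolved Z is a sum of many operators whose contributions could cancel. This is
  prevented because averaging over one Haar gate makes diagonal and off-diagonal entries of the
  evolved observable uncorrelated, whatever the state below the gate is; Fubini then handles one
  gate per layer.\<close>

lemma dim_mat_adjoint [simp]:
  "dim_row (mat_adjoint A) = dim_col A" "dim_col (mat_adjoint A) = dim_row A"
  by (auto simp: mat_adjoint_def mat_of_rows_def)

lemma mat_adjoint_carrier [simp, intro]:
  "A \<in> carrier_mat m n \<Longrightarrow> mat_adjoint A \<in> carrier_mat n m"
  by (intro carrier_matI) simp_all

lemma index_mat_adjoint [simp]:
  fixes A :: "complex mat"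
  assumes "i < dim_col A" "j < dim_row A"
  shows "mat_adjoint A $$ (i, j) = cnj (A $$ (j, i))"
  using assms by (auto simp: mat_adjoint_def mat_of_rows_def conjugate_vec_def)

lemma mat_mult_index:
  fixes A B :: "complex mat"
  assumes "A \<in> carrier_mat l m" "B \<in> carrier_mat m n" "i < l" "j < n"
  shows "(A * B) $$ (i, j) = (\<Sum>k<m. A $$ (i, k) * B $$ (k, j))"
  using assms by (auto simp: scalar_prod_def atLeast0LessThan)

lemma mat_adjoint_mult:
  fixes A B :: "complex mat"
  assumes "A \<in> carrier_mat l m" "B \<in> carrier_mat m n"
  shows "mat_adjoint (A * B) = mat_adjoint B * mat_adjoint A"
proof (rule eq_matI)
  fix i j assume "i < dim_row (mat_adjoint B * mat_adjoint A)"
    "j < dim_col (mat_adjoint B * mat_adjoint A)"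
  then have "i < n" "j < l" using assms by auto
  then have "mat_adjoint (A * B) $$ (i, j) = cnj ((A * B) $$ (j, i))"
    using assms by (subst index_mat_adjoint) auto
  also have "\<dots> = (\<Sum>k<m. cnj (A $$ (j, k)) * cnj (B $$ (k, i)))"
    using assms \<open>i < n\<close> \<open>j < l\<close> by (subst mat_mult_index) auto
  also have "\<dots> = (\<Sum>k<m. mat_adjoint B $$ (i, k) * mat_adjoint A $$ (k, j))"
    using assms \<open>i < n\<close> \<open>j < l\<close> by (intro sum.cong) auto
  also have "\<dots> = (mat_adjoint B * mat_adjoint A) $$ (i, j)"
    using assms \<open>i < n\<close> \<open>j < l\<close> by (subst mat_mult_index) auto
  finally show "mat_adjoint (A * B) $$ (i, j) = (mat_adjoint B * mat_adjoint A) $$ (i, j)" .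
qed (use assms in auto)

lemma mat_adjoint_one [simp]: "mat_adjoint (1\<^sub>m n :: complex mat) = 1\<^sub>m n"
  by (rule eq_matI) auto

lemma unitary_groupD:
  assumes "U \<in> unitary_group N"
  shows "U \<in> carrier_mat N N" "mat_adjoint U * U = 1\<^sub>m N" "U * mat_adjoint U = 1\<^sub>m N"
proof -
  show "U \<in> carrier_mat N N" "mat_adjoint U * U = 1\<^sub>m N"
    using assms by (auto simp: unitary_group_def)
  then show "U * mat_adjoint U = 1\<^sub>m N"
    using mat_mult_left_right_inverse[of "mat_adjoint U" N U] by auto
qed

lemma orthogonal_group_unitary: "U \<in> orthogonal_group N \<Longrightarrow> U \<in> unitary_group N"
  by (simp add: orthogonal_group_def)

lemma mult_carrier_square [simp]:
  "A \<in> carrier_mat N N \<Longrightarrow> B \<in> carrier_mat N N \<Longrightarrow> A * B \<in> carrier_mat N N"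
  by (rule mult_carrier_mat)

text \<open>Heisenberg evolution through a product meets the last factor \<open>L\<close> first.
  This is the form in which the inductions over layers absorb the last layer into the
  observable.\<close>

lemma conj_conj:
  fixes A L U :: "complex mat"
  assumes "A \<in> carrier_mat N N" "L \<in> carrier_mat N N" "U \<in> carrier_mat N N"
  shows "mat_adjoint (L * U) * A * (L * U) = mat_adjoint U * (mat_adjoint L * A * L) * U"
proof -
  have "mat_adjoint (L * U) * A * (L * U) = mat_adjoint U * mat_adjoint L * A * (L * U)"
    using assms by (simp add: mat_adjoint_mult)
  also have "\<dots> = mat_adjoint U * mat_adjoint L * A * L * U"
    using assms by (subst assoc_mult_mat[symmetric, of _ N N _ N _ N]) auto
  also have "\<dots> = mat_adjoint U * (mat_adjoint L * A * L) * U"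
    using assms by (simp add: assoc_mult_mat[of _ N N _ N _ N])
  finally show ?thesis .
qed

text \<open>Inserting \<open>U * mat_adjoint U = 1\<close> between the factors lets
  \<open>J n x\<close> and \<open>J n y\<close> evolve separately.\<close>

lemma conj_mult:
  assumes "U \<in> unitary_group N" "A \<in> carrier_mat N N" "B \<in> carrier_mat N N"
  shows "mat_adjoint U * (A * B) * U = (mat_adjoint U * A * U) * (mat_adjoint U * B * U)"
proof -
  note U = unitary_groupD[OF assms(1)]
  note assoc = assoc_mult_mat[of _ N N _ N _ N]
  have "(mat_adjoint U * A * U) * (mat_adjoint U * B * U)
      = mat_adjoint U * A * (U * mat_adjoint U) * B * U"
    using assms U(1) by (simp add: assoc)
  also have "\<dots> = mat_adjoint U * (A * B) * U"
    using assms U by (simp add: assoc)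
  finally show ?thesis by simp
qed

lemma unitary_mult:
  assumes "U \<in> unitary_group N" "V \<in> unitary_group N"
  shows "U * V \<in> unitary_group N"
proof -
  note U = unitary_groupD[OF assms(1)] and V = unitary_groupD[OF assms(2)]
  have "mat_adjoint (U * V) * 1\<^sub>m N * (U * V) = mat_adjoint V * (mat_adjoint U * 1\<^sub>m N * U) * V"
    by (rule conj_conj) (use U V in auto)
  then show ?thesis using U V by (auto simp: unitary_group_def)
qed

lemma orthogonal_group_real:
  assumes "U \<in> orthogonal_group N" "i < N" "j < N"
  shows "U $$ (i, j) \<in> \<real>"
  using assms elements_matI[of U N N i j] by (auto simp: orthogonal_group_def unitary_group_def)

lemma orthogonal_groupI:
  assumes "U \<in> unitary_group N" "\<And>i j. i < N \<Longrightarrow> j < N \<Longrightarrow> U $$ (i, j) \<in> \<real>"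
  shows "U \<in> orthogonal_group N"
  using assms by (auto simp: orthogonal_group_def unitary_group_def elements_mat_def)

lemma orthogonal_mult:
  assumes "U \<in> orthogonal_group N" "V \<in> orthogonal_group N"
  shows "U * V \<in> orthogonal_group N"
proof (rule orthogonal_groupI)
  show "U * V \<in> unitary_group N"
    using assms by (intro unitary_mult orthogonal_group_unitary)
  fix i j assume "i < N" "j < N"
  then show "(U * V) $$ (i, j) \<in> \<real>"
    using assms unitary_groupD(1)[OF orthogonal_group_unitary]
    by (subst mat_mult_index[of _ N N _ N]) (auto intro!: sum_in_Reals Reals_mult orthogonal_group_real)
qed

lemma unitary_entry_norm_le:
  assumes "U \<in> unitary_group N" "i < N" "j < N"
  shows "norm (U $$ (i, j)) \<le> 1"
proof -
  note U = unitary_groupD[OF assms(1)]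
  have "1 = (mat_adjoint U * U) $$ (j, j)" using U assms by auto
  also have "\<dots> = (\<Sum>k<N. cnj (U $$ (k, j)) * U $$ (k, j))"
    using U assms by (subst mat_mult_index[of _ N N _ N]) auto
  also have "\<dots> = complex_of_real (\<Sum>k<N. (norm (U $$ (k, j)))\<^sup>2)"
    unfolding of_real_sum complex_norm_square by (simp add: mult.commute)
  finally have "(\<Sum>k<N. (norm (U $$ (k, j)))\<^sup>2) = 1"
    using of_real_eq_1_iff by metis
  moreover have "(norm (U $$ (i, j)))\<^sup>2 \<le> (\<Sum>k<N. (norm (U $$ (k, j)))\<^sup>2)"
    using assms by (intro member_le_sum) auto
  ultimately show ?thesis by (simp add: power_le_one_iff abs_square_le_1)
qed


section \<open>Operators supported on a subset of the qubits\<close>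

section \<open>Local operators\<close>

definition from_bits :: "nat \<Rightarrow> (nat \<Rightarrow> bool) \<Rightarrow> nat" where
  "from_bits n P = horner_sum of_bool 2 (map P [0..<n])"

lemma from_bits_less [simp]: "from_bits n P < 2 ^ n"
  using horner_sum_bound[of "map P [0..<n]"]
  by (simp add: from_bits_def)

lemma bit_from_bits [simp]: "bit (from_bits n P) q \<longleftrightarrow> q < n \<and> P q"
  by (auto simp: from_bits_def bit_horner_sum_bit_iff)

lemma nat_bit_eqI:
  assumes "i < 2 ^ n" "j < 2 ^ n" "\<And>q. q < n \<Longrightarrow> bit i q = bit (j :: nat) q"
  shows "i = j"
proof (rule bit_eqI)
  fix q
  have "bit i q = bit (take_bit n i) q" "bit j q = bit (take_bit n j) q"
    using assms by (auto simp: take_bit_nat_eq_self)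
  then show "bit i q = bit j q" using assms(3)[of q] by (auto simp: bit_take_bit_iff)
qed

definition agree :: "nat \<Rightarrow> nat set \<Rightarrow> nat \<Rightarrow> nat \<Rightarrow> bool" where
  "agree n T i j \<longleftrightarrow> (\<forall>q<n. q \<in> T \<longrightarrow> bit i q = bit j q)"

definition merge :: "nat \<Rightarrow> nat set \<Rightarrow> nat \<Rightarrow> nat \<Rightarrow> nat" where
  "merge n T i j = from_bits n (\<lambda>q. if q \<in> T then bit i q else bit j q)"

lemma merge_less [simp]: "merge n T i j < 2 ^ n"
  by (simp add: merge_def)

lemma bit_merge [simp]: "bit (merge n T i j) q \<longleftrightarrow> q < n \<and> (if q \<in> T then bit i q else bit j q)"
  by (simp add: merge_def)

text \<open>Operators of the form \<open>X\<^sub>T \<otimes> 1\<close>, acting trivially outside \<open>T\<close>.\<close>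

definition local_on :: "nat \<Rightarrow> nat set \<Rightarrow> complex mat \<Rightarrow> bool" where
  "local_on n T X \<longleftrightarrow> X \<in> carrier_mat (2 ^ n) (2 ^ n) \<and>
     (\<forall>i<2 ^ n. \<forall>j<2 ^ n. \<not> agree n (- T) i j \<longrightarrow> X $$ (i, j) = 0) \<and>
     (\<forall>i<2 ^ n. \<forall>j<2 ^ n. \<forall>i'<2 ^ n. \<forall>j'<2 ^ n.
        agree n (- T) i j \<longrightarrow> agree n (- T) i' j' \<longrightarrow> agree n T i i' \<longrightarrow> agree n T j j' \<longrightarrow>
        X $$ (i, j) = X $$ (i', j'))"

lemma local_on_carrier: "local_on n T X \<Longrightarrow> X \<in> carrier_mat (2 ^ n) (2 ^ n)"
  by (simp add: local_on_def)

lemma local_on_zero: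
  "local_on n T X \<Longrightarrow> i < 2 ^ n \<Longrightarrow> j < 2 ^ n \<Longrightarrow> \<not> agree n (- T) i j \<Longrightarrow> X $$ (i, j) = 0"
  by (simp add: local_on_def)

lemma local_on_eq:
  assumes "local_on n T X" "i < 2 ^ n" "j < 2 ^ n" "i' < 2 ^ n" "j' < 2 ^ n"
    "agree n (- T) i j" "agree n (- T) i' j'" "agree n T i i'" "agree n T j j'"
  shows "X $$ (i, j) = X $$ (i', j')"
  using assms unfolding local_on_def by blast

lemma local_on_mono:
  assumes "local_on n T X" "T \<subseteq> T'"
  shows "local_on n T' X"
  unfolding local_on_def
proof (intro conjI allI impI)
  show "X \<in> carrier_mat (2 ^ n) (2 ^ n)" using assms local_on_carrier by blast
next
  fix i j assume "i < 2 ^ n" "j < 2 ^ n" "\<not> agree n (- T') i j"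
  then show "X $$ (i, j) = 0"
    using assms by (intro local_on_zero[OF assms(1)]) (auto simp: agree_def)
next
  fix i j i' j' :: nat
  assume *: "i < 2 ^ n" "j < 2 ^ n" "i' < 2 ^ n" "j' < 2 ^ n"
    "agree n (- T') i j" "agree n (- T') i' j'" "agree n T' i i'" "agree n T' j j'"
  have same: "agree n (- T) i j \<longleftrightarrow> agree n (- T) i' j'"
    using * unfolding agree_def by (metis ComplI Compl_iff)
  show "X $$ (i, j) = X $$ (i', j')"
  proof (cases "agree n (- T) i j")
    case True
    have "agree n T i i'" "agree n T j j'" using *(7,8) assms(2) by (auto simp: agree_def)
    then show ?thesis using True same local_on_eq[OF assms(1) *(1-4)] by simp
  next
    case False
    then show ?thesis using * same local_on_zero[OF assms(1)] by simp
  qed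
qed

text \<open>Only intermediate indices that agree with \<open>i\<close> outside \<open>T\<close>
  contribute. Overwriting their bits outside \<open>T\<close> by those of \<open>i'\<close> matches
  them with the intermediate indices for \<open>i'\<close>.\<close>

lemma local_on_mult:
  assumes "local_on n T X" "local_on n T Y"
  shows "local_on n T (X * Y)"
proof -
  note X = local_on_carrier[OF assms(1)] and Y = local_on_carrier[OF assms(2)]
  have XY: "(X * Y) $$ (i, j) = (\<Sum>k | k < 2 ^ n \<and> agree n (- T) k i. X $$ (i, k) * Y $$ (k, j))"
    if "i < 2 ^ n" "j < 2 ^ n" for i j
  proof -
    have "\<not> agree n (- T) k i \<Longrightarrow> X $$ (i, k) = 0" if "k < 2 ^ n" for k
      using that \<open>i < 2 ^ n\<close> by (intro local_on_zero[OF assms(1)]) (auto simp: agree_def)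
    then have "X $$ (i, k) \<noteq> 0 \<Longrightarrow> agree n (- T) k i" if "k < 2 ^ n" for k
      using that by blast
    then show ?thesis
      using that X Y by (subst mat_mult_index[of _ "2 ^ n" "2 ^ n" _ "2 ^ n"])
        (auto intro!: sum.mono_neutral_right)
  qed
  show ?thesis unfolding local_on_def
  proof (intro conjI allI impI)
    fix i j assume "i < 2 ^ n" "j < 2 ^ n" "\<not> agree n (- T) i j"
    then show "(X * Y) $$ (i, j) = 0"
      unfolding XY[OF \<open>i < 2 ^ n\<close> \<open>j < 2 ^ n\<close>]
      by (intro sum.neutral ballI) (auto intro!: disjI2 local_on_zero[OF assms(2)] simp: agree_def)
  next
    fix i j i' j' :: nat
    assume *: "i < 2 ^ n" "j < 2 ^ n" "i' < 2 ^ n" "j' < 2 ^ n"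
      "agree n (- T) i j" "agree n (- T) i' j'" "agree n T i i'" "agree n T j j'"
    show "(X * Y) $$ (i, j) = (X * Y) $$ (i', j')"
      unfolding XY[OF *(1,2)] XY[OF *(3,4)]
    proof (rule sum.reindex_bij_witness[of _ "\<lambda>k. merge n T k i" "\<lambda>k. merge n T k i'"])
      fix k assume k: "k \<in> {k. k < 2 ^ n \<and> agree n (- T) k i}"
      show "merge n T (merge n T k i') i = k"
        using k by (intro nat_bit_eqI[of _ n]) (auto simp: agree_def)
      show "merge n T k i' \<in> {k. k < 2 ^ n \<and> agree n (- T) k i'}" by (auto simp: agree_def)
      have "X $$ (i, k) = X $$ (i', merge n T k i')" "Y $$ (k, j) = Y $$ (merge n T k i', j')"
        using k * by (auto intro!: local_on_eq[OF assms(1)] local_on_eq[OF assms(2)] simp: agree_def)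
      then show "X $$ (i', merge n T k i') * Y $$ (merge n T k i', j') = X $$ (i, k) * Y $$ (k, j)"
        by simp
    next
      fix k assume k: "k \<in> {k. k < 2 ^ n \<and> agree n (- T) k i'}"
      show "merge n T (merge n T k i) i' = k"
        using k by (intro nat_bit_eqI[of _ n]) (auto simp: agree_def)
      show "merge n T k i \<in> {k. k < 2 ^ n \<and> agree n (- T) k i}" by (auto simp: agree_def)
    qed
  qed (use X Y in auto)
qed

lemma local_on_adjoint:
  assumes "local_on n T X"
  shows "local_on n T (mat_adjoint X)"
proof -
  note X = local_on_carrier[OF assms]
  show ?thesis unfolding local_on_def
  proof (intro conjI allI impI)
    fix i j assume "i < 2 ^ n" "j < 2 ^ n" "\<not> agree n (- T) i j"
    then show "mat_adjoint X $$ (i, j) = 0"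
      using X local_on_zero[OF assms, of j i] by (auto simp: agree_def)
  next
    fix i j i' j' :: nat
    assume *: "i < 2 ^ n" "j < 2 ^ n" "i' < 2 ^ n" "j' < 2 ^ n"
      "agree n (- T) i j" "agree n (- T) i' j'" "agree n T i i'" "agree n T j j'"
    then have "X $$ (j, i) = X $$ (j', i')"
      by (intro local_on_eq[OF assms]) (auto simp: agree_def)
    then show "mat_adjoint X $$ (i, j) = mat_adjoint X $$ (i', j')"
      using X * by auto
  qed (use X in auto)
qed

text \<open>\<open>X\<close> can change only bits in \<open>T\<close> and \<open>Y\<close> only bits
  in \<open>T'\<close>, so a single intermediate index survives: the one with the bits of
  \<open>j\<close> on \<open>T\<close> and those of \<open>i\<close> elsewhere. Commutation, the
  factorization of layers and the factorization of expectations all follow from this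
  formula.\<close>

lemma mult_local_disjoint:
  assumes "local_on n T X" "local_on n T' Y" "T \<inter> T' = {}" "i < 2 ^ n" "j < 2 ^ n"
  shows "(X * Y) $$ (i, j) = (if agree n (- (T \<union> T')) i j
           then X $$ (i, merge n T j i) * Y $$ (i, merge n T' j i) else 0)"
proof -
  note X = local_on_carrier[OF assms(1)] and Y = local_on_carrier[OF assms(2)]
  define m where "m = merge n T j i"
  have "(X * Y) $$ (i, j) = (\<Sum>k<2 ^ n. X $$ (i, k) * Y $$ (k, j))"
    using assms X Y by (subst mat_mult_index[of _ "2 ^ n" "2 ^ n" _ "2 ^ n"]) auto
  also have "\<dots> = (\<Sum>k\<in>{m}. X $$ (i, k) * Y $$ (k, j))"
  proof (rule sum.mono_neutral_right)
    show "\<forall>k\<in>{..<2 ^ n} - {m}. X $$ (i, k) * Y $$ (k, j) = 0"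
    proof
      fix k assume k: "k \<in> {..<2 ^ n} - {m}"
      then have "k \<noteq> m" by simp
      then obtain q where "q < n" "bit k q \<noteq> bit m q"
        using k nat_bit_eqI[of k n m] by (auto simp: m_def)
      then have "\<not> (agree n (- T) i k \<and> agree n (- T') k j)"
        using assms(3) by (cases "q \<in> T") (auto simp: agree_def m_def)
      then show "X $$ (i, k) * Y $$ (k, j) = 0"
        using local_on_zero[OF assms(1)] local_on_zero[OF assms(2)] assms k by auto
    qed
  qed (auto simp: m_def)
  also have "\<dots> = X $$ (i, m) * Y $$ (m, j)" by simp
  also have "\<dots> = (if agree n (- (T \<union> T')) i j
           then X $$ (i, merge n T j i) * Y $$ (i, merge n T' j i) else 0)"
  proof (cases "agree n (- (T \<union> T')) i j")
    case True
    then have "Y $$ (m, j) = Y $$ (i, merge n T' j i)"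
      using assms by (intro local_on_eq[OF assms(2)]) (auto simp: agree_def m_def)
    then show ?thesis using True by (simp add: m_def)
  next
    case False
    then have "\<not> agree n (- T') m j" by (auto simp: agree_def m_def)
    then show ?thesis using False local_on_zero[OF assms(2)] assms by (simp add: m_def)
  qed
  finally show ?thesis .
qed

lemma local_commute:
  assumes "local_on n T X" "local_on n T' Y" "T \<inter> T' = {}"
  shows "X * Y = Y * X"
proof (rule eq_matI)
  fix i j assume "i < dim_row (Y * X)" "j < dim_col (Y * X)"
  then have "i < 2 ^ n" "j < 2 ^ n"
    using local_on_carrier[OF assms(1)] local_on_carrier[OF assms(2)] by auto
  moreover have "T' \<inter> T = {}" using assms by auto
  ultimately show "(X * Y) $$ (i, j) = (Y * X) $$ (i, j)"
    using mult_local_disjoint[OF assms] mult_local_disjoint[OF assms(2,1)]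
    by (auto simp: Un_commute)
qed (use local_on_carrier[OF assms(1)] local_on_carrier[OF assms(2)] in auto)


section \<open>Gates and layers as operators, and conjugation by a layer\<close>

section \<open>Layers\<close>

lemma bit_subindex:
  assumes "finite a"
  shows "bit (subindex a i) t \<longleftrightarrow> t < card a \<and> bit i (sorted_list_of_set a ! t)"
  using assms by (auto simp: subindex_def bit_horner_sum_bit_iff)

lemma subindex_less:
  assumes "finite a"
  shows "subindex a i < 2 ^ card a"
  using horner_sum_bound[of "map (bit i) (sorted_list_of_set a)"] assms
  by (simp add: subindex_def)

lemma subindex_eq_iff:
  assumes "finite a"
  shows "subindex a i = subindex a j \<longleftrightarrow> (\<forall>q\<in>a. bit i q = bit j q)"
proof
  assume eq: "subindex a i = subindex a j"
  show "\<forall>q\<in>a. bit i q = bit j q"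
  proof
    fix q assume "q \<in> a"
    then obtain t where "t < card a" "q = sorted_list_of_set a ! t"
      using assms by (metis in_set_conv_nth length_sorted_list_of_set set_sorted_list_of_set)
    then show "bit i q = bit j q" using eq assms by (metis bit_subindex)
  qed
next
  assume "\<forall>q\<in>a. bit i q = bit j q"
  then have "map (bit i) (sorted_list_of_set a) = map (bit j) (sorted_list_of_set a)"
    using assms by (intro map_cong) auto
  then show "subindex a i = subindex a j" unfolding subindex_def by (rule arg_cong)
qed

lemma subindex_cong:
  assumes "a \<subseteq> {..<n}" "agree n a i j"
  shows "subindex a i = subindex a j"
  using assms finite_subset[OF assms(1)]
  by (subst subindex_eq_iff) (auto simp: agree_def)

text \<open>Turns a sum over intermediate indices of the whole system into a sum over the basis of
  the subsystem \<open>a\<close>, which makes \<open>embed\<close> multiplicative.\<close>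

lemma bij_betw_subindex:
  assumes "a \<subseteq> {..<n}"
  shows "bij_betw (subindex a) {k. k < 2 ^ n \<and> agree n (- a) i k} {..<2 ^ card a}"
proof (rule bij_betwI')
  have fin: "finite a" using assms finite_subset by blast
  fix x y assume *: "x \<in> {k. k < 2 ^ n \<and> agree n (- a) i k}" "y \<in> {k. k < 2 ^ n \<and> agree n (- a) i k}"
  show "(subindex a x = subindex a y) = (x = y)"
  proof
    assume "subindex a x = subindex a y"
    then have "\<forall>q\<in>a. bit x q = bit y q" by (simp add: subindex_eq_iff[OF fin])
    moreover have "bit x q = bit y q" if "q < n" "q \<notin> a" for q
      using * that by (auto simp: agree_def)
    ultimately show "x = y" using * by (intro nat_bit_eqI[of x n y]) auto
  qed simp
next
  fix x show "subindex a x \<in> {..<2 ^ card a}"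
    using subindex_less assms finite_subset[OF assms] by auto
next
  fix p :: nat assume p: "p \<in> {..<2 ^ card a}"
  have fin: "finite a" using assms finite_subset by blast
  let ?l = "sorted_list_of_set a"
  \<comment> \<open>\<open>?t\<close> sends a qubit of \<open>a\<close> to its position in the
    sorted list, so \<open>?k\<close> spreads the bits of \<open>p\<close> over \<open>a\<close> and
    copies \<open>i\<close> elsewhere.\<close>
  let ?t = "the_inv_into {..<card a} ((!) ?l)"
  let ?k = "from_bits n (\<lambda>q. if q \<in> a then bit p (?t q) else bit i q)"
  have inj: "inj_on ((!) ?l) {..<card a}"
    using fin by (auto simp: inj_on_def nth_eq_iff_index_eq)
  have "subindex a ?k = p"
  proof (rule nat_bit_eqI)
    fix t assume t: "t < card a"
    then have "?l ! t \<in> a" using fin by (metis length_sorted_list_of_set nth_mem set_sorted_list_of_set)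
    moreover have "?t (?l ! t) = t" using inj t by (auto intro: the_inv_into_f_f)
    ultimately show "bit (subindex a ?k) t = bit p t"
      using t assms by (auto simp: bit_subindex[OF fin])
  qed (use p subindex_less[OF fin] in auto)
  then show "\<exists>x\<in>{k. k < 2 ^ n \<and> agree n (- a) i k}. p = subindex a x"
    by (intro bexI[of _ ?k]) (auto simp: agree_def)
qed

lemma layer_mat_carrier [simp]: "layer_mat n S \<in> carrier_mat (2 ^ n) (2 ^ n)"
  by (simp add: layer_mat_def)

lemma dim_layer_mat [simp]: "dim_row (layer_mat n S) = 2 ^ n" "dim_col (layer_mat n S) = 2 ^ n"
  by (simp_all add: layer_mat_def)

lemma layer_mat_index:
  assumes "i < 2 ^ n" "j < 2 ^ n"
  shows "layer_mat n S $$ (i, j) = (if agree n (- \<Union> (fst ` S)) i j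
           then \<Prod>(a, g)\<in>S. g $$ (subindex a i, subindex a j) else 0)"
  using assms by (simp add: layer_mat_def agree_def)

lemma layer_mat_empty [simp]: "layer_mat n {} = 1\<^sub>m (2 ^ n)"
  by (rule eq_matI) (auto simp: layer_mat_index agree_def intro: nat_bit_eqI)

lemma layer_mat_local:
  assumes "\<Union> (fst ` S) \<subseteq> {..<n}"
  shows "local_on n (\<Union> (fst ` S)) (layer_mat n S)"
  unfolding local_on_def
proof (intro conjI allI impI)
  fix i j i' j' :: nat
  assume *: "i < 2 ^ n" "j < 2 ^ n" "i' < 2 ^ n" "j' < 2 ^ n"
    "agree n (- \<Union> (fst ` S)) i j" "agree n (- \<Union> (fst ` S)) i' j'"
    "agree n (\<Union> (fst ` S)) i i'" "agree n (\<Union> (fst ` S)) j j'"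
  have "subindex a i = subindex a i' \<and> subindex a j = subindex a j'" if "(a, g) \<in> S" for a g
    using that assms *(7,8) by (intro conjI subindex_cong[of a n]) (force simp: agree_def)+
  then show "layer_mat n S $$ (i, j) = layer_mat n S $$ (i', j')"
    using * by (auto simp: layer_mat_index intro!: prod.cong)
qed (auto simp: layer_mat_index)

lemma layer_mat_Un:
  assumes "finite S1" "finite S2" "S1 \<inter> S2 = {}"
    and "\<Union> (fst ` S1) \<subseteq> {..<n}" "\<Union> (fst ` S2) \<subseteq> {..<n}"
    and disj: "\<Union> (fst ` S1) \<inter> \<Union> (fst ` S2) = {}"
  shows "layer_mat n (S1 \<union> S2) = layer_mat n S1 * layer_mat n S2"
proof (rule eq_matI)
  let ?T1 = "\<Union> (fst ` S1)" and ?T2 = "\<Union> (fst ` S2)"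
  fix i j assume "i < dim_row (layer_mat n S1 * layer_mat n S2)" "j < dim_col (layer_mat n S1 * layer_mat n S2)"
  then have ij: "i < 2 ^ n" "j < 2 ^ n" by (auto simp: layer_mat_def)
  have sub: "subindex a (merge n T j i) = subindex a j" if "a \<subseteq> T" "a \<subseteq> {..<n}" for a T
    using that by (intro subindex_cong[of a n]) (auto simp: agree_def)
  have sub1: "subindex a (merge n ?T1 j i) = subindex a j" if "(a, g) \<in> S1" for a g
    using that assms(4) by (intro sub) force+
  have sub2: "subindex a (merge n ?T2 j i) = subindex a j" if "(a, g) \<in> S2" for a g
    using that assms(5) by (intro sub) force+
  have 1: "layer_mat n S1 $$ (i, merge n ?T1 j i) = (\<Prod>(a, g)\<in>S1. g $$ (subindex a i, subindex a j))"
    using ij sub1 by (subst layer_mat_index) (auto simp: agree_def intro!: prod.cong)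
  have 2: "layer_mat n S2 $$ (i, merge n ?T2 j i) = (\<Prod>(a, g)\<in>S2. g $$ (subindex a i, subindex a j))"
    using ij sub2 by (subst layer_mat_index) (auto simp: agree_def intro!: prod.cong)
  have "fst ` (S1 \<union> S2) = fst ` S1 \<union> fst ` S2" by (rule image_Un)
  then have supp: "\<Union> (fst ` (S1 \<union> S2)) = ?T1 \<union> ?T2" by simp
  show "layer_mat n (S1 \<union> S2) $$ (i, j) = (layer_mat n S1 * layer_mat n S2) $$ (i, j)"
    unfolding mult_local_disjoint[OF layer_mat_local[OF assms(4)] layer_mat_local[OF assms(5)] disj ij]
      layer_mat_index[OF ij] supp 1 2 prod.union_disjoint[OF assms(1-3)] ..
qed (auto simp: layer_mat_def)

abbreviation embed :: "nat \<Rightarrow> nat set \<Rightarrow> complex mat \<Rightarrow> complex mat" where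
  "embed n a g \<equiv> layer_mat n {(a, g)}"

lemma embed_index:
  assumes "i < 2 ^ n" "j < 2 ^ n"
  shows "embed n a g $$ (i, j) = (if agree n (- a) i j then g $$ (subindex a i, subindex a j) else 0)"
  using assms by (simp add: layer_mat_index)

lemma embed_local:
  assumes "a \<subseteq> {..<n}"
  shows "local_on n a (embed n a g)"
  using layer_mat_local[of "{(a, g)}" n] assms by simp

lemma embed_mult:
  assumes "a \<subseteq> {..<n}" "g \<in> carrier_mat (2 ^ card a) (2 ^ card a)" "h \<in> carrier_mat (2 ^ card a) (2 ^ card a)"
  shows "embed n a (g * h) = embed n a g * embed n a h"
proof (rule eq_matI)
  have fin: "finite a" using assms finite_subset by blast
  note sub = subindex_less[OF fin]
  fix i j assume "i < dim_row (embed n a g * embed n a h)" "j < dim_col (embed n a g * embed n a h)"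
  then have ij: "i < 2 ^ n" "j < 2 ^ n" by (auto simp: layer_mat_def)
  let ?K = "{k. k < 2 ^ n \<and> agree n (- a) i k}"
  have agr: "agree n (- a) k j \<longleftrightarrow> agree n (- a) i j" if "k \<in> ?K" for k
    using that by (auto simp: agree_def)
  have "(embed n a g * embed n a h) $$ (i, j) = (\<Sum>k<2 ^ n. embed n a g $$ (i, k) * embed n a h $$ (k, j))"
    using ij by (subst mat_mult_index[of _ "2 ^ n" "2 ^ n" _ "2 ^ n"]) auto
  also have "\<dots> = (\<Sum>k\<in>?K. embed n a g $$ (i, k) * embed n a h $$ (k, j))"
    using ij by (intro sum.mono_neutral_right) (auto simp: embed_index)
  also have "\<dots> = (\<Sum>k\<in>?K. (\<lambda>p. if agree n (- a) i j then g $$ (subindex a i, p) * h $$ (p, subindex a j) else 0) (subindex a k))"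
    using ij agr by (intro sum.cong) (auto simp: embed_index)
  also have "\<dots> = (\<Sum>p<2 ^ card a. if agree n (- a) i j then g $$ (subindex a i, p) * h $$ (p, subindex a j) else 0)"
    by (rule sum.reindex_bij_betw[OF bij_betw_subindex[OF assms(1)]])
  also have "\<dots> = (if agree n (- a) i j then (g * h) $$ (subindex a i, subindex a j) else 0)"
    using sub by (auto simp: mat_mult_index[OF assms(2,3)])
  finally show "embed n a (g * h) $$ (i, j) = (embed n a g * embed n a h) $$ (i, j)"
    using ij by (simp add: embed_index)
qed (auto simp: layer_mat_def)

lemma embed_one:
  assumes "a \<subseteq> {..<n}"
  shows "embed n a (1\<^sub>m (2 ^ card a)) = 1\<^sub>m (2 ^ n)"
proof (rule eq_matI)
  have fin: "finite a" using assms finite_subset by blast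
  fix i j assume "i < dim_row (1\<^sub>m (2 ^ n) :: complex mat)" "j < dim_col (1\<^sub>m (2 ^ n) :: complex mat)"
  then have ij: "i < 2 ^ n" "j < 2 ^ n" by auto
  have "i = j" if "agree n (- a) i j" "\<forall>q\<in>a. bit i q = bit j q"
    using that ij by (intro nat_bit_eqI[of i n j]) (auto simp: agree_def)
  then show "embed n a (1\<^sub>m (2 ^ card a)) $$ (i, j) = 1\<^sub>m (2 ^ n) $$ (i, j)"
    using ij subindex_less[OF fin] by (auto simp: embed_index subindex_eq_iff[OF fin] agree_def)
qed (auto simp: layer_mat_def)

lemma embed_adjoint:
  assumes "a \<subseteq> {..<n}" "g \<in> carrier_mat (2 ^ card a) (2 ^ card a)"
  shows "mat_adjoint (embed n a g) = embed n a (mat_adjoint g)"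
proof (rule eq_matI)
  have fin: "finite a" using assms finite_subset by blast
  fix i j assume "i < dim_row (embed n a (mat_adjoint g))" "j < dim_col (embed n a (mat_adjoint g))"
  then have ij: "i < 2 ^ n" "j < 2 ^ n" by (auto simp: layer_mat_def)
  have d: "dim_row (embed n a g) = 2 ^ n" "dim_col (embed n a g) = 2 ^ n" by (auto simp: layer_mat_def)
  have "agree n (- a) j i = agree n (- a) i j" by (auto simp: agree_def)
  then show "mat_adjoint (embed n a g) $$ (i, j) = embed n a (mat_adjoint g) $$ (i, j)"
    using ij subindex_less[OF fin] assms(2) d
    by (cases "agree n (- a) i j") (simp_all add: embed_index)
qed (auto simp: layer_mat_def)

lemma embed_unitary:
  assumes "a \<subseteq> {..<n}" "g \<in> unitary_group (2 ^ card a)"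
  shows "embed n a g \<in> unitary_group (2 ^ n)"
proof -
  note g = unitary_groupD[OF assms(2)]
  have "mat_adjoint (embed n a g) * embed n a g = embed n a (mat_adjoint g * g)"
    using g(1) assms(1) by (subst embed_mult) (simp_all add: embed_adjoint)
  then show ?thesis using g assms(1) by (simp add: embed_one unitary_group_def)
qed

definition layer :: "nat \<Rightarrow> (nat set \<times> complex mat) set \<Rightarrow> bool" where
  "layer n S \<longleftrightarrow> finite S \<and>
     (\<forall>s\<in>S. fst s \<subseteq> {..<n} \<and> snd s \<in> unitary_group (2 ^ card (fst s))) \<and>
     (\<forall>s\<in>S. \<forall>s'\<in>S. s = s' \<or> fst s \<inter> fst s' = {})"

lemma layer_subset:
  assumes "layer n S" "S' \<subseteq> S"
  shows "layer n S'"
proof -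
  have "finite S'" using assms finite_subset by (auto simp: layer_def)
  moreover have "\<forall>s\<in>S'. fst s \<subseteq> {..<n} \<and> snd s \<in> unitary_group (2 ^ card (fst s))"
    "\<forall>s\<in>S'. \<forall>s'\<in>S'. s = s' \<or> fst s \<inter> fst s' = {}"
    using assms unfolding layer_def by (simp_all add: subsetD)
  ultimately show ?thesis by (simp add: layer_def)
qed

lemma layer_supports: "layer n S \<Longrightarrow> \<Union> (fst ` S) \<subseteq> {..<n}"
  by (auto simp: layer_def)

lemma layer_mat_split:
  assumes "layer n S" "S' \<subseteq> S"
  shows "layer_mat n S = layer_mat n S' * layer_mat n (S - S')"
    and "\<Union> (fst ` S') \<inter> \<Union> (fst ` (S - S')) = {}"
proof -
  have "a \<inter> a' = {}" if "(a, g) \<in> S'" "(a', g') \<in> S - S'" for a g a' g'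
  proof -
    have "\<forall>s\<in>S. \<forall>s'\<in>S. s = s' \<or> fst s \<inter> fst s' = {}"
      using assms(1) by (simp add: layer_def)
    moreover have "(a, g) \<in> S" "(a', g') \<in> S" "(a, g) \<noteq> (a', g')" using that assms(2) by auto
    ultimately show ?thesis by fastforce
  qed
  then show disj: "\<Union> (fst ` S') \<inter> \<Union> (fst ` (S - S')) = {}"
    by (auto simp: disjoint_iff)
  have "layer_mat n (S' \<union> (S - S')) = layer_mat n S' * layer_mat n (S - S')"
    using assms disj layer_supports[OF layer_subset[OF assms]] layer_supports[OF layer_subset[OF assms(1), of "S - S'"]]
    by (intro layer_mat_Un) (auto simp: layer_def intro: finite_subset)
  moreover have "S' \<union> (S - S') = S" using assms by auto
  ultimately show "layer_mat n S = layer_mat n S' * layer_mat n (S - S')" by simp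
qed

lemma layer_mat_unitary:
  assumes "layer n S"
  shows "layer_mat n S \<in> unitary_group (2 ^ n)"
proof -
  have "finite S" using assms by (simp add: layer_def)
  then show ?thesis using assms
  proof (induction S rule: finite_induct)
    case empty
    show ?case by (simp add: unitary_group_def)
  next
    case (insert s S)
    obtain a g where s: "s = (a, g)" by (cases s)
    have "layer_mat n (insert s S) = embed n a g * layer_mat n S"
      using layer_mat_split(1)[OF insert.prems, of "{s}"] insert.hyps s by simp
    moreover have "layer_mat n S \<in> unitary_group (2 ^ n)"
      using insert.IH layer_subset[OF insert.prems] by blast
    moreover have "embed n a g \<in> unitary_group (2 ^ n)"
      using insert.prems s by (intro embed_unitary) (auto simp: layer_def)
    ultimately show ?case by (simp add: unitary_mult)
  qed
qed

text \<open>Gates away from the support of \<open>X\<close> cancel, so only those meeting it matter.\<close>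

lemma layer_conj_split:
  assumes "layer n S" "S' \<subseteq> S" "local_on n T X" "\<Union> (fst ` (S - S')) \<inter> T = {}"
  shows "mat_adjoint (layer_mat n S) * X * layer_mat n S
       = mat_adjoint (layer_mat n S') * X * layer_mat n S'"
proof -
  let ?A = "layer_mat n S'" and ?B = "layer_mat n (S - S')"
  note split = layer_mat_split[OF assms(1,2)]
  have lA: "layer n S'" and lB: "layer n (S - S')"
    using layer_subset[OF assms(1)] assms(2) by auto
  note locA = layer_mat_local[OF layer_supports[OF lA]] and locB = layer_mat_local[OF layer_supports[OF lB]]
  note B = unitary_groupD[OF layer_mat_unitary[OF lB]]
  note X = local_on_carrier[OF assms(3)]
  note assoc = assoc_mult_mat[of _ "2 ^ n" "2 ^ n" _ "2 ^ n" _ "2 ^ n"]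
  have "layer_mat n S = ?B * ?A"
    using split local_commute[OF locA locB split(2)] by simp
  then have "mat_adjoint (layer_mat n S) * X * layer_mat n S
      = mat_adjoint ?A * (mat_adjoint ?B * X * ?B) * ?A"
    using X by (simp add: conj_conj[of X "2 ^ n"])
  also have "mat_adjoint ?B * X * ?B = X"
    using X B local_commute[OF assms(3) locB] assms(4) by (simp add: assoc Int_commute)
      (simp add: assoc[symmetric])
  finally show ?thesis .
qed

text \<open>Growth of the lightcone by one layer: once the gates missing \<open>T\<close> have
  cancelled, all three factors live on \<open>T\<close> together with the supports that meet
  it.\<close>

lemma layer_conj_local:
  assumes "layer n S" "local_on n T X"
  shows "local_on n (T \<union> \<Union> {a \<in> fst ` S. a \<inter> T \<noteq> {}}) (mat_adjoint (layer_mat n S) * X * layer_mat n S)"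
proof -
  define S' where "S' = {s \<in> S. fst s \<inter> T \<noteq> {}}"
  have sub: "S' \<subseteq> S" by (auto simp: S'_def)
  have "local_on n (\<Union> (fst ` S')) (layer_mat n S')"
    by (rule layer_mat_local[OF layer_supports[OF layer_subset[OF assms(1) sub]]])
  then have "local_on n (T \<union> \<Union> {a \<in> fst ` S. a \<inter> T \<noteq> {}}) (layer_mat n S')"
    by (rule local_on_mono) (auto simp: S'_def)
  moreover have "local_on n (T \<union> \<Union> {a \<in> fst ` S. a \<inter> T \<noteq> {}}) X"
    using assms(2) by (rule local_on_mono) auto
  ultimately have "local_on n (T \<union> \<Union> {a \<in> fst ` S. a \<inter> T \<noteq> {}})
      (mat_adjoint (layer_mat n S') * X * layer_mat n S')"
    by (intro local_on_mult local_on_adjoint)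
  moreover have "\<Union> (fst ` (S - S')) \<inter> T = {}" by (auto simp: S'_def)
  ultimately show ?thesis using layer_conj_split[OF assms(1) sub assms(2)] by simp
qed


section \<open>Second moments of a Haar-conjugated observable\<close>

section \<open>Haar moments\<close>

lemma space_mat_borel [simp]: "space (mat_borel N) = carrier_mat N N"
  by (simp add: mat_borel_def)

lemma measurable_mat_entry [measurable]:
  assumes "i < N" "j < N"
  shows "(\<lambda>A. A $$ (i, j)) \<in> borel_measurable (mat_borel N)"
proof -
  have "(\<lambda>A. \<lambda>p \<in> {..<N} \<times> {..<N}. A $$ p) \<in> measurable (mat_borel N) (\<Pi>\<^sub>M p \<in> {..<N} \<times> {..<N}. borel)"
    unfolding mat_borel_def by (rule measurable_vimage_algebra1) (auto simp: space_PiM)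
  from measurable_compose[OF this measurable_component_singleton[of "(i, j)"]] assms
  show ?thesis by simp
qed

lemma measurable_mat_borelI:
  assumes "\<And>x. x \<in> space M \<Longrightarrow> f x \<in> carrier_mat N N"
    and "\<And>i j. i < N \<Longrightarrow> j < N \<Longrightarrow> (\<lambda>x. f x $$ (i, j)) \<in> borel_measurable M"
  shows "f \<in> measurable M (mat_borel N)"
  unfolding mat_borel_def
proof (rule measurable_vimage_algebra2)
  show "f \<in> space M \<rightarrow> carrier_mat N N" using assms(1) by auto
  show "(\<lambda>x. \<lambda>p\<in>{..<N} \<times> {..<N}. f x $$ p) \<in> measurable M (\<Pi>\<^sub>M p \<in> {..<N} \<times> {..<N}. borel)"
    using assms(2) by (intro measurable_restrict) auto
qed

lemma orthogonal_carrier: "orthogonal_group N \<subseteq> carrier_mat N N"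
  by (auto simp: orthogonal_group_def unitary_group_def)

text \<open>For real \<open>U\<close> and \<open>A\<close> this is the entry (i, j) of U^T A U.
  Taking real parts makes it a real-valued function of every matrix, so that integrals and bounds
  stay in the reals.\<close>

definition haar_conj :: "nat \<Rightarrow> complex mat \<Rightarrow> complex mat \<Rightarrow> nat \<Rightarrow> nat \<Rightarrow> real" where
  "haar_conj N A U i j = (\<Sum>k<N. \<Sum>l<N. Re (U $$ (k, i)) * Re (A $$ (k, l)) * Re (U $$ (l, j)))"

text \<open>The orthogonal reflection mixing coordinates \<open>k\<close> and \<open>l\<close>; the choices \<open>(c, s) = (1, 0)\<close>,
  \<open>(0, 1)\<close> and \<open>(1, 1) / sqrt 2\<close> are a sign flip, a swap and a Hadamard rotation.\<close>

definition reflection :: "nat \<Rightarrow> nat \<Rightarrow> nat \<Rightarrow> real \<Rightarrow> real \<Rightarrow> complex mat" where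
  "reflection N k l c s = Matrix.mat N N (\<lambda>(i, j). complex_of_real (
     if j = k then (if i = k then c else if i = l then s else 0)
     else if j = l then (if i = k then s else if i = l then - c else 0)
     else if i = j then 1 else 0))"

lemma mult_reflection:
  assumes "U \<in> carrier_mat N N" "k < N" "l < N" "k \<noteq> l" "i < N" "j < N"
  shows "(U * reflection N k l c s) $$ (i, j) =
    (if j = k then c * U $$ (i, k) + s * U $$ (i, l)
     else if j = l then s * U $$ (i, k) - c * U $$ (i, l) else U $$ (i, j))"
proof -
  let ?R = "reflection N k l c s"
  have R: "?R \<in> carrier_mat N N" by (simp add: reflection_def)
  have "(U * ?R) $$ (i, j) = (\<Sum>t<N. U $$ (i, t) * ?R $$ (t, j))"
    using assms R by (subst mat_mult_index[of _ N N _ N]) auto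
  also have "\<dots> = (\<Sum>t\<in>{k, l, j}. U $$ (i, t) * ?R $$ (t, j))"
    using assms by (intro sum.mono_neutral_right) (auto simp: reflection_def)
  also have "{k, l, j} = (if j = k \<or> j = l then {k, l} else {k, l, j})" by auto
  also have "(\<Sum>t\<in>\<dots>. U $$ (i, t) * ?R $$ (t, j)) = (if j = k then c * U $$ (i, k) + s * U $$ (i, l)
     else if j = l then s * U $$ (i, k) - c * U $$ (i, l) else U $$ (i, j))"
    using assms by (auto simp: reflection_def)
  finally show ?thesis .
qed

lemma reflection_orthogonal:
  assumes "k < N" "l < N" "k \<noteq> l" "c\<^sup>2 + s\<^sup>2 = 1"
  shows "reflection N k l c s \<in> orthogonal_group N"
proof (rule orthogonal_groupI)
  let ?R = "reflection N k l c s"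
  have R: "?R \<in> carrier_mat N N" by (simp add: reflection_def)
  have "mat_adjoint ?R = ?R" by (rule eq_matI) (auto simp: reflection_def)
  moreover have "?R * ?R = 1\<^sub>m N"
  proof (rule eq_matI)
    fix i j assume ij: "i < dim_row (1\<^sub>m N :: complex mat)" "j < dim_col (1\<^sub>m N :: complex mat)"
    have cs: "complex_of_real c * c + complex_of_real s * s = 1"
      "complex_of_real s * s + complex_of_real c * c = 1"
      using assms(4) by (auto simp: power2_eq_square simp flip: of_real_mult of_real_add)
    then show "(?R * ?R) $$ (i, j) = 1\<^sub>m N $$ (i, j)"
      using ij assms(1-3) by (subst mult_reflection[OF R]) (auto simp: reflection_def)
  qed (use R in auto)
  ultimately show "?R \<in> unitary_group N" using R by (auto simp: unitary_group_def)
qed (auto simp: reflection_def)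

lemma haar_conj_eq:
  assumes "U \<in> orthogonal_group N" "A \<in> carrier_mat N N"
    "\<And>i j. i < N \<Longrightarrow> j < N \<Longrightarrow> A $$ (i, j) \<in> \<real>" "i < N" "j < N"
  shows "(mat_adjoint U * A * U) $$ (i, j) = complex_of_real (haar_conj N A U i j)"
proof -
  have U: "U \<in> carrier_mat N N" using assms orthogonal_carrier by auto
  have real: "complex_of_real (Re (U $$ (k, l))) = U $$ (k, l)"
    "complex_of_real (Re (A $$ (k, l))) = A $$ (k, l)" "cnj (U $$ (k, l)) = U $$ (k, l)"
    if "k < N" "l < N" for k l
    using that orthogonal_group_real[OF assms(1)] assms(3) by (simp_all add: of_real_Re Reals_cnj_iff)
  have "(mat_adjoint U * A) $$ (i, l) = (\<Sum>k<N. mat_adjoint U $$ (i, k) * A $$ (k, l))" if "l < N" for l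
    using U assms that by (intro mat_mult_index) auto
  then have "(mat_adjoint U * A * U) $$ (i, j) = (\<Sum>l<N. (\<Sum>k<N. mat_adjoint U $$ (i, k) * A $$ (k, l)) * U $$ (l, j))"
    using U assms by (subst mat_mult_index[of _ N N _ N]) simp_all
  also have "\<dots> = (\<Sum>l<N. (\<Sum>k<N. U $$ (k, i) * A $$ (k, l)) * U $$ (l, j))"
    using U assms real by (intro sum.cong arg_cong2[where f = "(*)"]) auto
  also have "\<dots> = (\<Sum>k<N. \<Sum>l<N. U $$ (k, i) * A $$ (k, l) * U $$ (l, j))"
    unfolding sum_distrib_right by (rule sum.swap)
  also have "\<dots> = complex_of_real (haar_conj N A U i j)"
    unfolding haar_conj_def of_real_sum using assms real by (intro sum.cong) auto
  finally show ?thesis .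
qed

lemma haar_conj_sym:
  assumes "\<And>i j. i < N \<Longrightarrow> j < N \<Longrightarrow> A $$ (i, j) = A $$ (j, i)"
  shows "haar_conj N A U i j = haar_conj N A U j i"
  unfolding haar_conj_def using assms by (subst sum.swap) (auto intro!: sum.cong)

lemma haar_conj_cong:
  assumes "\<And>k. k < N \<Longrightarrow> U $$ (k, i) = V $$ (k, i')" "\<And>k. k < N \<Longrightarrow> U $$ (k, j) = V $$ (k, j')"
  shows "haar_conj N A U i j = haar_conj N A V i' j'"
  using assms unfolding haar_conj_def by (auto intro!: sum.cong)

lemma haar_conj_trace:
  assumes "U \<in> orthogonal_group N" "(\<Sum>i<N. A $$ (i, i)) = 0"
  shows "(\<Sum>i<N. haar_conj N A U i i) = 0"
proof -
  have U: "U \<in> carrier_mat N N" "U * mat_adjoint U = 1\<^sub>m N"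
    using unitary_groupD[OF orthogonal_group_unitary[OF assms(1)]] by auto
  have ortho: "(\<Sum>i<N. Re (U $$ (k, i)) * Re (U $$ (l, i))) = (if k = l then 1 else 0)" if "k < N" "l < N" for k l
  proof -
    have im: "Im (U $$ (k, i)) = 0" if "i < N" for i
      using orthogonal_group_real[OF assms(1) \<open>k < N\<close> that] by (simp add: complex_is_Real_iff)
    have "(if k = l then 1 else 0) = Re ((U * mat_adjoint U) $$ (k, l))" using U that by simp
    also have "\<dots> = (\<Sum>i<N. Re (U $$ (k, i)) * Re (U $$ (l, i)))"
      using U that im by (subst mat_mult_index[of _ N N _ N]) (auto intro!: sum.cong)
    finally show ?thesis by simp
  qed
  have "(\<Sum>i<N. haar_conj N A U i i) = (\<Sum>k<N. \<Sum>l<N. \<Sum>i<N. Re (U $$ (k, i)) * Re (A $$ (k, l)) * Re (U $$ (l, i)))"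
    unfolding haar_conj_def by (subst sum.swap, rule sum.cong[OF refl], rule sum.swap)
  also have "\<dots> = (\<Sum>k<N. \<Sum>l<N. Re (A $$ (k, l)) * (\<Sum>i<N. Re (U $$ (k, i)) * Re (U $$ (l, i))))"
    by (simp add: sum_distrib_left mult_ac)
  also have "\<dots> = (\<Sum>k<N. Re (A $$ (k, k)))"
    using ortho by (intro sum.cong refl) (simp add: if_distrib[of "\<lambda>x. _ * x"] sum.delta cong: if_cong)
  also have "\<dots> = Re (\<Sum>k<N. A $$ (k, k))" by simp
  finally show ?thesis using assms(2) by simp
qed

text \<open>The conjugate of a symmetric involution is again one, so its rows are unit
  vectors.\<close>

lemma haar_conj_row_norm:
  assumes "U \<in> orthogonal_group N" "A \<in> carrier_mat N N" "A * A = 1\<^sub>m N"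
    "\<And>i j. i < N \<Longrightarrow> j < N \<Longrightarrow> A $$ (i, j) \<in> \<real>" "\<And>i j. i < N \<Longrightarrow> j < N \<Longrightarrow> A $$ (i, j) = A $$ (j, i)" "i < N"
  shows "(\<Sum>j<N. (haar_conj N A U i j)\<^sup>2) = 1"
proof -
  let ?B = "mat_adjoint U * A * U"
  have U: "U \<in> unitary_group N" by (rule orthogonal_group_unitary[OF assms(1)])
  have B: "?B \<in> carrier_mat N N" using unitary_groupD[OF U] assms(2) by simp
  have "?B * ?B = 1\<^sub>m N"
    using conj_mult[OF U assms(2,2)] assms(3) unitary_groupD[OF U] by simp
  then have "1 = (?B * ?B) $$ (i, i)" using assms by simp
  also have "\<dots> = (\<Sum>j<N. ?B $$ (i, j) * ?B $$ (j, i))"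
    using B assms by (subst mat_mult_index[of _ N N _ N]) auto
  also have "\<dots> = (\<Sum>j<N. complex_of_real ((haar_conj N A U i j)\<^sup>2))"
    using assms haar_conj_eq[OF assms(1,2,4)] haar_conj_sym[OF assms(5), of N U]
    by (intro sum.cong) (auto simp: power2_eq_square)
  finally show ?thesis by (metis of_real_eq_1_iff of_real_sum)
qed

lemma haar_conj_abs_le_1:
  assumes "U \<in> orthogonal_group N" "A \<in> carrier_mat N N" "A * A = 1\<^sub>m N"
    "\<And>i j. i < N \<Longrightarrow> j < N \<Longrightarrow> A $$ (i, j) \<in> \<real>" "\<And>i j. i < N \<Longrightarrow> j < N \<Longrightarrow> A $$ (i, j) = A $$ (j, i)"
    "i < N" "j < N"
  shows "\<bar>haar_conj N A U i j\<bar> \<le> 1"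
proof -
  have "(haar_conj N A U i j)\<^sup>2 \<le> (\<Sum>j<N. (haar_conj N A U i j)\<^sup>2)"
    using assms(7) by (intro member_le_sum) auto
  also have "\<dots> = 1" by (rule haar_conj_row_norm[OF assms(1-6)])
  finally show ?thesis by (simp add: abs_square_le_1)
qed

lemma space_haar: "is_haar_orthogonal N H \<Longrightarrow> space H = orthogonal_group N"
  using orthogonal_carrier[of N]
  by (auto simp: is_haar_orthogonal_def space_restrict_space dest!: sets_eq_imp_space_eq)

lemma prob_space_haar: "is_haar_orthogonal N H \<Longrightarrow> prob_space H"
  by (simp add: is_haar_orthogonal_def)

lemma sets_haar: "is_haar_orthogonal N H \<Longrightarrow> sets H = sets (restrict_space (mat_borel N) (orthogonal_group N))"
  by (simp add: is_haar_orthogonal_def)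

lemma haar_entry_measurable:
  assumes "is_haar_orthogonal N H" "i < N" "j < N"
  shows "(\<lambda>U. U $$ (i, j)) \<in> borel_measurable H"
  using measurable_restrict_space1[OF measurable_mat_entry[OF assms(2,3)]]
    measurable_cong_sets[OF sets_haar[OF assms(1)] refl] by blast

lemma haar_right_invariant:
  fixes f :: "complex mat \<Rightarrow> real"
  assumes H: "is_haar_orthogonal N H" and V: "V \<in> orthogonal_group N" and f: "f \<in> borel_measurable H"
  shows "(LINT U|H. f (U * V)) = (LINT U|H. f U)"
proof -
  have VN: "V \<in> carrier_mat N N" using V orthogonal_carrier by auto
  have "(\<lambda>U. U * V) \<in> measurable H (restrict_space (mat_borel N) (orthogonal_group N))"
  proof (rule measurable_restrict_space2)
    show "(\<lambda>U. U * V) \<in> space H \<rightarrow> orthogonal_group N"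
      using V orthogonal_mult by (auto simp: space_haar[OF H])
    show "(\<lambda>U. U * V) \<in> measurable H (mat_borel N)"
    proof (rule measurable_mat_borelI)
      fix U assume "U \<in> space H"
      then show "U * V \<in> carrier_mat N N"
        using VN subsetD[OF orthogonal_carrier] by (auto simp: space_haar[OF H])
    next
      fix i j assume ij: "i < N" "j < N"
      have "(\<lambda>U. \<Sum>k<N. U $$ (i, k) * V $$ (k, j)) \<in> borel_measurable H"
        using ij haar_entry_measurable[OF H] by (intro borel_measurable_sum borel_measurable_times) auto
      moreover have "(U * V) $$ (i, j) = (\<Sum>k<N. U $$ (i, k) * V $$ (k, j))" if "U \<in> space H" for U
        using that orthogonal_carrier ij by (intro mat_mult_index[OF _ VN]) (auto simp: space_haar[OF H])
      ultimately show "(\<lambda>U. (U * V) $$ (i, j)) \<in> borel_measurable H"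
        by (simp cong: measurable_cong)
    qed
  qed
  then have m: "(\<lambda>U. U * V) \<in> measurable H H"
    using measurable_cong_sets[OF refl sets_haar[OF H]] by blast
  have "(LINT U|H. f U) = (LINT U|distr H H (\<lambda>U. U * V). f U)"
    using H V by (simp add: is_haar_orthogonal_def)
  also have "\<dots> = (LINT U|H. f (U * V))" by (rule integral_distr[OF m f])
  finally show ?thesis ..
qed

text \<open>Used at two scales: N = 2^n evaluates the Haar side of the design condition, and N = 2^m
  averages over a single gate. Reality, symmetry, zero trace and A^2 = 1 are all that the moments
  see of \<open>A\<close>.\<close>

locale haar_observable =
  fixes N :: nat and H :: "complex mat measure" and A :: "complex mat"
  assumes H: "is_haar_orthogonal N H"
    and A_carrier: "A \<in> carrier_mat N N"
    and A_real: "\<And>i j. i < N \<Longrightarrow> j < N \<Longrightarrow> A $$ (i, j) \<in> \<real>"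
    and A_sym: "\<And>i j. i < N \<Longrightarrow> j < N \<Longrightarrow> A $$ (i, j) = A $$ (j, i)"
    and A_square: "A * A = 1\<^sub>m N"
    and A_trace: "(\<Sum>i<N. A $$ (i, i)) = 0"
begin

abbreviation B :: "complex mat \<Rightarrow> nat \<Rightarrow> nat \<Rightarrow> real" where "B \<equiv> haar_conj N A"

definition W :: "nat \<Rightarrow> nat \<Rightarrow> nat \<Rightarrow> nat \<Rightarrow> real" where
  "W i j k l = (LINT U|H. B U i j * B U k l)"

lemma B_measurable:
  assumes "i < N" "j < N"
  shows "(\<lambda>U. B U i j) \<in> borel_measurable H"
  unfolding haar_conj_def using haar_entry_measurable[OF H] assms
  by (intro borel_measurable_sum borel_measurable_times borel_measurable_const measurable_compose[OF _ borel_measurable_Re]) auto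

lemma B_bound: "U \<in> orthogonal_group N \<Longrightarrow> i < N \<Longrightarrow> j < N \<Longrightarrow> \<bar>B U i j\<bar> \<le> 1"
  by (intro haar_conj_abs_le_1 A_carrier A_square A_real A_sym)

lemma W_integrable:
  assumes "i < N" "j < N" "k < N" "l < N"
  shows "integrable H (\<lambda>U. B U i j * B U k l)"
proof -
  interpret prob_space H by (rule prob_space_haar[OF H])
  show ?thesis
  proof (rule integrable_const_bound[where B = 1])
    show "AE U in H. norm (B U i j * B U k l) \<le> 1"
      using assms B_bound by (intro AE_I2) (auto simp: space_haar[OF H] abs_mult intro!: mult_le_one)
  qed (use assms B_measurable in auto)
qed

lemma W_has:
  "i < N \<Longrightarrow> j < N \<Longrightarrow> k < N \<Longrightarrow> l < N \<Longrightarrow>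
    has_bochner_integral H (\<lambda>U. B U i j * B U k l) (W i j k l)"
  unfolding W_def by (intro has_bochner_integral_integrable W_integrable)

lemma W_reflect:
  assumes "k < N" "l < N" "k \<noteq> l" "c\<^sup>2 + s\<^sup>2 = 1" "i < N" "j < N" "i' < N" "j' < N"
  shows "W i j i' j' = (LINT U|H. B (U * reflection N k l c s) i j * B (U * reflection N k l c s) i' j')"
  unfolding W_def using assms B_measurable
  by (intro haar_right_invariant[symmetric, OF H reflection_orthogonal]) auto

text \<open>The reflection with (c, s) = (1, 0) negates column \<open>t\<close> of \<open>U\<close>
  and fixes column \<open>t'\<close>, which is present only because \<open>reflection\<close> takes
  two coordinates.\<close>

lemma W_flip:
  assumes "t < N" "t' < N" "t \<noteq> t'" "i < N" "j < N" "i' < N" "j' < N"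
  defines "\<sigma> x \<equiv> if x = t then - 1 else 1"
  shows "W i j i' j' = \<sigma> i * \<sigma> j * \<sigma> i' * \<sigma> j' * W i j i' j'"
proof -
  let ?R = "reflection N t' t 1 0"
  have B: "B (U * ?R) x y = \<sigma> x * \<sigma> y * B U x y" if "U \<in> space H" "x < N" "y < N" for U x y
  proof -
    have "U \<in> carrier_mat N N" using that orthogonal_carrier by (auto simp: space_haar[OF H])
    then have "Re ((U * ?R) $$ (k, x)) = \<sigma> x * Re (U $$ (k, x))" if "k < N" "x < N" for k x
      using that assms(1-3) by (subst mult_reflection[of U N]) (auto simp: \<sigma>_def)
    then show ?thesis using that unfolding haar_conj_def sum_distrib_left by (intro sum.cong) auto
  qed
  have "W i j i' j' = (LINT U|H. B (U * ?R) i j * B (U * ?R) i' j')"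
    using assms(1-7) by (intro W_reflect) auto
  also have "\<dots> = (LINT U|H. (\<sigma> i * \<sigma> j * \<sigma> i' * \<sigma> j') * (B U i j * B U i' j'))"
    using assms(4-7) B by (intro Bochner_Integration.integral_cong) auto
  also have "\<dots> = \<sigma> i * \<sigma> j * \<sigma> i' * \<sigma> j' * W i j i' j'" by (simp add: W_def)
  finally show ?thesis .
qed

text \<open>Some index occurs an odd number of times among i, i, k, l, namely \<open>l\<close> if i
  = k and \<open>k\<close> otherwise; negating that column negates the moment.\<close>

lemma W_offdiag:
  assumes "i < N" "k < N" "l < N" "k \<noteq> l"
  shows "W i i k l = 0"
proof (cases "i = k")
  case True
  then show ?thesis using W_flip[of l k i i k l] assms by simp
next
  case False
  then show ?thesis using W_flip[of k l i i k l] assms by simp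
qed

lemma W_swap:
  assumes "k < N" "l < N" "k \<noteq> l" "i < N" "j < N" "i' < N" "j' < N"
  defines "\<tau> x \<equiv> if x = k then l else if x = l then k else x"
  shows "W i j i' j' = W (\<tau> i) (\<tau> j) (\<tau> i') (\<tau> j')"
proof -
  let ?R = "reflection N k l 0 1"
  have B: "B (U * ?R) x y = B U (\<tau> x) (\<tau> y)" if "U \<in> space H" "x < N" "y < N" for U x y
  proof -
    have "U \<in> carrier_mat N N" using that orthogonal_carrier by (auto simp: space_haar[OF H])
    then show ?thesis using that assms(1-3)
      by (intro haar_conj_cong; subst mult_reflection[of U N]) (auto simp: \<tau>_def)
  qed
  have "W i j i' j' = (LINT U|H. B (U * ?R) i j * B (U * ?R) i' j')"
    using assms(1-7) by (intro W_reflect) auto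
  also have "\<dots> = W (\<tau> i) (\<tau> j) (\<tau> i') (\<tau> j')"
    unfolding W_def using assms(4-7) B by (intro Bochner_Integration.integral_cong) auto
  finally show ?thesis .
qed

lemma W_diag_eq: "k < N \<Longrightarrow> l < N \<Longrightarrow> W k k k k = W l l l l"
  using W_swap[of k l k k k k] by (cases "k = l") auto

lemma W_pair_eq: "i < N \<Longrightarrow> k < N \<Longrightarrow> l < N \<Longrightarrow> i \<noteq> k \<Longrightarrow> i \<noteq> l \<Longrightarrow> W i i k k = W i i l l"
  using W_swap[of k l i i k k] by (cases "k = l") auto

text \<open>Replacing column \<open>k\<close> by the normalized sum of columns \<open>k\<close> and
  \<open>l\<close> expands the diagonal entry. The cross moments vanish by \<open>W_offdiag\<close>,
  and equality of the two diagonal moments closes the equation.\<close>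

lemma W_hadamard:
  assumes "k < N" "l < N" "k \<noteq> l"
  shows "W k k k k = W k k l l + 2 * W k l k l"
proof -
  let ?c = "1 / sqrt 2 :: real"
  let ?R = "reflection N k l ?c ?c"
  have cc: "?c * ?c = 1 / 2" by (simp add: real_sqrt_mult[symmetric])
  have B: "B (U * ?R) k k = (B U k k + B U l l + 2 * B U k l) / 2" if "U \<in> space H" for U
  proof -
    have "U \<in> carrier_mat N N" using that orthogonal_carrier by (auto simp: space_haar[OF H])
    then have "Re ((U * ?R) $$ (x, k)) = ?c * (Re (U $$ (x, k)) + Re (U $$ (x, l)))" if "x < N" for x
      using that assms by (subst mult_reflection[of U N]) (auto simp: field_simps)
    then have "B (U * ?R) k k = (\<Sum>x<N. \<Sum>y<N. (?c * ?c) * ((Re (U $$ (x, k)) + Re (U $$ (x, l))) * Re (A $$ (x, y))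
        * (Re (U $$ (y, k)) + Re (U $$ (y, l)))))"
      unfolding haar_conj_def by (intro sum.cong) auto
    also have "\<dots> = (B U k k + B U k l + B U l k + B U l l) / 2"
      unfolding haar_conj_def cc by (simp add: sum.distrib algebra_simps sum_distrib_left sum_divide_distrib)
    also have "B U l k = B U k l" by (intro haar_conj_sym A_sym)
    finally show ?thesis by simp
  qed
  note int = W_integrable
  have "W k k k k = (LINT U|H. B (U * ?R) k k * B (U * ?R) k k)"
    using assms cc by (intro W_reflect) (auto simp: power2_eq_square)
  also have "\<dots> = (LINT U|H. ((B U k k * B U k k) + (B U l l * B U l l) + 4 * (B U k l * B U k l)
       + 2 * (B U k k * B U l l) + 4 * (B U k k * B U k l) + 4 * (B U l l * B U k l)) / 4)"
    by (intro Bochner_Integration.integral_cong refl) (simp only: B, simp add: field_simps)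
  also have "\<dots> = (W k k k k + W l l l l + 4 * W k l k l + 2 * W k k l l + 4 * W k k k l + 4 * W l l k l) / 4"
    using assms int by (simp add: W_def)
  also have "W k k k l = 0" using assms by (intro W_offdiag) auto
  also have "W l l k l = 0" using assms by (intro W_offdiag) auto
  also have "W l l l l = W k k k k" using assms by (intro W_diag_eq) auto
  finally show ?thesis by simp
qed

lemma W_trace:
  assumes "i < N"
  shows "(\<Sum>j<N. W i i j j) = 0"
proof -
  have "(\<Sum>j<N. W i i j j) = (LINT U|H. B U i i * (\<Sum>j<N. B U j j))"
    unfolding W_def sum_distrib_left using assms W_integrable
    by (intro Bochner_Integration.integral_sum[symmetric]) auto
  also have "\<dots> = (LINT U|H. 0)"
    using haar_conj_trace[OF _ A_trace] by (intro Bochner_Integration.integral_cong) (auto simp: space_haar[OF H])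
  finally show ?thesis by simp
qed

lemma W_row:
  assumes "i < N"
  shows "(\<Sum>j<N. W i j i j) = 1"
proof -
  interpret prob_space H by (rule prob_space_haar[OF H])
  have "(\<Sum>j<N. W i j i j) = (LINT U|H. (\<Sum>j<N. B U i j * B U i j))"
    unfolding W_def using assms W_integrable
    by (intro Bochner_Integration.integral_sum[symmetric]) auto
  also have "\<dots> = (LINT U|H. 1)"
    using assms haar_conj_row_norm[OF _ A_carrier A_square A_real A_sym]
    by (intro Bochner_Integration.integral_cong) (auto simp: space_haar[OF H] power2_eq_square)
  finally show ?thesis by (simp add: prob_space)
qed

text \<open>Sum the Hadamard relation over all j other than i and write p for the diagonal moment.
  The trace relation turns the first sum into -p and the row norm turns the second into 1 - p, so (N
  - 1) p = -p + 2 (1 - p).\<close>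

lemma W_diag:
  assumes "i < N"
  shows "W i i i i = 2 / (real N + 2)"
proof -
  let ?p = "W i i i i"
  have split: "sum f {..<N} = f i + sum f ({..<N} - {i})" for f :: "nat \<Rightarrow> real"
    using assms by (intro sum.remove) auto
  have "(real N - 1) * ?p = (\<Sum>j\<in>{..<N} - {i}. ?p)"
    using assms by (simp add: of_nat_diff)
  also have "\<dots> = (\<Sum>j\<in>{..<N} - {i}. W i i j j + 2 * W i j i j)"
    using assms by (intro sum.cong W_hadamard) auto
  also have "\<dots> = (\<Sum>j\<in>{..<N} - {i}. W i i j j) + 2 * (\<Sum>j\<in>{..<N} - {i}. W i j i j)"
    by (simp add: sum.distrib sum_distrib_left)
  also have "\<dots> = - ?p + 2 * (1 - ?p)"
    using W_trace[OF assms] W_row[OF assms] split[of "\<lambda>j. W i i j j"] split[of "\<lambda>j. W i j i j"] by simp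
  finally show ?thesis by (simp add: field_simps)
qed

text \<open>By the trace relation the N - 1 moments \<open>W i i k k\<close> with k other than i add
  up to minus the diagonal moment, and by symmetry they are equal.\<close>

lemma W_pair:
  assumes "i < N" "j < N" "i \<noteq> j"
  shows "W i i j j = - (2 / ((real N - 1) * (real N + 2)))"
proof -
  have "0 = W i i i i + (\<Sum>k\<in>{..<N} - {i}. W i i k k)"
    using W_trace[OF assms(1)] assms by (subst (asm) sum.remove[of _ i]) auto
  also have "(\<Sum>k\<in>{..<N} - {i}. W i i k k) = (\<Sum>k\<in>{..<N} - {i}. W i i j j)"
    using assms by (intro sum.cong W_pair_eq) auto
  also have "\<dots> = (real N - 1) * W i i j j"
    using assms by (simp add: of_nat_diff)
  finally have "(real N - 1) * W i i j j = - (2 / (real N + 2))" using W_diag[OF assms(1)] by simp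
  moreover have "real N - 1 \<noteq> 0" using assms by auto
  ultimately have "W i i j j = - (2 / (real N + 2)) / (real N - 1)"
    by (metis nonzero_mult_div_cancel_left)
  then show ?thesis by (simp add: mult.commute)
qed

text \<open>The diagonal part \<open>?D\<close> and the off-diagonal part \<open>?F\<close> are
  uncorrelated, so the second moment is that of \<open>?D\<close> plus that of \<open>?F\<close>.
  The former is evaluated exactly and the latter dropped as nonnegative.\<close>

lemma second_moment_ge:
  fixes X :: "nat \<Rightarrow> nat \<Rightarrow> real"
  assumes "N \<ge> 2"
  shows "2 / ((real N - 1) * (real N + 2)) * (N * (\<Sum>i<N. (X i i)\<^sup>2) - (\<Sum>i<N. X i i)\<^sup>2)
    \<le> (LINT U|H. (\<Sum>i<N. \<Sum>j<N. X i j * B U i j)\<^sup>2)"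
proof -
  interpret prob_space H by (rule prob_space_haar[OF H])
  let ?D = "\<lambda>U. \<Sum>i<N. X i i * B U i i"
  let ?F = "\<lambda>U. \<Sum>k<N. \<Sum>l\<in>{..<N} - {k}. X k l * B U k l"
  let ?Q = "2 / ((real N - 1) * (real N + 2))"
  have split: "(\<Sum>i<N. \<Sum>j<N. X i j * B U i j) = ?D U + ?F U" for U
    unfolding sum.distrib[symmetric] by (intro sum.cong sum.remove) auto
  have DD: "?D U * ?D U = (\<Sum>i<N. \<Sum>k<N. X i i * X k k * (B U i i * B U k k))" for U
    by (simp add: sum_product mult_ac)
  have DF: "?D U * ?F U = (\<Sum>i<N. \<Sum>k<N. \<Sum>l\<in>{..<N} - {k}. X i i * X k l * (B U i i * B U k l))" for U
    by (subst sum_distrib_right) (simp add: sum_distrib_left mult_ac)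
  have iDD: "integrable H (\<lambda>U. ?D U * ?D U)" and iDF: "integrable H (\<lambda>U. ?D U * ?F U)"
    unfolding DD DF using W_integrable by (auto intro!: Bochner_Integration.integrable_sum)
  have "(LINT U|H. ?D U * ?F U) = (\<Sum>i<N. \<Sum>k<N. \<Sum>l\<in>{..<N} - {k}. X i i * X k l * W i i k l)"
    unfolding DF
    by (rule has_bochner_integral_integral_eq, intro has_bochner_integral_sum has_bochner_integral_mult_right W_has) auto
  also have "\<dots> = 0" using W_offdiag by (auto intro!: sum.neutral)
  finally have eDF: "(LINT U|H. ?D U * ?F U) = 0" .
  have "(LINT U|H. ?D U * ?D U) = (\<Sum>i<N. \<Sum>k<N. X i i * X k k * W i i k k)"
    unfolding DD
    by (rule has_bochner_integral_integral_eq, intro has_bochner_integral_sum has_bochner_integral_mult_right W_has) auto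
  also have "\<dots> = (\<Sum>i<N. \<Sum>k<N. (if k = i then N * ?Q * (X i i)\<^sup>2 else 0) - ?Q * (X i i * X k k))"
  proof (intro sum.cong refl)
    fix i k assume *: "i \<in> {..<N}" "k \<in> {..<N}"
    \<comment> \<open>With \<open>?Q\<close> as common factor the diagonal moment is (N - 1) Q = N Q
      - Q, while the other moments are -Q; both cases then share the term -Q times
      \<open>X i i * X k k\<close>.\<close>
    have Q: "2 / (real N + 2) = (real N - 1) * ?Q"
      unfolding times_divide_eq_right using assms by (intro nonzero_mult_divide_mult_cancel_left[symmetric]) simp
    show "X i i * X k k * W i i k k = (if k = i then N * ?Q * (X i i)\<^sup>2 else 0) - ?Q * (X i i * X k k)"
    proof (cases "k = i")
      case True
      have alg: "x * x * ((n - 1) * y) = n * y * x\<^sup>2 - y * (x * x)" for n x y :: real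
        by (simp add: algebra_simps power2_eq_square)
      have W: "W i i i i = (real N - 1) * ?Q" using * by (intro trans[OF W_diag Q]) simp
      show ?thesis unfolding True W if_P[OF refl] by (rule alg)
    next
      case False
      then show ?thesis using * W_pair[of i k] by simp
    qed
  qed
  also have "\<dots> = ?Q * (N * (\<Sum>i<N. (X i i)\<^sup>2) - (\<Sum>i<N. X i i)\<^sup>2)"
    by (simp add: sum_subtractf sum.delta power2_eq_square sum_product sum_distrib_left
      sum_divide_distrib right_diff_distrib mult_ac)
  finally have eDD: "(LINT U|H. ?D U * ?D U) = ?Q * (N * (\<Sum>i<N. (X i i)\<^sup>2) - (\<Sum>i<N. X i i)\<^sup>2)" .
  have FF: "?F U * ?F U = (\<Sum>i<N. \<Sum>k<N. \<Sum>l\<in>{..<N} - {k}. \<Sum>j\<in>{..<N} - {i}. X i j * X k l * (B U i j * B U k l))" for U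
    by (simp add: sum_product sum_distrib_left sum_distrib_right mult_ac)
  have iFF: "integrable H (\<lambda>U. ?F U * ?F U)"
    unfolding FF using W_integrable by (auto intro!: Bochner_Integration.integrable_sum)
  have "?Q * (N * (\<Sum>i<N. (X i i)\<^sup>2) - (\<Sum>i<N. X i i)\<^sup>2) = (LINT U|H. ?D U * ?D U + 2 * (?D U * ?F U))"
    using iDD iDF eDD eDF by simp
  also have "\<dots> \<le> (LINT U|H. (?D U * ?D U + 2 * (?D U * ?F U)) + ?F U * ?F U)"
    using iDD iDF iFF by (intro integral_mono) auto
  also have "\<dots> = (LINT U|H. (\<Sum>i<N. \<Sum>j<N. X i j * B U i j)\<^sup>2)"
    unfolding split by (intro Bochner_Integration.integral_cong) (auto simp: power2_eq_square algebra_simps)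
  finally show ?thesis .
qed

lemma second_moment_integrable:
  "integrable H (\<lambda>U. (\<Sum>i<N. \<Sum>j<N. X i j * B U i j)\<^sup>2)"
proof -
  have "(\<Sum>i<N. \<Sum>j<N. X i j * B U i j)\<^sup>2
      = (\<Sum>i<N. \<Sum>k<N. \<Sum>l<N. \<Sum>j<N. X i j * X k l * (B U i j * B U k l))" for U
    by (simp add: power2_eq_square sum_product sum_distrib_left sum_distrib_right mult_ac)
  then show ?thesis using W_integrable by (auto intro!: Bochner_Integration.integrable_sum)
qed

end

text \<open>Bessel's inequality for \<open>x\<close> against the constant vector 1 and the balanced
  sign vector \<open>z\<close>, which are orthogonal and both have squared norm N. The squares
  summed in the proof are those of N times the residual of \<open>x\<close> after both
  projections.\<close>

lemma sum_signs_square_le: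
  fixes x z :: "nat \<Rightarrow> real"
  assumes "N > 0" "\<And>i. i < N \<Longrightarrow> (z i)\<^sup>2 = 1" "(\<Sum>i<N. z i) = 0"
  shows "(\<Sum>i<N. z i * x i)\<^sup>2 \<le> N * (\<Sum>i<N. (x i)\<^sup>2) - (\<Sum>i<N. x i)\<^sup>2"
proof -
  define S where "S = (\<Sum>i<N. x i)"
  define T where "T = (\<Sum>i<N. z i * x i)"
  have "0 \<le> (\<Sum>i<N. (N * x i - S - z i * T)\<^sup>2)" by (intro sum_nonneg) auto
  also have "\<dots> = (\<Sum>i<N. (N * N) * (x i)\<^sup>2 + S\<^sup>2 + T\<^sup>2 - (2 * N * S) * x i - (2 * N * T) * (z i * x i) + (2 * S * T) * z i)"
  proof (intro sum.cong refl)
    fix i assume "i \<in> {..<N}"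
    then have "z i * z i = 1" using assms(2)[of i] by (simp add: power2_eq_square)
    then have "(z i * T)\<^sup>2 = T\<^sup>2" by (simp add: power2_eq_square algebra_simps)
    then show "(N * x i - S - z i * T)\<^sup>2 = (N * N) * (x i)\<^sup>2 + S\<^sup>2 + T\<^sup>2 - (2 * N * S) * x i - (2 * N * T) * (z i * x i) + (2 * S * T) * z i"
      by (simp add: power2_eq_square algebra_simps)
  qed
  also have "\<dots> = N * N * (\<Sum>i<N. (x i)\<^sup>2) + N * S\<^sup>2 + N * T\<^sup>2 - (2 * N * S) * S - (2 * N * T) * T"
    using assms(3) by (simp add: sum.distrib sum_subtractf sum_distrib_left[symmetric] S_def T_def)
  also have "\<dots> = N * (N * (\<Sum>i<N. (x i)\<^sup>2) - S\<^sup>2 - T\<^sup>2)"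
    by (simp add: power2_eq_square algebra_simps)
  finally show ?thesis using assms(1) by (simp add: zero_le_mult_iff S_def T_def)
qed


section \<open>From the semidefinite order to a scalar inequality\<close>

section \<open>State designs\<close>

text \<open>Row-major order agrees with the index split of \<open>tensor_mat\<close>, so the overlap
  with psi tensor psi is psi^T A psi for real psi and A.\<close>

definition vectorize :: "nat \<Rightarrow> complex mat \<Rightarrow> complex Matrix.vec" where
  "vectorize N A = Matrix.vec (N ^ 2) (\<lambda>s. complex_of_real (Re (A $$ (s div N, s mod N))))"

lemma vectorize_carrier [simp]: "vectorize N A \<in> carrier_vec (N ^ 2)" "dim_vec (vectorize N A) = N ^ 2"
  by (simp_all add: vectorize_def)

lemma tensor_power_2_index:
  assumes "K \<in> carrier_mat N N" "s < N ^ 2" "t < N ^ 2"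
  shows "tensor_power 2 K $$ (s, t) = K $$ (s div N, t div N) * K $$ (s mod N, t mod N)"
proof -
  have "N > 0" using assms(2) by (cases N) auto
  then show ?thesis using assms
    by (simp add: numeral_2_eq_2 tensor_mat_def less_mult_imp_div_less)
qed

lemma tensor_power_2_ketbra:
  assumes "dim_vec \<psi> = N" "s < N ^ 2" "t < N ^ 2"
  shows "tensor_power 2 (ketbra \<psi>) $$ (s, t)
    = \<psi> $ (s div N) * cnj (\<psi> $ (t div N)) * (\<psi> $ (s mod N) * cnj (\<psi> $ (t mod N)))"
proof -
  have "N > 0" using assms(2) by (cases N) auto
  moreover have "ketbra \<psi> \<in> carrier_mat N N"
    using assms(1) by (intro carrier_matI) (simp_all add: ketbra_def)
  ultimately show ?thesis using assms
    by (subst tensor_power_2_index[of _ N])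
      (simp_all add: ketbra_def power2_eq_square less_mult_imp_div_less)
qed

lemma state_moment_carrier [simp]: "state_moment N k M \<psi> \<in> carrier_mat (N ^ k) (N ^ k)"
  by (simp add: state_moment_def)

lemma dim_state_moment [simp]:
  "dim_row (state_moment N k M \<psi>) = N ^ k" "dim_col (state_moment N k M \<psi>) = N ^ k"
  by (simp_all add: state_moment_def)

lemma sum_div_mod:
  fixes f :: "nat \<Rightarrow> nat \<Rightarrow> 'a :: comm_monoid_add"
  assumes "N > 0"
  shows "(\<Sum>s<N ^ 2. f (s div N) (s mod N)) = (\<Sum>i<N. \<Sum>j<N. f i j)"
proof -
  have "(\<Sum>s<N ^ 2. f (s div N) (s mod N)) = (\<Sum>(i, j)\<in>{..<N} \<times> {..<N}. f i j)"
  proof (rule sum.reindex_bij_witness[of _ "\<lambda>(i, j). i * N + j" "\<lambda>s. (s div N, s mod N)"])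
    fix s assume "s \<in> {..<N ^ 2}"
    then show "(s div N, s mod N) \<in> {..<N} \<times> {..<N}"
      using assms by (simp add: power2_eq_square less_mult_imp_div_less)
  next
    fix p assume p: "p \<in> {..<N} \<times> {..<N}"
    obtain i j where ij: "p = (i, j)" "i < N" "j < N" using p by auto
    have "i * N + j < (i + 1) * N" using ij by simp
    also have "\<dots> \<le> N * N" using ij by (intro mult_right_mono) auto
    finally show "(case p of (i, j) \<Rightarrow> i * N + j) \<in> {..<N ^ 2}"
      using ij by (simp add: power2_eq_square)
  qed (use assms in auto)
  then show ?thesis by (simp add: sum.cartesian_product)
qed

lemma cnj_measurable: "cnj \<in> borel_measurable borel"
  by (intro borel_measurable_continuous_onI continuous_intros)

lemma mult_unit_vec_index:
  fixes X :: "complex mat"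
  assumes "X \<in> carrier_mat N N" "i < N" "j < N"
  shows "(X *\<^sub>v unit_vec N j) $ i = X $$ (i, j)"
  using assms by (simp add: scalar_prod_right_unit)

text \<open>With \<open>a\<close> the entries of the test vector and \<open>w\<close> the real
  amplitudes of psi tensor psi, the form is the expectation of the square of the sum of
  \<open>a s * w \<omega> s\<close>; \<open>sum_div_mod\<close> turns that sum into psi^T A
  psi.\<close>

lemma state_moment_quadratic_form:
  fixes X :: "'w \<Rightarrow> complex mat" and A :: "complex mat"
  assumes M: "prob_space M" and N: "N > 0"
    and carrier: "\<And>\<omega>. X \<omega> \<in> carrier_mat N N"
    and meas: "\<And>i. i < N \<Longrightarrow> (\<lambda>\<omega>. X \<omega> $$ (i, 0)) \<in> borel_measurable M"
    and orth: "AE \<omega> in M. X \<omega> \<in> orthogonal_group N"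
  shows "(state_moment N 2 M (\<lambda>\<omega>. X \<omega> *\<^sub>v unit_vec N 0) *\<^sub>v vectorize N A) \<bullet>c vectorize N A
    = complex_of_real (LINT \<omega>|M. (haar_conj N A (X \<omega>) 0 0)\<^sup>2)"
proof -
  interpret prob_space M by fact
  define a where "a s = Re (A $$ (s div N, s mod N))" for s
  define w where "w \<omega> s = Re (X \<omega> $$ (s div N, 0)) * Re (X \<omega> $$ (s mod N, 0))" for \<omega> s
  let ?\<rho> = "state_moment N 2 M (\<lambda>\<omega>. X \<omega> *\<^sub>v unit_vec N 0)"
  have ms: "s div N < N" "s mod N < N" if "s < N ^ 2" for s
    using that N by (auto simp: power2_eq_square less_mult_imp_div_less)
  have wm: "(\<lambda>\<omega>. w \<omega> s) \<in> borel_measurable M" if "s < N ^ 2" for s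
    unfolding w_def using ms[OF that] meas
    by (intro borel_measurable_times measurable_compose[OF _ borel_measurable_Re]) auto
  have wb: "AE \<omega> in M. \<bar>w \<omega> s\<bar> \<le> 1" if "s < N ^ 2" for s
  proof (use orth in eventually_elim)
    case (elim \<omega>)
    then have "\<bar>Re (X \<omega> $$ (i, 0))\<bar> \<le> 1" if "i < N" for i
      using abs_Re_le_cmod unitary_entry_norm_le[OF orthogonal_group_unitary that N] order_trans by blast
    then show ?case using ms[OF that] by (auto simp: w_def abs_mult intro!: mult_le_one)
  qed
  have int: "integrable M (\<lambda>\<omega>. w \<omega> s * w \<omega> t)" if "s < N ^ 2" "t < N ^ 2" for s t
  proof (rule integrable_const_bound[where B = 1])
    show "AE \<omega> in M. norm (w \<omega> s * w \<omega> t) \<le> 1"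
      using wb[OF that(1)] wb[OF that(2)] by eventually_elim (auto simp: abs_mult intro!: mult_le_one)
  qed (use wm that in auto)
  have \<rho>: "?\<rho> $$ (s, t) = complex_of_real (LINT \<omega>|M. w \<omega> s * w \<omega> t)" if "s < N ^ 2" "t < N ^ 2" for s t
  proof -
    define f where "f \<omega> = X \<omega> $$ (s div N, 0) * cnj (X \<omega> $$ (t div N, 0)) *
      (X \<omega> $$ (s mod N, 0) * cnj (X \<omega> $$ (t mod N, 0)))" for \<omega>
    have "tensor_power 2 (ketbra (X \<omega> *\<^sub>v unit_vec N 0)) $$ (s, t) = f \<omega>" for \<omega>
    proof -
      have "dim_vec (X \<omega> *\<^sub>v unit_vec N 0) = N" using carrier[of \<omega>] by simp
      from tensor_power_2_ketbra[OF this that] show ?thesis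
        using ms[OF that(1)] ms[OF that(2)]
        unfolding f_def by (simp only: mult_unit_vec_index[OF carrier _ N])
    qed
    then have "?\<rho> $$ (s, t) = (LINT \<omega>|M. f \<omega>)"
      using that by (simp add: state_moment_def)
    \<comment> \<open>Orthogonality is only almost sure, so amplitudes are replaced by their real
      parts under the integral, where null sets do not matter.\<close>
    also have "\<dots> = (LINT \<omega>|M. complex_of_real (w \<omega> s * w \<omega> t))"
    proof (rule integral_cong_AE)
      show "AE \<omega> in M. f \<omega> = complex_of_real (w \<omega> s * w \<omega> t)"
      proof (use orth in eventually_elim)
        case (elim \<omega>)
        have "X \<omega> $$ (i, 0) = complex_of_real (Re (X \<omega> $$ (i, 0)))" if "i < N" for i
          using orthogonal_group_real[OF elim that N] by (simp add: of_real_Re)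
        then have "X \<omega> $$ (i, 0) = complex_of_real (Re (X \<omega> $$ (i, 0)))"
            "cnj (X \<omega> $$ (i, 0)) = complex_of_real (Re (X \<omega> $$ (i, 0)))" if "i < N" for i
          using that by (metis, metis complex_cnj_complex_of_real)
        note r = this[OF ms(1)[OF that(1)]] this[OF ms(1)[OF that(2)]]
          this[OF ms(2)[OF that(1)]] this[OF ms(2)[OF that(2)]]
        show ?case unfolding f_def w_def r(4,8) using r by simp
      qed
      show "f \<in> borel_measurable M"
        unfolding f_def using ms[OF that(1)] ms[OF that(2)] meas
        by (intro borel_measurable_times measurable_compose[OF _ cnj_measurable]) auto
      show "(\<lambda>\<omega>. complex_of_real (w \<omega> s * w \<omega> t)) \<in> borel_measurable M"
        using wm that by auto
    qed
    finally show ?thesis unfolding integral_complex_of_real .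
  qed
  have "(?\<rho> *\<^sub>v vectorize N A) \<bullet>c vectorize N A
      = (\<Sum>s<N ^ 2. (\<Sum>t<N ^ 2. ?\<rho> $$ (s, t) * complex_of_real (a t)) * complex_of_real (a s))"
    by (simp add: scalar_prod_def vectorize_def a_def atLeast0LessThan row_def)
  also have "\<dots> = complex_of_real (\<Sum>s<N ^ 2. \<Sum>t<N ^ 2. a s * a t * (LINT \<omega>|M. w \<omega> s * w \<omega> t))"
    by (simp add: \<rho> sum_distrib_left mult_ac)
  also have "(\<Sum>s<N ^ 2. \<Sum>t<N ^ 2. a s * a t * (LINT \<omega>|M. w \<omega> s * w \<omega> t))
      = (LINT \<omega>|M. (\<Sum>s<N ^ 2. \<Sum>t<N ^ 2. a s * a t * (w \<omega> s * w \<omega> t)))"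
    by (rule has_bochner_integral_integral_eq[symmetric],
        intro has_bochner_integral_sum has_bochner_integral_mult_right has_bochner_integral_integrable int) auto
  also have "(\<lambda>\<omega>. \<Sum>s<N ^ 2. \<Sum>t<N ^ 2. a s * a t * (w \<omega> s * w \<omega> t)) = (\<lambda>\<omega>. (haar_conj N A (X \<omega>) 0 0)\<^sup>2)"
  proof
    fix \<omega>
    have "(\<Sum>s<N ^ 2. \<Sum>t<N ^ 2. a s * a t * (w \<omega> s * w \<omega> t)) = (\<Sum>s<N ^ 2. a s * w \<omega> s)\<^sup>2"
      by (simp add: power2_eq_square sum_product mult_ac)
    also have "(\<Sum>s<N ^ 2. a s * w \<omega> s) = haar_conj N A (X \<omega>) 0 0"
      unfolding a_def w_def haar_conj_def
      using sum_div_mod[OF N, of "\<lambda>i j. Re (A $$ (i, j)) * (Re (X \<omega> $$ (i, 0)) * Re (X \<omega> $$ (j, 0)))"]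
      by (simp add: mult_ac)
    finally show "(\<Sum>s<N ^ 2. \<Sum>t<N ^ 2. a s * a t * (w \<omega> s * w \<omega> t)) = (haar_conj N A (X \<omega>) 0 0)\<^sup>2" .
  qed
  finally show ?thesis .
qed

lemma loewner_le_quadratic_form:
  assumes "A \<preceq>\<^sub>L B" "A \<in> carrier_mat m m" "B \<in> carrier_mat m m" "v \<in> carrier_vec m"
  shows "(A *\<^sub>v v) \<bullet>c v \<le> (B *\<^sub>v v) \<bullet>c v"
proof -
  have "0 \<le> ((B - A) *\<^sub>v v) \<bullet>c v" using assms by (auto simp: loewner_le_def psd_def)
  also have "(B - A) *\<^sub>v v = B *\<^sub>v v - A *\<^sub>v v" using assms by (intro minus_mult_distrib_mat_vec)
  also have "(B *\<^sub>v v - A *\<^sub>v v) \<bullet>c v = (B *\<^sub>v v) \<bullet>c v - (A *\<^sub>v v) \<bullet>c v"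
    using assms by (intro minus_scalar_prod_distrib[of _ m]) auto
  finally show ?thesis by simp
qed

lemma smult_quadratic_form:
  fixes A :: "complex mat"
  assumes "A \<in> carrier_mat m m" "v \<in> carrier_vec m"
  shows "((c \<cdot>\<^sub>m A) *\<^sub>v v) \<bullet>c v = c * ((A *\<^sub>v v) \<bullet>c v)"
proof -
  have "(c \<cdot>\<^sub>m A) *\<^sub>v v = c \<cdot>\<^sub>v (A *\<^sub>v v)"
    using assms by (intro eq_vecI) auto
  then show ?thesis
    using assms smult_scalar_prod_distrib[of "A *\<^sub>v v" m "conjugate v" c] by simp
qed

lemma orthogonal_state_design_bounds:
  fixes X :: "'w \<Rightarrow> complex mat"
  assumes design: "orthogonal_state_design 2 n \<epsilon> M (\<lambda>\<omega>. X \<omega> *\<^sub>v zero_ket n)"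
    and M: "prob_space M"
    and carrier: "\<And>\<omega>. X \<omega> \<in> carrier_mat (2 ^ n) (2 ^ n)"
    and meas: "\<And>i. i < 2 ^ n \<Longrightarrow> (\<lambda>\<omega>. X \<omega> $$ (i, 0)) \<in> borel_measurable M"
    and orth: "AE \<omega> in M. X \<omega> \<in> orthogonal_group (2 ^ n)"
    and A: "A \<in> carrier_mat (2 ^ n) (2 ^ n)" "\<And>i j. i < 2 ^ n \<Longrightarrow> j < 2 ^ n \<Longrightarrow> A $$ (i, j) \<in> \<real>"
      "\<And>i j. i < 2 ^ n \<Longrightarrow> j < 2 ^ n \<Longrightarrow> A $$ (i, j) = A $$ (j, i)"
      "A * A = 1\<^sub>m (2 ^ n)" "(\<Sum>i<2 ^ n. A $$ (i, i)) = 0"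
  shows "(1 - \<epsilon>) * (2 / (2 ^ n + 2)) \<le> (LINT \<omega>|M. (haar_conj (2 ^ n) A (X \<omega>) 0 0)\<^sup>2)"
    and "(LINT \<omega>|M. (haar_conj (2 ^ n) A (X \<omega>) 0 0)\<^sup>2) \<le> (1 + \<epsilon>) * (2 / (2 ^ n + 2))"
proof -
  let ?N = "2 ^ n :: nat"
  obtain H where H: "is_haar_orthogonal ?N H"
    and lo: "complex_of_real (1 - \<epsilon>) \<cdot>\<^sub>m state_moment ?N 2 H (\<lambda>U. U *\<^sub>v zero_ket n)
        \<preceq>\<^sub>L state_moment ?N 2 M (\<lambda>\<omega>. X \<omega> *\<^sub>v zero_ket n)"
    and hi: "state_moment ?N 2 M (\<lambda>\<omega>. X \<omega> *\<^sub>v zero_ket n)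
        \<preceq>\<^sub>L complex_of_real (1 + \<epsilon>) \<cdot>\<^sub>m state_moment ?N 2 H (\<lambda>U. U *\<^sub>v zero_ket n)"
    using design unfolding orthogonal_state_design_def Let_def by blast
  interpret haar_observable ?N H A by unfold_locales (use H A in auto)
  let ?v = "vectorize ?N A"
  text \<open>Replacing \<open>U\<close> by \<open>1\<close> off the null set makes the carrier condition hold everywhere.\<close>
  let ?Y = "\<lambda>U. if U \<in> orthogonal_group ?N then U else 1\<^sub>m ?N"
  have mom: "state_moment ?N 2 H (\<lambda>U. U *\<^sub>v zero_ket n) = state_moment ?N 2 H (\<lambda>U. ?Y U *\<^sub>v zero_ket n)"
    unfolding state_moment_def
    by (intro cong_mat) (auto intro!: Bochner_Integration.integral_cong simp: space_haar[OF H])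
  have "(state_moment ?N 2 H (\<lambda>U. ?Y U *\<^sub>v zero_ket n) *\<^sub>v ?v) \<bullet>c ?v
      = complex_of_real (LINT U|H. (haar_conj ?N A (?Y U) 0 0)\<^sup>2)"
  proof (rule state_moment_quadratic_form)
    show "AE U in H. ?Y U \<in> orthogonal_group ?N" by (intro AE_I2) (simp add: space_haar[OF H])
    show "(\<lambda>U. ?Y U $$ (i, 0)) \<in> borel_measurable H" if "i < ?N" for i
      using haar_entry_measurable[OF H that, of 0]
      by (subst measurable_cong[where g = "\<lambda>U. U $$ (i, 0)"]) (auto simp: space_haar[OF H])
  qed (use prob_space_haar[OF H] orthogonal_carrier[of ?N] in auto)
  \<comment> \<open>The state is column 0 of \<open>U\<close>, so the Haar side is a diagonal moment
    of the conjugated observable.\<close>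
  also have "(LINT U|H. (haar_conj ?N A (?Y U) 0 0)\<^sup>2) = W 0 0 0 0"
    unfolding W_def by (intro Bochner_Integration.integral_cong) (auto simp: space_haar[OF H] power2_eq_square)
  also have "\<dots> = 2 / (2 ^ n + 2)" using W_diag[of 0] by simp
  finally have \<rho>: "(state_moment ?N 2 H (\<lambda>U. U *\<^sub>v zero_ket n) *\<^sub>v ?v) \<bullet>c ?v = complex_of_real (2 / (2 ^ n + 2))"
    by (simp add: mom)
  have \<sigma>: "(state_moment ?N 2 M (\<lambda>\<omega>. X \<omega> *\<^sub>v zero_ket n) *\<^sub>v ?v) \<bullet>c ?v
      = complex_of_real (LINT \<omega>|M. (haar_conj ?N A (X \<omega>) 0 0)\<^sup>2)"
    using M carrier meas orth by (intro state_moment_quadratic_form) auto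
  have car: "state_moment ?N 2 H (\<lambda>U. U *\<^sub>v zero_ket n) \<in> carrier_mat (?N ^ 2) (?N ^ 2)" by simp
  have "complex_of_real ((1 - \<epsilon>) * (2 / (2 ^ n + 2))) \<le> complex_of_real (LINT \<omega>|M. (haar_conj ?N A (X \<omega>) 0 0)\<^sup>2)"
    using loewner_le_quadratic_form[OF lo, of "?N ^ 2" ?v] unfolding smult_quadratic_form[OF car vectorize_carrier(1)] \<rho> \<sigma>
    by simp
  then show "(1 - \<epsilon>) * (2 / (2 ^ n + 2)) \<le> (LINT \<omega>|M. (haar_conj ?N A (X \<omega>) 0 0)\<^sup>2)"
    by (simp add: less_eq_complex_def)
  have "complex_of_real (LINT \<omega>|M. (haar_conj ?N A (X \<omega>) 0 0)\<^sup>2) \<le> complex_of_real ((1 + \<epsilon>) * (2 / (2 ^ n + 2)))"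
    using loewner_le_quadratic_form[OF hi, of "?N ^ 2" ?v] unfolding smult_quadratic_form[OF car vectorize_carrier(1)] \<rho> \<sigma>
    by simp
  then show "(LINT \<omega>|M. (haar_conj ?N A (X \<omega>) 0 0)\<^sup>2) \<le> (1 + \<epsilon>) * (2 / (2 ^ n + 2))"
    by (simp add: less_eq_complex_def)
qed


section \<open>Circuits layer by layer, and measurability of the circuit unitary\<close>

section \<open>Circuits\<close>

text \<open>Excludes gates with empty support. An empty support is disjoint from itself, so
  disjointness within a layer would not make the gate at a given location unique.\<close>

lemma connected_qubits_nonempty: "connected_qubits G a \<Longrightarrow> a \<noteq> {}"
  by (auto simp: connected_qubits_def connected_def strongly_connected_def)

lemma circuitsD:
  assumes "C \<in> circuits G r d" "(i, a, g) \<in> C"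
  shows "i < d" "connected_qubits G a" "card a \<le> r" "g \<in> unitary_group (2 ^ card a)" "a \<noteq> {}"
  using assms connected_qubits_nonempty unfolding circuits_def by fast+

lemma circuits_disjoint:
  assumes "C \<in> circuits G r d" "(i, a, g) \<in> C" "(i, a', g') \<in> C"
  shows "(a, g) = (a', g') \<or> a \<inter> a' = {}"
  using assms unfolding circuits_def by fast

lemma circuits_unique:
  assumes "C \<in> circuits G r d" "(i, a, g) \<in> C" "(i, a, g') \<in> C"
  shows "g = g'"
  using circuits_disjoint[OF assms] circuitsD(5)[OF assms(1,2)] by auto

lemma circuits_gate_carrier:
  "C \<in> circuits G r d \<Longrightarrow> (i, a, g) \<in> C \<Longrightarrow> g \<in> carrier_mat (2 ^ card a) (2 ^ card a)"
  by (rule unitary_groupD(1)[OF circuitsD(4)])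

lemma circuits_support:
  assumes "architecture n G" "C \<in> circuits G r d" "(i, a, g) \<in> C"
  shows "a \<subseteq> {..<n}"
  using assms circuitsD(2)[OF assms(2,3)] by (simp add: architecture_def connected_qubits_def)

lemma circuits_layer:
  assumes "architecture n G" "C \<in> circuits G r d"
  shows "layer n {s. (i, s) \<in> C}"
  unfolding layer_def
proof (intro conjI ballI)
  let ?S = "{s. (i, s) \<in> C}"
  \<comment> \<open>Finiteness of a circuit comes from here: within a layer a gate is determined by
    its support, and there are finitely many supports.\<close>
  have "inj_on fst ?S"
    using circuits_unique[OF assms(2)] by (force simp: inj_on_def)
  moreover have "fst ` ?S \<subseteq> Pow {..<n}"
    using circuits_support[OF assms] by (simp add: image_subset_iff)
  ultimately show "finite ?S"
    by (metis finite_Pow_iff finite_imageD finite_lessThan finite_subset)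
next
  fix s assume "s \<in> {s. (i, s) \<in> C}"
  then show "fst s \<subseteq> {..<n}" "snd s \<in> unitary_group (2 ^ card (fst s))"
    using circuits_support[OF assms, of i "fst s" "snd s"] circuitsD(4)[OF assms(2), of i "fst s" "snd s"] by auto
next
  fix s s' assume "s \<in> {s. (i, s) \<in> C}" "s' \<in> {s. (i, s) \<in> C}"
  then show "s = s' \<or> fst s \<inter> fst s' = {}"
    using circuits_disjoint[OF assms(2), of i "fst s" "snd s" "fst s'" "snd s'"] by (auto simp: prod_eq_iff)
qed

lemma circuit_mat_carrier [simp]: "circuit_mat n k C \<in> carrier_mat (2 ^ n) (2 ^ n)"
  by (induction k) (auto intro: mult_carrier_mat)

lemma space_circuit_borel: "space (circuit_borel G r d) = circuits G r d"
  unfolding circuit_borel_def by (rule space_measure_of) auto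

lemma circuit_event_measurable:
  assumes "B \<in> sets (mat_borel (2 ^ card a))"
  shows "{C \<in> circuits G r d. \<exists>g\<in>B. (i, a, g) \<in> C} \<in> sets (circuit_borel G r d)"
proof -
  let ?\<A> = "{{C \<in> circuits G r d. \<exists>g \<in> B. (i, a, g) \<in> C} | i a B. B \<in> sets (mat_borel (2 ^ card a))}"
  have "{C \<in> circuits G r d. \<exists>g\<in>B. (i, a, g) \<in> C} \<in> ?\<A>" using assms by blast
  moreover have "?\<A> \<subseteq> Pow (circuits G r d)" by auto
  ultimately show ?thesis unfolding circuit_borel_def by (auto intro: sigma_sets.Basic)
qed

lemma gate_present_measurable:
  "{C \<in> circuits G r d. \<exists>g. (i, a, g) \<in> C} \<in> sets (circuit_borel G r d)"
proof -
  let ?K = "carrier_mat (2 ^ card a) (2 ^ card a) :: complex mat set"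
  have "(\<exists>g. (i, a, g) \<in> C) \<longleftrightarrow> (\<exists>g\<in>?K. (i, a, g) \<in> C)" if "C \<in> circuits G r d" for C
    using circuits_gate_carrier[OF that, of i a] by blast
  then have "{C \<in> circuits G r d. \<exists>g. (i, a, g) \<in> C} = {C \<in> circuits G r d. \<exists>g\<in>?K. (i, a, g) \<in> C}"
    by (intro Collect_cong conj_cong refl)
  moreover have "?K \<in> sets (mat_borel (2 ^ card a))"
    using sets.top[of "mat_borel (2 ^ card a)"] by simp
  ultimately show ?thesis using circuit_event_measurable[of ?K a G r d i] by simp
qed

text \<open>With the default 1 for an absent gate, a layer entry becomes a product over all subsets
  of the qubits, an index set that does not depend on the circuit.\<close>

definition gate_entry :: "nat \<Rightarrow> nat set \<Rightarrow> nat \<Rightarrow> nat \<Rightarrow> circuit \<Rightarrow> complex" where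
  "gate_entry i a p q C = (if \<exists>g. (i, a, g) \<in> C then (THE g. (i, a, g) \<in> C) $$ (p, q) else 1)"

lemma gate_entry_eq:
  assumes "C \<in> circuits G r d" "(i, a, g) \<in> C"
  shows "gate_entry i a p q C = g $$ (p, q)"
proof -
  have "(THE g. (i, a, g) \<in> C) = g"
    using assms circuits_unique[OF assms(1)] by blast
  then show ?thesis using assms by (auto simp: gate_entry_def)
qed

lemma gate_entry_measurable:
  assumes "p < 2 ^ card a" "q < 2 ^ card a"
  shows "gate_entry i a p q \<in> borel_measurable (circuit_borel G r d)"
proof (rule measurableI)
  fix Y :: "complex set" assume Y: "Y \<in> sets borel"
  let ?B = "(\<lambda>A. A $$ (p, q)) -` Y \<inter> space (mat_borel (2 ^ card a))"
  have B: "?B \<in> sets (mat_borel (2 ^ card a))"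
    by (rule measurable_sets[OF measurable_mat_entry[OF assms] Y])
  \<comment> \<open>The second set collects the circuits without a gate at this location, where the
    entry takes its default value 1.\<close>
  have "gate_entry i a p q -` Y \<inter> space (circuit_borel G r d)
      = {C \<in> circuits G r d. \<exists>g\<in>?B. (i, a, g) \<in> C} \<union>
        (if 1 \<in> Y then circuits G r d - {C \<in> circuits G r d. \<exists>g. (i, a, g) \<in> C} else {})" (is "?L = ?R")
  proof (rule Set.set_eqI)
    fix C show "C \<in> ?L \<longleftrightarrow> C \<in> ?R"
    proof (cases "C \<in> circuits G r d")
      case C: True
      show ?thesis
      proof (cases "\<exists>g. (i, a, g) \<in> C")
        case True
        then obtain g where g: "(i, a, g) \<in> C" by blast
        have "(\<exists>h\<in>?B. (i, a, h) \<in> C) \<longleftrightarrow> g \<in> ?B"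
          using g circuits_unique[OF C g] by (metis (no_types, lifting))
        also have "\<dots> \<longleftrightarrow> g $$ (p, q) \<in> Y"
          using circuits_gate_carrier[OF C g] by simp
        finally have 1: "(\<exists>h\<in>?B. (i, a, h) \<in> C) \<longleftrightarrow> g $$ (p, q) \<in> Y" .
        have "C \<in> ?R \<longleftrightarrow> (\<exists>h\<in>?B. (i, a, h) \<in> C)"
          using C True by (simp del: space_mat_borel)
        then show ?thesis using C 1 gate_entry_eq[OF C g] by (simp add: space_circuit_borel)
      next
        case False
        then have "gate_entry i a p q C = 1" by (simp add: gate_entry_def)
        then show ?thesis using C False by (simp add: space_circuit_borel)
      qed
    qed (auto simp: space_circuit_borel)
  qed
  moreover have "circuits G r d \<in> sets (circuit_borel G r d)"
    using sets.top[of "circuit_borel G r d"] by (simp add: space_circuit_borel)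
  ultimately show "gate_entry i a p q -` Y \<inter> space (circuit_borel G r d) \<in> sets (circuit_borel G r d)"
    using circuit_event_measurable[OF B] gate_present_measurable by (simp add: sets.Diff sets.Un)
qed simp

text \<open>Here the circuit enters only through the presence and the entries of gates at fixed
  locations, combined by finite operations, so measurability can be read off.\<close>

lemma layer_mat_gate_entry:
  assumes "architecture n G" "C \<in> circuits G r d" "i < 2 ^ n" "j < 2 ^ n"
  shows "layer_mat n {s. (k, s) \<in> C} $$ (i, j) =
    (if \<forall>q<n. bit i q = bit j q \<or> (\<exists>a\<in>Pow {..<n}. q \<in> a \<and> (\<exists>g. (k, a, g) \<in> C))
     then \<Prod>a\<in>Pow {..<n}. gate_entry k a (subindex a i) (subindex a j) C else 0)"
proof -
  let ?S = "{s. (k, s) \<in> C}"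
  have fst: "fst ` ?S \<subseteq> Pow {..<n}"
    using circuits_support[OF assms(1,2)] by (simp add: image_subset_iff)
  have inj: "inj_on fst ?S" using circuits_unique[OF assms(2)] by (force simp: inj_on_def)
  have agr: "agree n (- \<Union> (fst ` ?S)) i j \<longleftrightarrow>
      (\<forall>q<n. bit i q = bit j q \<or> (\<exists>a\<in>Pow {..<n}. q \<in> a \<and> (\<exists>g. (k, a, g) \<in> C)))"
    using circuits_support[OF assms(1,2)] unfolding agree_def by (fastforce simp: image_iff)
  have "(\<Prod>(a, g)\<in>?S. g $$ (subindex a i, subindex a j))
      = (\<Prod>s\<in>?S. gate_entry k (fst s) (subindex (fst s) i) (subindex (fst s) j) C)"
    using gate_entry_eq[OF assms(2)] by (intro prod.cong) (auto split: prod.splits)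
  also have "\<dots> = (\<Prod>a\<in>fst ` ?S. gate_entry k a (subindex a i) (subindex a j) C)"
    using prod.reindex[OF inj, of "\<lambda>a. gate_entry k a (subindex a i) (subindex a j) C"] by simp
  also have "\<dots> = (\<Prod>a\<in>Pow {..<n}. gate_entry k a (subindex a i) (subindex a j) C)"
    using fst by (intro prod.mono_neutral_left) (auto simp: gate_entry_def image_iff)
  finally show ?thesis unfolding layer_mat_index[OF assms(3,4)] agr by (rule if_cong[OF refl _ refl])
qed

lemma layer_mat_entry_measurable:
  assumes "architecture n G" "i < 2 ^ n" "j < 2 ^ n"
  shows "(\<lambda>C. layer_mat n {s. (k, s) \<in> C} $$ (i, j)) \<in> borel_measurable (circuit_borel G r d)"
proof -
  let ?M = "circuit_borel G r d"
  have [measurable]: "Measurable.pred ?M (\<lambda>C. \<exists>g. (k, a, g) \<in> C)" for a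
    using gate_present_measurable[of G r d k a] by (simp add: pred_def space_circuit_borel)
  have [measurable]: "gate_entry k a (subindex a i) (subindex a j) \<in> borel_measurable ?M" if "a \<in> Pow {..<n}" for a
    using that finite_subset[of a "{..<n}"] by (intro gate_entry_measurable subindex_less) auto
  have "(\<lambda>C. if \<forall>q<n. bit i q = bit j q \<or> (\<exists>a\<in>Pow {..<n}. q \<in> a \<and> (\<exists>g. (k, a, g) \<in> C))
     then \<Prod>a\<in>Pow {..<n}. gate_entry k a (subindex a i) (subindex a j) C else 0) \<in> borel_measurable ?M"
    by measurable
  then show ?thesis
    by (subst measurable_cong[OF layer_mat_gate_entry[OF assms(1) _ assms(2,3)]])
      (auto simp: space_circuit_borel)
qed

lemma circuit_mat_entry_measurable:
  assumes "architecture n G" "i < 2 ^ n" "j < 2 ^ n"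
  shows "(\<lambda>C. circuit_mat n k C $$ (i, j)) \<in> borel_measurable (circuit_borel G r d)"
  using assms(2,3)
proof (induction k arbitrary: i j)
  case 0
  then show ?case by simp
next
  case (Suc k)
  have "circuit_mat n (Suc k) C $$ (i, j)
      = (\<Sum>l<2 ^ n. layer_mat n {s. (k, s) \<in> C} $$ (i, l) * circuit_mat n k C $$ (l, j))" for C
    using Suc.prems by (simp add: mat_mult_index[of _ "2 ^ n" "2 ^ n" _ "2 ^ n"] del: index_mult_mat)
  then show ?case using Suc layer_mat_entry_measurable[OF assms(1)]
    by (simp only:) (intro borel_measurable_sum borel_measurable_times, auto)
qed


section \<open>Lightcones and graph distance\<close>

section \<open>Lightcones\<close>

lemma relpow_sym:
  assumes "sym R" "(x, y) \<in> R ^^ m"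
  shows "(y, x) \<in> R ^^ m"
  using assms(2)
proof (induction m arbitrary: y)
  case (Suc m)
  then obtain z where "(x, z) \<in> R ^^ m" "(z, y) \<in> R" by auto
  then have "(y, z) \<in> R" "(z, x) \<in> R ^^ m" using Suc.IH assms(1) by (auto dest: symD)
  then show ?case by (rule relpow_Suc_I2)
qed simp

lemma relpow_subset: "R \<subseteq> (S :: ('a \<times> 'a) set) \<Longrightarrow> R ^^ m \<subseteq> S ^^ m"
  by (induction m) auto

lemma architecture_sym: "architecture n G \<Longrightarrow> sym (parcs G)"
  unfolding architecture_def
  using pair_graph.axioms(2) pair_pseudo_graph.axioms(2) pair_sym_digraph.pair_sym_arcs
    pair_sym_digraph_axioms_def pair_sym_digraph_def symmetric_def
  by (metis with_proj_simps(3))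

text \<open>The bound r^2 counts edges: reachability in a finite relation takes no more steps than
  the relation has pairs, and inside \<open>a\<close> there are at most
  \<open>card a * card a\<close>.\<close>

lemma connected_qubits_relpow:
  assumes G: "architecture n G" and a: "connected_qubits G a" "card a \<le> r" and tz: "t \<in> a" "z \<in> a"
  shows "\<exists>m\<le>r\<^sup>2. (t, z) \<in> parcs G ^^ m"
proof -
  define R where "R = parcs G \<inter> a \<times> a"
  have "finite a"
    using a G finite_subset[of a "{..<n}"] by (simp add: connected_qubits_def architecture_def)
  then have fin: "finite R" and card: "card R \<le> card a * card a"
    using card_mono[of "a \<times> a" R] by (auto simp: R_def card_cartesian_product)
  \<comment> \<open>\<open>connected\<close> refers to the symmetric closure of the induced
    subgraph; as the architecture is symmetric, the closure adds no edge.\<close>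
  have "arcs_ends (with_proj (mk_symmetric (with_proj G \<restriction> a))) \<subseteq> R"
    using symD[OF architecture_sym[OF G]] by (auto simp: mk_symmetric_def R_def)
  moreover have "(t, z) \<in> (arcs_ends (with_proj (mk_symmetric (with_proj G \<restriction> a))))\<^sup>*"
  proof (rule rtrancl_on_rtranclI)
    show "(t, z) \<in> rtrancl_on (verts (with_proj (mk_symmetric (with_proj G \<restriction> a))))
        (arcs_ends (with_proj (mk_symmetric (with_proj G \<restriction> a))))"
      using a(1) tz unfolding connected_qubits_def connected_def strongly_connected_def reachable_def
      by (simp add: mk_symmetric_def)
  qed
  ultimately have "(t, z) \<in> R\<^sup>*" using rtrancl_mono by blast
  then obtain m where m: "m \<le> card R" "(t, z) \<in> R ^^ m"
    unfolding rtrancl_finite_eq_relpow[OF fin] by auto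
  have "R ^^ m \<subseteq> parcs G ^^ m" by (rule relpow_subset) (auto simp: R_def)
  moreover have "card R \<le> r\<^sup>2"
    using card a(2) mult_le_mono[of "card a" r "card a" r] by (simp add: power2_eq_square)
  ultimately show ?thesis using m by (meson order_trans subsetD)
qed

lemma graph_dist_le:
  assumes G: "architecture n G" and x: "x < n" and path: "(x, y) \<in> parcs G ^^ m"
  shows "graph_dist G x y \<le> ereal (real m)"
proof -
  interpret pair_graph G using G by (simp add: architecture_def)
  have "\<exists>p. awalk x p y \<and> length p = m" if "x \<in> pverts G"
    using path that
  proof (induction m arbitrary: x)
    case 0
    then show ?case by (auto simp: awalk_simps)
  next
    case (Suc m)
    then obtain z where z: "(x, z) \<in> parcs G" "(z, y) \<in> parcs G ^^ m"
      by (meson relpow_Suc_D2)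
    then obtain p where "awalk z p y" "length p = m"
      using Suc.IH[of z] arc_snd_in_verts[OF z(1)] by auto
    then show ?case using z arc_fst_in_verts[OF z(1)]
      by (intro exI[of _ "(x, z) # p"]) (auto simp: awalk_simps)
  qed
  then obtain p where p: "awalk x p y" "length p = m"
    using x G by (auto simp: architecture_def)
  have "awalk_cost (\<lambda>_. 1) p = real (length p)" by (induction p) auto
  then show ?thesis using min_cost_le_walk_cost[OF p(1), of "\<lambda>_. 1"] p(2)
    by (simp add: graph_dist_def)
qed

definition reach :: "nat pair_pre_digraph \<Rightarrow> nat \<Rightarrow> nat set \<Rightarrow> nat set" where
  "reach G k T = {z. \<exists>t\<in>T. \<exists>m\<le>k. (t, z) \<in> parcs G ^^ m}"

lemma reach_superset: "T \<subseteq> reach G k T"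
  by (force simp: reach_def intro: exI[of _ 0])

lemma reach_mono: "T \<subseteq> T' \<Longrightarrow> reach G k T \<subseteq> reach G k T'"
  by (auto simp: reach_def)

lemma reach_reach: "reach G k (reach G l T) \<subseteq> reach G (l + k) T"
proof
  fix z assume "z \<in> reach G k (reach G l T)"
  then obtain t y m m' where *: "t \<in> T" "m \<le> l" "(t, y) \<in> parcs G ^^ m" "m' \<le> k" "(y, z) \<in> parcs G ^^ m'"
    by (auto simp: reach_def)
  then have "(t, z) \<in> parcs G ^^ (m + m')" unfolding relpow_add by auto
  then show "z \<in> reach G (l + k) T" using * by (auto simp: reach_def intro!: exI[of _ "m + m'"] bexI[of _ t])
qed

text \<open>Each layer widens the support by at most r^2 steps, the reach of one gate. The last
  layer acts on the observable first, so the induction has to range over all \<open>T\<close> and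
  \<open>X\<close>.\<close>

lemma circuit_conj_local:
  assumes G: "architecture n G" and C: "C \<in> circuits G r d" and X: "local_on n T X"
  shows "local_on n (reach G (k * r\<^sup>2) T) (mat_adjoint (circuit_mat n k C) * X * circuit_mat n k C)"
  using X
proof (induction k arbitrary: T X)
  case 0
  then have "local_on n (reach G 0 T) X" using reach_superset by (rule local_on_mono)
  then show ?case using local_on_carrier[OF 0] by simp
next
  case (Suc k)
  let ?S = "{s. (k, s) \<in> C}"
  let ?T = "T \<union> \<Union> {a \<in> fst ` ?S. a \<inter> T \<noteq> {}}"
  have "?T \<subseteq> reach G (r\<^sup>2) T"
  proof
    fix z assume "z \<in> ?T"
    then consider "z \<in> T" | a g t where "(k, a, g) \<in> C" "t \<in> a" "t \<in> T" "z \<in> a" by auto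
    then show "z \<in> reach G (r\<^sup>2) T"
    proof cases
      case 1
      then show ?thesis using reach_superset by blast
    next
      case 2
      then show ?thesis
        using connected_qubits_relpow[OF G circuitsD(2,3)[OF C]] unfolding reach_def by blast
    qed
  qed
  then have "reach G (k * r\<^sup>2) ?T \<subseteq> reach G (k * r\<^sup>2) (reach G (r\<^sup>2) T)" by (rule reach_mono)
  also have "\<dots> \<subseteq> reach G (Suc k * r\<^sup>2) T" using reach_reach by simp
  finally have sub: "reach G (k * r\<^sup>2) ?T \<subseteq> reach G (Suc k * r\<^sup>2) T" .
  have "local_on n ?T (mat_adjoint (layer_mat n ?S) * X * layer_mat n ?S)"
    by (rule layer_conj_local[OF circuits_layer[OF G C] Suc.prems])
  from local_on_mono[OF Suc.IH[OF this] sub]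
  show ?case using local_on_carrier[OF Suc.prems] by (simp add: conj_conj[of X "2 ^ n"])
qed


section \<open>The antisymmetric observable and the diameter bound\<close>

section \<open>Antisymmetric observables\<close>

definition jmat :: "complex mat" where
  "jmat = Matrix.mat 2 2 (\<lambda>(i, j). if i = j then 0 else if i = 0 then 1 else - 1)"

text \<open>\<open>J\<^sub>x\<close> is \<open>\<i>\<close> times the Pauli operator \<open>Y\<close> on qubit \<open>x\<close>: real and antisymmetric.\<close>

definition J :: "nat \<Rightarrow> nat \<Rightarrow> complex mat" where
  "J n x = embed n {x} jmat"

lemma jmat_carrier [simp]: "jmat \<in> carrier_mat 2 2"
  by (simp add: jmat_def)

lemma jmat_square: "jmat * jmat = - 1\<^sub>m 2"
proof (rule eq_matI)
  fix i j assume "i < dim_row (- 1\<^sub>m 2 :: complex mat)" "j < dim_col (- 1\<^sub>m 2 :: complex mat)"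
  then have ij: "i < 2" "j < 2" by auto
  have "(jmat * jmat) $$ (i, j) = (\<Sum>k<2. jmat $$ (i, k) * jmat $$ (k, j))"
    using ij by (intro mat_mult_index[of _ 2 2 _ 2]) auto
  then show "(jmat * jmat) $$ (i, j) = (- 1\<^sub>m 2) $$ (i, j)"
    using ij by (auto simp: jmat_def numeral_2_eq_2 less_Suc_eq)
qed (auto simp: jmat_def)

lemma J_carrier [simp]: "J n x \<in> carrier_mat (2 ^ n) (2 ^ n)"
  by (simp add: J_def)

lemma J_local: "x < n \<Longrightarrow> local_on n {x} (J n x)"
  unfolding J_def by (rule embed_local) simp

lemma J_index:
  assumes "i < 2 ^ n" "j < 2 ^ n"
  shows "J n x $$ (i, j) = (if agree n (- {x}) i j \<and> bit i x \<noteq> bit j x then if bit i x then - 1 else 1 else 0)"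
  using assms by (auto simp: J_def embed_index jmat_def subindex_def)

lemma J_square:
  assumes "x < n"
  shows "J n x * J n x = - 1\<^sub>m (2 ^ n)"
proof -
  have "J n x * J n x = embed n {x} (- 1\<^sub>m 2)"
    unfolding J_def jmat_square[symmetric] using assms by (intro embed_mult[symmetric]) auto
  also have "\<dots> = - 1\<^sub>m (2 ^ n)"
  proof (rule eq_matI)
    fix i j assume "i < dim_row (- 1\<^sub>m (2 ^ n) :: complex mat)" "j < dim_col (- 1\<^sub>m (2 ^ n) :: complex mat)"
    then have ij: "i < 2 ^ n" "j < 2 ^ n" by auto
    have s: "subindex {x} i < 2" "subindex {x} j < 2" using subindex_less[of "{x}"] by auto
    have "1\<^sub>m (2 ^ n) $$ (i, j) = embed n {x} (1\<^sub>m 2) $$ (i, j)"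
      using embed_one[of "{x}" n] assms by simp
    then show "embed n {x} (- 1\<^sub>m 2) $$ (i, j) = (- 1\<^sub>m (2 ^ n)) $$ (i, j)"
      using ij s by (simp add: embed_index split: if_splits)
  qed auto
  finally show ?thesis .
qed

lemma JJ_square:
  assumes "x < n" "y < n" "x \<noteq> y"
  shows "(J n x * J n y) * (J n x * J n y) = 1\<^sub>m (2 ^ n)"
proof -
  note assoc = assoc_mult_mat[of _ "2 ^ n" "2 ^ n" _ "2 ^ n" _ "2 ^ n"]
  have comm: "J n y * J n x = J n x * J n y"
    using assms by (intro local_commute[OF J_local J_local]) auto
  have "(J n x * J n y) * (J n x * J n y) = J n x * ((J n y * J n x) * J n y)"
    by (simp add: assoc)
  also have "\<dots> = (J n x * J n x) * (J n y * J n y)"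
    unfolding comm by (simp add: assoc)
  also have "\<dots> = 1\<^sub>m (2 ^ n)" using assms by (simp add: J_square)
  finally show ?thesis .
qed

text \<open>Each factor flips its own bit, so the diagonal is zero. The sign depends only on whether
  the two bits are equal, which flipping both preserves; hence the product is symmetric.\<close>

lemma JJ_index:
  assumes "x < n" "y < n" "x \<noteq> y" "i < 2 ^ n" "j < 2 ^ n"
  shows "(J n x * J n y) $$ (i, j) =
    (if agree n (- {x, y}) i j \<and> bit i x \<noteq> bit j x \<and> bit i y \<noteq> bit j y
     then if bit i x = bit i y then 1 else - 1 else 0)"
proof -
  have "{x} \<inter> {y} = {}" using assms by auto
  moreover have "{y, x} = {x, y}" by auto
  moreover have "agree n (- {x}) i (merge n {x} j i)" "agree n (- {y}) i (merge n {y} j i)"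
    by (auto simp: agree_def)
  ultimately show ?thesis
    using assms by (subst mult_local_disjoint[OF J_local J_local]) (auto simp: J_index)
qed

text \<open>A real quadratic form agrees with that of the transposed matrix, which for an
  antisymmetric matrix is its negative.\<close>

lemma J_expectation_zero:
  assumes U: "U \<in> orthogonal_group (2 ^ n)"
  shows "(mat_adjoint U * J n x * U) $$ (0, 0) = 0"
proof -
  let ?N = "2 ^ n :: nat"
  have "J n x $$ (i, j) \<in> \<real>" if "i < ?N" "j < ?N" for i j
    using that by (simp add: J_index)
  then have "(mat_adjoint U * J n x * U) $$ (0, 0) = complex_of_real (haar_conj ?N (J n x) U 0 0)"
    by (intro haar_conj_eq[OF U]) auto
  have anti: "Re (J n x $$ (k, l)) = - Re (J n x $$ (l, k))" if "k < ?N" "l < ?N" for k l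
    using that by (auto simp: J_index agree_def)
  have "haar_conj ?N (J n x) U 0 0 = (\<Sum>l<?N. \<Sum>k<?N. Re (U $$ (k, 0)) * Re (J n x $$ (k, l)) * Re (U $$ (l, 0)))"
    unfolding haar_conj_def by (rule sum.swap)
  also have "\<dots> = (\<Sum>l<?N. \<Sum>k<?N. - (Re (U $$ (l, 0)) * Re (J n x $$ (l, k)) * Re (U $$ (k, 0))))"
  proof (intro sum.cong refl)
    fix l k assume "l \<in> {..<?N}" "k \<in> {..<?N}"
    then show "Re (U $$ (k, 0)) * Re (J n x $$ (k, l)) * Re (U $$ (l, 0))
        = - (Re (U $$ (l, 0)) * Re (J n x $$ (l, k)) * Re (U $$ (k, 0)))"
      using anti[of k l] by simp
  qed
  also have "\<dots> = - haar_conj ?N (J n x) U 0 0"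
    unfolding haar_conj_def by (simp add: sum_negf)
  finally have "haar_conj ?N (J n x) U 0 0 = 0" by simp
  with \<open>(mat_adjoint U * J n x * U) $$ (0, 0) = _\<close> show ?thesis by simp
qed

text \<open>The all-zero state is a product state: merging index 0 with itself gives index 0
  again.\<close>

lemma product_expectation:
  assumes "local_on n T X" "local_on n T' Y" "T \<inter> T' = {}"
  shows "(X * Y) $$ (0, 0) = X $$ (0, 0) * Y $$ (0, 0)"
proof -
  have "merge n T 0 0 = 0" for T by (rule nat_bit_eqI[of _ n]) auto
  then show ?thesis using mult_local_disjoint[OF assms, of 0 0] by (simp add: agree_def)
qed

text \<open>Two lightcones of radius \<open>d * r\<^sup>2\<close> can meet only if the distance is
  at most twice that radius. If they do not meet, the correlation vanishes, whereas the lower bound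
  is strictly positive for \<epsilon> < 1.\<close>

lemma qubit_distance_le:
  assumes G: "architecture n G" and E: "orthogonal_ensemble n G r d E"
    and design: "orthogonal_state_design 2 n \<epsilon> E (\<lambda>C. circuit_mat n d C *\<^sub>v zero_ket n)"
    and \<epsilon>: "\<epsilon> < 1" and xy: "x < n" "y < n"
  shows "graph_dist G x y \<le> ereal (real (2 * d * r\<^sup>2))"
proof (rule ccontr)
  assume far: "\<not> ?thesis"
  have sp: "space E = circuits G r d"
    using E sets_eq_imp_space_eq[of E "circuit_borel G r d"] by (simp add: orthogonal_ensemble_def space_circuit_borel)
  \<comment> \<open>Formulated with walks, this also covers qubits in different components, where
    the distance is infinite and no walk exists.\<close>
  have no_path: "m > 2 * d * r\<^sup>2" if "(x, y) \<in> parcs G ^^ m" for m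
    using far graph_dist_le[OF G xy(1) that] order_trans[of "graph_dist G x y" "ereal (real m)"]
    by (metis ereal_less_eq(3) not_less of_nat_le_iff)
  then have "x \<noteq> y" using no_path[of 0] by auto
  have disj: "reach G (d * r\<^sup>2) {x} \<inter> reach G (d * r\<^sup>2) {y} = {}"
  proof (rule ccontr)
    assume "\<not> ?thesis"
    then obtain z m m' where "m \<le> d * r\<^sup>2" "m' \<le> d * r\<^sup>2" "(x, z) \<in> parcs G ^^ m" "(y, z) \<in> parcs G ^^ m'"
      by (auto simp: reach_def)
    moreover from this have "(x, y) \<in> parcs G ^^ (m + m')"
      using relpow_sym[OF architecture_sym[OF G]] unfolding relpow_add by blast
    ultimately show False using no_path[of "m + m'"] by simp
  qed
  let ?N = "2 ^ n :: nat" and ?U = "circuit_mat n d"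
  define A where "A = J n x * J n y"
  have A: "A \<in> carrier_mat ?N ?N" by (simp add: A_def)
  have A_real: "A $$ (i, j) \<in> \<real>" if "i < ?N" "j < ?N" for i j
    using that xy \<open>x \<noteq> y\<close> by (simp add: A_def JJ_index)
  have zero: "haar_conj ?N A (?U C) 0 0 = 0" if C: "C \<in> circuits G r d" "?U C \<in> orthogonal_group ?N" for C
  proof -
    let ?V = "mat_adjoint (?U C)"
    have "complex_of_real (haar_conj ?N A (?U C) 0 0) = (?V * A * ?U C) $$ (0, 0)"
      using A A_real by (intro haar_conj_eq[OF C(2), symmetric]) auto
    also have "?V * A * ?U C = (?V * J n x * ?U C) * (?V * J n y * ?U C)"
      unfolding A_def using C(2) by (intro conj_mult orthogonal_group_unitary) auto
    also have "\<dots> $$ (0, 0) = (?V * J n x * ?U C) $$ (0, 0) * (?V * J n y * ?U C) $$ (0, 0)"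
      using product_expectation[OF circuit_conj_local[OF G C(1) J_local[OF xy(1)], of d]
          circuit_conj_local[OF G C(1) J_local[OF xy(2)], of d] disj] .
    also have "\<dots> = 0" using J_expectation_zero[OF C(2)] by simp
    finally show ?thesis by simp
  qed
  have orth: "AE C in E. ?U C \<in> orthogonal_group ?N" using E by (simp add: orthogonal_ensemble_def)
  have "(1 - \<epsilon>) * (2 / (2 ^ n + 2)) \<le> (LINT C|E. (haar_conj ?N A (?U C) 0 0)\<^sup>2)"
  proof (rule orthogonal_state_design_bounds(1)[OF design _ _ _ orth A A_real])
    show "prob_space E" using E by (simp add: orthogonal_ensemble_def)
    show "(\<lambda>C. ?U C $$ (i, 0)) \<in> borel_measurable E" if "i < ?N" for i
      using circuit_mat_entry_measurable[OF G that, of 0 d r d] E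
      by (subst measurable_cong_sets[OF _ refl, of E "circuit_borel G r d"]) (auto simp: orthogonal_ensemble_def)
    show "A $$ (i, j) = A $$ (j, i)" if "i < ?N" "j < ?N" for i j
      using that xy \<open>x \<noteq> y\<close> by (auto simp: A_def JJ_index agree_def)
    show "A * A = 1\<^sub>m ?N" using JJ_square[OF xy \<open>x \<noteq> y\<close>] by (simp add: A_def)
    show "(\<Sum>i<?N. A $$ (i, i)) = 0"
      using xy \<open>x \<noteq> y\<close> by (intro sum.neutral) (simp add: A_def JJ_index)
  qed auto
  also have "(LINT C|E. (haar_conj ?N A (?U C) 0 0)\<^sup>2) = 0"
  proof (rule integral_eq_zero_AE)
    show "AE C in E. (haar_conj ?N A (?U C) 0 0)\<^sup>2 = 0"
      using orth AE_space by eventually_elim (simp add: zero sp)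
  qed
  finally have "(1 - \<epsilon>) * (2 / (2 ^ n + 2)) \<le> 0" .
  moreover have "(1 - \<epsilon>) * (2 / (2 ^ n + 2)) > (0 :: real)"
    using \<epsilon> by (intro mult_pos_pos divide_pos_pos add_pos_pos) auto
  ultimately show False by simp
qed

lemma diameter_le:
  assumes G: "architecture n G" and E: "orthogonal_ensemble n G r d E"
    and design: "orthogonal_state_design 2 n \<epsilon> E (\<lambda>C. circuit_mat n d C *\<^sub>v zero_ket n)"
    and \<epsilon>: "\<epsilon> < 1"
  shows "ereal (1 / (2 * (real r)\<^sup>2 + 1)) * graph_diameter G \<le> ereal (real d)"
proof -
  have "graph_diameter G \<le> ereal (real (2 * d * r\<^sup>2))"
    unfolding graph_diameter_def using qubit_distance_le[OF G E design \<epsilon>] G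
    by (intro SUP_least) (auto simp: architecture_def)
  \<comment> \<open>The summand 1 in the constant keeps the denominator positive when r = 0.\<close>
  then have "ereal (1 / (2 * (real r)\<^sup>2 + 1)) * graph_diameter G \<le> ereal (1 / (2 * (real r)\<^sup>2 + 1)) * ereal (real (2 * d * r\<^sup>2))"
    by (intro ereal_mult_left_mono) auto
  also have "\<dots> \<le> ereal (real d)"
  proof -
    have "0 < 1 + 2 * (real r)\<^sup>2" by (intro add_pos_nonneg) auto
    moreover have "real d * (2 * (real r)\<^sup>2) \<le> real d * (1 + 2 * (real r)\<^sup>2)"
      by (intro mult_left_mono) auto
    ultimately show ?thesis by (simp add: divide_le_eq mult_ac add_ac)
  qed
  finally show ?thesis .
qed


section \<open>Pauli Z and the average over one gate\<close>

section \<open>Diagonal observables\<close>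

definition zsign :: "nat \<Rightarrow> nat \<Rightarrow> real" where
  "zsign t i = (if bit i t then - 1 else 1)"

text \<open>The Pauli operator \<open>Z\<close> on qubit \<open>t\<close> of \<open>m\<close> qubits.\<close>

definition zmat :: "nat \<Rightarrow> nat \<Rightarrow> complex mat" where
  "zmat m t = Matrix.mat (2 ^ m) (2 ^ m) (\<lambda>(i, j). if i = j then complex_of_real (zsign t i) else 0)"

lemma zmat_carrier [simp]: "zmat m t \<in> carrier_mat (2 ^ m) (2 ^ m)"
  by (simp add: zmat_def)

lemma zmat_index:
  "i < 2 ^ m \<Longrightarrow> j < 2 ^ m \<Longrightarrow> zmat m t $$ (i, j) = (if i = j then complex_of_real (zsign t i) else 0)"
  by (simp add: zmat_def)

lemma zsign_square [simp]: "(zsign t i)\<^sup>2 = 1"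
  by (simp add: zsign_def)

text \<open>Flipping bit \<open>t\<close> is a sign-reversing involution of the basis.\<close>

lemma sum_zsign:
  assumes "t < m"
  shows "(\<Sum>i<2 ^ m. zsign t i) = 0"
proof -
  define f where "f i = from_bits m (\<lambda>q. if q = t then \<not> bit i q else bit i q)" for i :: nat
  have f_less: "f i < 2 ^ m" for i by (simp add: f_def)
  have ff: "f (f i) = i" if "i < 2 ^ m" for i
    using that by (intro nat_bit_eqI[of _ m]) (auto simp: f_def)
  have "(\<Sum>i<2 ^ m. zsign t i) = (\<Sum>i<2 ^ m. - zsign t i)"
  proof (rule sum.reindex_bij_witness[of _ f f])
    show "- zsign t (f i) = zsign t i" for i using assms by (simp add: zsign_def f_def)
  qed (use ff f_less in auto)
  then show ?thesis by (simp add: sum_negf)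
qed

lemma zmat_square: "zmat m t * zmat m t = 1\<^sub>m (2 ^ m)"
proof (rule eq_matI)
  fix i j assume "i < dim_row (1\<^sub>m (2 ^ m) :: complex mat)" "j < dim_col (1\<^sub>m (2 ^ m) :: complex mat)"
  then have ij: "i < 2 ^ m" "j < 2 ^ m" by auto
  have "(zmat m t * zmat m t) $$ (i, j) = (\<Sum>k<2 ^ m. zmat m t $$ (i, k) * zmat m t $$ (k, j))"
    using ij by (intro mat_mult_index) auto
  also have "\<dots> = (\<Sum>k<2 ^ m. if k = i then zmat m t $$ (i, i) * zmat m t $$ (i, j) else 0)"
    using ij by (intro sum.cong) (auto simp: zmat_index)
  also have "\<dots> = 1\<^sub>m (2 ^ m) $$ (i, j)" using ij by (auto simp: zmat_index zsign_def)
  finally show "(zmat m t * zmat m t) $$ (i, j) = 1\<^sub>m (2 ^ m) $$ (i, j)" .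
qed (auto simp: zmat_def)

lemma zmat_real: "i < 2 ^ m \<Longrightarrow> j < 2 ^ m \<Longrightarrow> zmat m t $$ (i, j) \<in> \<real>"
  by (simp add: zmat_index)

lemma zmat_sym: "i < 2 ^ m \<Longrightarrow> j < 2 ^ m \<Longrightarrow> zmat m t $$ (i, j) = zmat m t $$ (j, i)"
  by (simp add: zmat_index)

lemma zmat_trace: "t < m \<Longrightarrow> (\<Sum>i<2 ^ m. zmat m t $$ (i, i)) = 0"
  using sum_zsign[of t m] by (simp add: zmat_index flip: of_real_sum)

lemma zmat_local: "x < n \<Longrightarrow> local_on n {x} (zmat n x)"
  unfolding local_on_def
  by (auto simp: zmat_index agree_def zsign_def intro: nat_bit_eqI)

text \<open>A Haar gate on \<open>a\<close> acts on observables of the whole subsystem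
  \<open>a\<close>, so Z at qubit \<open>x\<close> is rewritten as one, with \<open>t\<close> the
  position of \<open>x\<close> in the sorted list of \<open>a\<close>.\<close>

lemma embed_zmat:
  assumes a: "a \<subseteq> {..<n}" and t: "t < card a" "sorted_list_of_set a ! t = x"
  shows "embed n a (zmat (card a) t) = zmat n x"
proof (rule eq_matI)
  have fin: "finite a" using a finite_subset by blast
  fix i j assume "i < dim_row (zmat n x)" "j < dim_col (zmat n x)"
  then have ij: "i < 2 ^ n" "j < 2 ^ n" by (auto simp: zmat_def)
  have "agree n (- a) i j \<and> subindex a i = subindex a j \<longleftrightarrow> i = j"
    using ij a nat_bit_eqI[of i n j] by (auto simp: subindex_eq_iff[OF fin] agree_def)
  moreover have "zsign t (subindex a i) = zsign x i"
    using t by (simp add: zsign_def bit_subindex[OF fin])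
  ultimately show "embed n a (zmat (card a) t) $$ (i, j) = zmat n x $$ (i, j)"
    using ij subindex_less[OF fin] by (auto simp: embed_index zmat_index)
qed (auto simp: zmat_def)

text \<open>With M = 2^m, \<open>second_moment_ge\<close> bounds the integral below by its diagonal
  part, and \<open>sum_signs_square_le\<close> keeps of that the component along the signs of Z. The
  constant comes from (M - 1)(M + 2) <= 2 M^2, so that 2 / ((M - 1)(M + 2)) >= 4^(-m) >= 4^(-r).
  Since \<open>X\<close> is arbitrary, nothing has to be known about the state below the
  gate.\<close>

lemma gate_second_moment_ge:
  assumes H: "is_haar_orthogonal (2 ^ m) H" and t: "t < m" and m: "m \<le> r"
  shows "ennreal (1 / 4 ^ r * (\<Sum>p<2 ^ m. zsign t p * X p p)\<^sup>2)
    \<le> (\<integral>\<^sup>+ g. ennreal ((\<Sum>p<2 ^ m. \<Sum>q<2 ^ m. X p q * haar_conj (2 ^ m) (zmat m t) g p q)\<^sup>2) \<partial>H)"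
proof -
  let ?M = "2 ^ m :: nat"
  interpret haar_observable ?M H "zmat m t"
    by unfold_locales (use H zmat_real zmat_sym zmat_square zmat_trace[OF t] in auto)
  have m1: "m \<ge> 1" using t by simp
  have M2: "(2 :: real) \<le> 2 ^ m" using power_increasing[OF m1, of "2 :: real"] by simp
  then have M2n: "?M \<ge> 2" using m1 by (cases m) auto
  let ?c = "2 / ((real ?M - 1) * (real ?M + 2))"
  have "(real ?M - 1) * (real ?M + 2) \<le> 2 * (2 ^ m * 2 ^ m)"
  proof -
    have "(2 ^ m - 1) * (2 ^ m + 2) = (2 ^ m * 2 ^ m + 2 ^ m - 2 :: real)" by (simp add: algebra_simps)
    moreover have "(2 ^ m :: real) \<le> 2 ^ m * 2 ^ m" by simp
    ultimately show ?thesis unfolding of_nat_power of_nat_numeral by linarith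
  qed
  also have "(2 ^ m * 2 ^ m :: real) = 4 ^ m" by (simp flip: power_mult_distrib)
  also have "2 * 4 ^ m \<le> (2 * 4 ^ r :: real)" using m by simp
  finally have "1 / 4 ^ r \<le> ?c"
    using M2 by (simp add: divide_simps)
  then have "1 / 4 ^ r * (\<Sum>p<?M. zsign t p * X p p)\<^sup>2 \<le> ?c * (\<Sum>p<?M. zsign t p * X p p)\<^sup>2"
    by (intro mult_right_mono) auto
  also have "\<dots> \<le> ?c * (?M * (\<Sum>i<?M. (X i i)\<^sup>2) - (\<Sum>i<?M. X i i)\<^sup>2)"
    using M2 by (intro mult_left_mono sum_signs_square_le sum_zsign t) auto
  also have "\<dots> \<le> (LINT U|H. (\<Sum>i<?M. \<Sum>j<?M. X i j * B U i j)\<^sup>2)"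
    by (rule second_moment_ge[OF M2n])
  finally show ?thesis
    using nn_integral_eq_integral[OF second_moment_integrable[of X]] by (simp add: ennreal_leI)
qed

text \<open>For real \<open>U\<close> this is the reduced density matrix on \<open>a\<close> of the
  state U|0>.\<close>

definition gate_marginal :: "nat \<Rightarrow> nat set \<Rightarrow> complex mat \<Rightarrow> nat \<Rightarrow> nat \<Rightarrow> real" where
  "gate_marginal n a U p q = (\<Sum>i<2 ^ n. \<Sum>j<2 ^ n.
     if agree n (- a) i j \<and> subindex a i = p \<and> subindex a j = q then Re (U $$ (i, 0)) * Re (U $$ (j, 0)) else 0)"

text \<open>The expectation of a local observable is its trace against the reduced density matrix.
  To prove it, the index pairs (i, j) are sorted by their restrictions (p, q) to
  \<open>a\<close>.\<close>

lemma haar_conj_embed: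
  assumes "a \<subseteq> {..<n}"
  shows "haar_conj (2 ^ n) (embed n a h) U 0 0
    = (\<Sum>p<2 ^ card a. \<Sum>q<2 ^ card a. gate_marginal n a U p q * Re (h $$ (p, q)))"
proof -
  let ?N = "2 ^ n :: nat" and ?M = "2 ^ card a :: nat"
  let ?u = "\<lambda>i. Re (U $$ (i, 0))"
  let ?f = "\<lambda>p q i j. if agree n (- a) i j \<and> subindex a i = p \<and> subindex a j = q then ?u i * ?u j * Re (h $$ (p, q)) else 0"
  have fin: "finite a" using assms finite_subset by blast
  have inner: "(\<Sum>(p, q)\<in>{..<?M} \<times> {..<?M}. ?f p q i j)
      = ?u i * Re (embed n a h $$ (i, j)) * ?u j" if "i < ?N" "j < ?N" for i j
  proof -
    have "(\<Sum>(p, q)\<in>{..<?M} \<times> {..<?M}. ?f p q i j)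
        = (\<Sum>s\<in>{..<?M} \<times> {..<?M}. if s = (subindex a i, subindex a j)
            then (if agree n (- a) i j then ?u i * ?u j * Re (h $$ s) else 0) else 0)"
      by (intro sum.cong refl) (auto split: if_splits)
    also have "\<dots> = (if agree n (- a) i j then ?u i * ?u j * Re (h $$ (subindex a i, subindex a j)) else 0)"
      using subindex_less[OF fin] by (subst sum.delta) auto
    finally show ?thesis using that by (simp add: embed_index)
  qed
  have "haar_conj ?N (embed n a h) U 0 0 = (\<Sum>(i, j)\<in>{..<?N} \<times> {..<?N}. \<Sum>(p, q)\<in>{..<?M} \<times> {..<?M}. ?f p q i j)"
    unfolding haar_conj_def sum.cartesian_product using inner by (intro sum.cong) auto
  also have "\<dots> = (\<Sum>(p, q)\<in>{..<?M} \<times> {..<?M}. \<Sum>(i, j)\<in>{..<?N} \<times> {..<?N}. ?f p q i j)"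
    unfolding split_beta by (rule sum.swap)
  also have "\<dots> = (\<Sum>(p, q)\<in>{..<?M} \<times> {..<?M}. gate_marginal n a U p q * Re (h $$ (p, q)))"
    unfolding gate_marginal_def sum_distrib_right
    by (intro sum.cong) (auto simp flip: sum.cartesian_product intro!: sum.cong)
  finally show ?thesis by (simp add: sum.cartesian_product)
qed


section \<open>Survival of the Z signal through a brickwork, and the size bound\<close>

section \<open>Brickworks\<close>

text \<open>For orthogonal \<open>U\<close>, the expectation of Z at qubit \<open>x\<close> in the
  state U|0>.\<close>

abbreviation \<phi> :: "nat \<Rightarrow> nat \<Rightarrow> complex mat \<Rightarrow> real" where
  "\<phi> n x U \<equiv> haar_conj (2 ^ n) (zmat n x) U 0 0"

lemma \<phi>_eq:
  assumes "U \<in> orthogonal_group (2 ^ n)"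
  shows "(mat_adjoint U * zmat n x * U) $$ (0, 0) = complex_of_real (\<phi> n x U)"
  using assms zmat_real by (intro haar_conj_eq) auto

lemma layer_mat_orthogonal:
  assumes "layer n S" "\<And>a g. (a, g) \<in> S \<Longrightarrow> g \<in> orthogonal_group (2 ^ card a)"
  shows "layer_mat n S \<in> orthogonal_group (2 ^ n)"
proof (rule orthogonal_groupI[OF layer_mat_unitary[OF assms(1)]])
  fix i j :: nat assume ij: "i < 2 ^ n" "j < 2 ^ n"
  have "g $$ (subindex a i, subindex a j) \<in> \<real>" if "(a, g) \<in> S" for a g
  proof -
    have "finite a" using assms(1) that finite_subset[of a "{..<n}"] by (force simp: layer_def)
    then show ?thesis by (intro orthogonal_group_real[OF assms(2)[OF that]] subindex_less)
  qed
  then show "layer_mat n S $$ (i, j) \<in> \<real>"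
    using ij by (auto simp: layer_mat_index intro!: prod_in_Reals)
qed

lemma circuit_mat_orthogonal:
  assumes "architecture n G" "C \<in> circuits G r d"
    and "\<forall>(i, a, g)\<in>C. g \<in> orthogonal_group (2 ^ card a)"
  shows "circuit_mat n k C \<in> orthogonal_group (2 ^ n)"
proof (induction k)
  case 0
  show ?case by (rule orthogonal_groupI) (auto simp: unitary_group_def)
next
  case (Suc k)
  moreover have "layer_mat n {s. (k, s) \<in> C} \<in> orthogonal_group (2 ^ n)"
    using assms(3) by (intro layer_mat_orthogonal[OF circuits_layer[OF assms(1,2)]]) auto
  ultimately show ?case by (simp add: orthogonal_mult)
qed

lemma circuit_mat_cong:
  assumes "\<And>i s. i < k \<Longrightarrow> (i, s) \<in> C \<longleftrightarrow> (i, s) \<in> C'"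
  shows "circuit_mat n k C = circuit_mat n k C'"
  using assms by (induction k) simp_all

lemma \<phi>_Suc:
  fixes k :: nat
  assumes "architecture n G" "C \<in> circuits G r d"
    and "\<forall>(i, a, g)\<in>C. g \<in> orthogonal_group (2 ^ card a)"
  defines "L \<equiv> layer_mat n {s. (k, s) \<in> C}"
  shows "complex_of_real (\<phi> n x (circuit_mat n (Suc k) C))
    = (mat_adjoint (circuit_mat n k C) * (mat_adjoint L * zmat n x * L) * circuit_mat n k C) $$ (0, 0)"
proof -
  have "mat_adjoint (circuit_mat n (Suc k) C) * zmat n x * circuit_mat n (Suc k) C
      = mat_adjoint (circuit_mat n k C) * (mat_adjoint L * zmat n x * L) * circuit_mat n k C"
    unfolding circuit_mat.simps L_def by (rule conj_conj) auto
  then show ?thesis using \<phi>_eq[OF circuit_mat_orthogonal[OF assms(1-3), of "Suc k"], of x] by simp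
qed

lemma \<phi>_step_idle:
  assumes G: "architecture n G" and C: "C \<in> circuits G r d"
    and orth: "\<forall>(i, a, g)\<in>C. g \<in> orthogonal_group (2 ^ card a)"
    and x: "x < n" and idle: "\<And>a g. (k, a, g) \<in> C \<Longrightarrow> x \<notin> a"
  shows "\<phi> n x (circuit_mat n (Suc k) C) = \<phi> n x (circuit_mat n k C)"
proof -
  let ?S = "{s. (k, s) \<in> C}" and ?U = "circuit_mat n k C"
  have "mat_adjoint (layer_mat n ?S) * zmat n x * layer_mat n ?S
      = mat_adjoint (layer_mat n {}) * zmat n x * layer_mat n {}"
    using idle by (intro layer_conj_split[OF circuits_layer[OF G C] _ zmat_local[OF x]]) auto
  also have "\<dots> = zmat n x"
    by (simp add: left_mult_one_mat[OF zmat_carrier] right_mult_one_mat[OF zmat_carrier])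
  finally have "complex_of_real (\<phi> n x (circuit_mat n (Suc k) C)) = complex_of_real (\<phi> n x ?U)"
    unfolding \<phi>_Suc[OF G C orth] by (simp add: \<phi>_eq[OF circuit_mat_orthogonal[OF G C orth]])
  then show ?thesis by simp
qed

text \<open>The expectations before and after layer \<open>k\<close> are linear in the same reduced
  density matrix \<open>X\<close>, paired with Z and with g^T Z g respectively. Because
  \<open>X\<close> comes from the layers below, averaging over \<open>g\<close> alone can compare
  the two.\<close>

lemma \<phi>_step_gate:
  assumes G: "architecture n G" and C: "C \<in> circuits G r d"
    and orth: "\<forall>(i, a, g)\<in>C. g \<in> orthogonal_group (2 ^ card a)"
    and x: "x < n" and g: "(k, a, g) \<in> C" and t: "t < card a" "sorted_list_of_set a ! t = x"
  defines "X \<equiv> gate_marginal n a (circuit_mat n k C)"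
  shows "\<phi> n x (circuit_mat n (Suc k) C)
      = (\<Sum>p<2 ^ card a. \<Sum>q<2 ^ card a. X p q * haar_conj (2 ^ card a) (zmat (card a) t) g p q)"
    and "\<phi> n x (circuit_mat n k C) = (\<Sum>p<2 ^ card a. zsign t p * X p p)"
proof -
  let ?S = "{s. (k, s) \<in> C}" and ?U = "circuit_mat n k C" and ?M = "2 ^ card a :: nat"
  let ?h = "mat_adjoint g * zmat (card a) t * g"
  have a: "a \<subseteq> {..<n}" by (rule circuits_support[OF G C g])
  have fin: "finite a" using a finite_subset by blast
  have xa: "x \<in> a" using t fin by (metis length_sorted_list_of_set nth_mem set_sorted_list_of_set)
  have gc: "g \<in> carrier_mat ?M ?M" by (rule circuits_gate_carrier[OF C g])
  have go: "g \<in> orthogonal_group ?M" using orth g by auto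
  have h: "?h $$ (p, q) = complex_of_real (haar_conj ?M (zmat (card a) t) g p q)" if "p < ?M" "q < ?M" for p q
    using that zmat_real by (intro haar_conj_eq[OF go]) auto
  have Z: "zmat n x = embed n a (zmat (card a) t)" by (rule embed_zmat[OF a t, symmetric])
  have "x \<notin> fst s" if "s \<in> ?S - {(a, g)}" for s
    using circuits_disjoint[OF C g, of "fst s" "snd s"] that xa by auto
  then have "\<Union> (fst ` (?S - {(a, g)})) \<inter> {x} = {}" by blast
  then have "mat_adjoint (layer_mat n ?S) * zmat n x * layer_mat n ?S
      = mat_adjoint (embed n a g) * zmat n x * embed n a g"
    using g by (intro layer_conj_split[OF circuits_layer[OF G C] _ zmat_local[OF x]]) auto
  also have "\<dots> = embed n a ?h"
    unfolding Z using a gc by (simp add: embed_adjoint embed_mult)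
  finally have "complex_of_real (\<phi> n x (circuit_mat n (Suc k) C)) = (mat_adjoint ?U * embed n a ?h * ?U) $$ (0, 0)"
    unfolding \<phi>_Suc[OF G C orth] by simp
  also have "\<dots> = complex_of_real (haar_conj (2 ^ n) (embed n a ?h) ?U 0 0)"
    using h subindex_less[OF fin]
    by (intro haar_conj_eq circuit_mat_orthogonal[OF G C orth]) (auto simp: embed_index)
  finally have "\<phi> n x (circuit_mat n (Suc k) C) = haar_conj (2 ^ n) (embed n a ?h) ?U 0 0" by simp
  also have "\<dots> = (\<Sum>p<?M. \<Sum>q<?M. X p q * haar_conj ?M (zmat (card a) t) g p q)"
    unfolding haar_conj_embed[OF a] X_def using h by (intro sum.cong) auto
  finally show "\<phi> n x (circuit_mat n (Suc k) C) = (\<Sum>p<?M. \<Sum>q<?M. X p q * haar_conj ?M (zmat (card a) t) g p q)" .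
  have "\<phi> n x ?U = (\<Sum>p<?M. \<Sum>q<?M. if q = p then zsign t p * X p p else 0)"
    unfolding Z haar_conj_embed[OF a] X_def by (intro sum.cong) (auto simp: zmat_index)
  then show "\<phi> n x ?U = (\<Sum>p<?M. zsign t p * X p p)" by simp
qed

lemma \<phi>_measurable:
  assumes "architecture n G"
  shows "(\<lambda>C. \<phi> n x (circuit_mat n k C)) \<in> borel_measurable (circuit_borel G r d)"
  unfolding haar_conj_def using circuit_mat_entry_measurable[OF assms]
  by (intro borel_measurable_sum borel_measurable_times borel_measurable_const measurable_compose[OF _ borel_measurable_Re]) auto

text \<open>A generalized brickwork is a mixture only on the level of events; the usual passage from
  indicators over sums to increasing limits extends this to integrals.\<close>

lemma nn_integral_mixture:
  fixes w :: "'b \<Rightarrow> real"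
  assumes sets: "\<And>b. b \<in> L \<Longrightarrow> sets (N b) = sets M"
    and emeasure: "\<And>A. A \<in> sets M \<Longrightarrow> emeasure M A = (\<Sum>b\<in>L. ennreal (w b) * emeasure (N b) A)"
    and f: "f \<in> borel_measurable M"
  shows "(\<integral>\<^sup>+ x. f x \<partial>M) = (\<Sum>b\<in>L. ennreal (w b) * (\<integral>\<^sup>+ x. f x \<partial>N b))"
proof -
  have meas: "g \<in> borel_measurable (N b)" if "b \<in> L" "g \<in> borel_measurable M" for b and g :: "'a \<Rightarrow> ennreal"
    using that measurable_cong_sets[OF sets[OF that(1)] refl] by blast
  have space: "space (N b) = space M" if "b \<in> L" for b
    using sets_eq_imp_space_eq[OF sets[OF that]] .
  show ?thesis using f
  proof (induction rule: borel_measurable_induct)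
    case (cong f g)
    have "(\<integral>\<^sup>+ x. f x \<partial>M) = (\<integral>\<^sup>+ x. g x \<partial>M)" using cong(3) by (intro nn_integral_cong) auto
    moreover have "(\<integral>\<^sup>+ x. f x \<partial>N b) = (\<integral>\<^sup>+ x. g x \<partial>N b)" if "b \<in> L" for b
      using cong(3) space[OF that] by (intro nn_integral_cong) auto
    ultimately show ?case using cong(4) by simp
  next
    case (set A)
    then show ?case using emeasure sets by simp
  next
    case (mult u c)
    then show ?case using meas by (simp add: nn_integral_cmult sum_distrib_left mult_ac)
  next
    case (add u v)
    then show ?case using meas by (simp add: nn_integral_add sum.distrib distrib_left)
  next
    case (seq U)
    have U: "incseq U" "\<And>i. U i \<in> borel_measurable M"
      and IH: "\<And>i. (\<integral>\<^sup>+ x. U i x \<partial>M) = (\<Sum>b\<in>L. ennreal (w b) * (\<integral>\<^sup>+ x. U i x \<partial>N b))"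
      by (fact seq)+
    have inc: "incseq (\<lambda>i. ennreal (w b) * (\<integral>\<^sup>+ x. U i x \<partial>N b))" for b
      using U(1) by (auto simp: incseq_def le_fun_def intro!: mult_left_mono nn_integral_mono)
    have "(\<integral>\<^sup>+ x. (SUP i. U i) x \<partial>M) = (SUP i. \<integral>\<^sup>+ x. U i x \<partial>M)"
      using nn_integral_monotone_convergence_SUP[OF U] by (simp only: SUP_apply)
    also have "\<dots> = (SUP i. \<Sum>b\<in>L. ennreal (w b) * (\<integral>\<^sup>+ x. U i x \<partial>N b))" by (simp add: IH)
    also have "\<dots> = (\<Sum>b\<in>L. SUP i. ennreal (w b) * (\<integral>\<^sup>+ x. U i x \<partial>N b))"
      using inc by (rule ennreal_SUP_sum)
    also have "\<dots> = (\<Sum>b\<in>L. ennreal (w b) * (\<integral>\<^sup>+ x. (SUP i. U i) x \<partial>N b))"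
      using nn_integral_monotone_convergence_SUP[OF U(1) meas[OF _ U(2)]]
      by (intro sum.cong refl) (simp only: SUP_mult_left_ennreal[symmetric] SUP_apply)
    finally show ?case .
  qed
qed

definition brickwork_circuit :: "layout \<Rightarrow> (nat \<times> nat set \<Rightarrow> complex mat) \<Rightarrow> circuit" where
  "brickwork_circuit b \<omega> = {(i, a, \<omega> (i, a)) | i a. (i, a) \<in> (SIGMA i:{..<length b}. snd (b ! i))}"

locale brickwork =
  fixes n r d :: nat and G :: "nat pair_pre_digraph" and haar :: "nat \<Rightarrow> complex mat measure" and b :: layout
  assumes G: "architecture n G"
    and haar: "\<And>m. is_haar_orthogonal (2 ^ m) (haar m)"
    and b: "b \<in> layouts G r d"
begin

definition I :: "(nat \<times> nat set) set" where
  "I = (SIGMA i:{..<length b}. snd (b ! i))"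

definition K :: "nat \<times> nat set \<Rightarrow> complex mat measure" where
  "K = (\<lambda>(i, a). haar (card a))"

abbreviation circ :: "(nat \<times> nat set \<Rightarrow> complex mat) \<Rightarrow> circuit" where
  "circ \<equiv> brickwork_circuit b"

lemma mem_circ [simp]: "(i, a, g) \<in> circ \<omega> \<longleftrightarrow> (i, a) \<in> I \<and> g = \<omega> (i, a)"
  by (auto simp: brickwork_circuit_def I_def)

lemma layer_layout:
  assumes "(i, a) \<in> I"
  shows "i < d" "partition_on {..<n} (fst (b ! i))" "a \<in> fst (b ! i)" "card a \<le> r" "connected_qubits G a"
proof -
  have i: "b ! i \<in> set b" "a \<in> snd (b ! i)" "i < length b" using assms by (auto simp: I_def)
  obtain A R where AR: "b ! i = (A, R)" by fastforce
  have "partition_on (pverts G) A \<and> R \<subseteq> A \<and> (\<forall>a\<in>A. card a \<le> r \<and> connected_qubits G a)"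
    using b i(1) AR by (auto simp: layouts_def)
  then show "partition_on {..<n} (fst (b ! i))" "a \<in> fst (b ! i)" "card a \<le> r" "connected_qubits G a"
    using i AR G by (auto simp: architecture_def)
  show "i < d" using b i(3) by (auto simp: layouts_def)
qed

lemma layout_disjoint:
  assumes "(i, a) \<in> I" "(i, a') \<in> I" "a \<noteq> a'"
  shows "a \<inter> a' = {}"
  using layer_layout(2,3)[OF assms(1)] layer_layout(3)[OF assms(2)] assms(3)
  by (auto simp: partition_on_def disjoint_def)

lemma finite_I: "finite I"
proof -
  have "I \<subseteq> {..<d} \<times> Pow {..<n}"
    using layer_layout(1,5) G by (fastforce simp: connected_qubits_def architecture_def)
  then show ?thesis by (rule finite_subset) auto
qed

lemma product_K: "product_prob_space K"
  by (rule product_prob_spaceI) (auto simp: K_def intro!: prob_space_haar[OF haar])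

lemma \<omega>_orthogonal:
  assumes "\<omega> \<in> space (Pi\<^sub>M I K)" "(i, a) \<in> I"
  shows "\<omega> (i, a) \<in> orthogonal_group (2 ^ card a)"
  using assms by (auto simp: space_PiM K_def space_haar[OF haar] dest!: PiE_mem)

lemma circ_circuits:
  assumes "\<omega> \<in> space (Pi\<^sub>M I K)"
  shows "circ \<omega> \<in> circuits G r d"
proof -
  have "i < d \<and> connected_qubits G a \<and> card a \<le> r \<and> g \<in> unitary_group (2 ^ card a)"
    if "(i, a, g) \<in> circ \<omega>" for i a g
    using that layer_layout[of i a] \<omega>_orthogonal[OF assms, of i a] by (auto intro: orthogonal_group_unitary)
  moreover have "i = i' \<longrightarrow> (a, g) = (a', g') \<or> a \<inter> a' = {}"
    if "(i, a, g) \<in> circ \<omega>" "(i', a', g') \<in> circ \<omega>" for i a g i' a' g'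
    using that layout_disjoint[of i a a'] by auto
  ultimately show ?thesis unfolding circuits_def by fast
qed

lemma circ_orthogonal:
  assumes "\<omega> \<in> space (Pi\<^sub>M I K)"
  shows "\<forall>(i, a, g)\<in>circ \<omega>. g \<in> orthogonal_group (2 ^ card a)"
  using \<omega>_orthogonal[OF assms] by auto

lemma circ_measurable: "circ \<in> measurable (Pi\<^sub>M I K) (circuit_borel G r d)"
  unfolding circuit_borel_def
proof (rule measurable_measure_of)
  show "circ \<in> space (Pi\<^sub>M I K) \<rightarrow> circuits G r d" using circ_circuits by auto
next
  fix Y assume "Y \<in> {{C \<in> circuits G r d. \<exists>g\<in>B. (i, a, g) \<in> C} | i a B. B \<in> sets (mat_borel (2 ^ card a))}"
  then obtain i a B where Y: "Y = {C \<in> circuits G r d. \<exists>g\<in>B. (i, a, g) \<in> C}"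
    and B: "B \<in> sets (mat_borel (2 ^ card a))" by blast
  show "circ -` Y \<inter> space (Pi\<^sub>M I K) \<in> sets (Pi\<^sub>M I K)"
  proof (cases "(i, a) \<in> I")
    case True
    \<comment> \<open>The Haar measure lives on the orthogonal group, so \<open>B\<close> has to be
      cut down to it to become an event for this coordinate.\<close>
    have "orthogonal_group (2 ^ card a) \<inter> B \<in> sets (K (i, a))"
      using B sets_restrict_space[of "mat_borel (2 ^ card a)" "orthogonal_group (2 ^ card a)"]
      by (auto simp: K_def sets_haar[OF haar])
    then have "(\<lambda>\<omega>. \<omega> (i, a)) -` (orthogonal_group (2 ^ card a) \<inter> B) \<inter> space (Pi\<^sub>M I K) \<in> sets (Pi\<^sub>M I K)"
      using measurable_component_singleton[OF True] by (rule measurable_sets[rotated])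
    moreover have "circ -` Y \<inter> space (Pi\<^sub>M I K)
        = (\<lambda>\<omega>. \<omega> (i, a)) -` (orthogonal_group (2 ^ card a) \<inter> B) \<inter> space (Pi\<^sub>M I K)"
      using True circ_circuits \<omega>_orthogonal by (auto simp: Y)
    ultimately show ?thesis by simp
  next
    case False
    then have "circ -` Y \<inter> space (Pi\<^sub>M I K) = {}" by (auto simp: Y)
    then show ?thesis by simp
  qed
qed auto

lemma fixed_brickwork_eq: "fixed_brickwork G r d haar b = distr (Pi\<^sub>M I K) (circuit_borel G r d) circ"
  unfolding fixed_brickwork_def Let_def I_def K_def brickwork_circuit_def[abs_def] ..

text \<open>Induction on the number of layers. The gate of layer \<open>k\<close> covering
  \<open>x\<close> is integrated innermost with all other gates fixed; the first \<open>k\<close>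
  layers do not contain it, so they are constant there and \<open>gate_second_moment_ge\<close>
  applies. If no gate covers \<open>x\<close>, the expectation is unchanged and the factor at most 1
  is merely lossy. Nonnegative integrals allow Fubini without integrability.\<close>

lemma second_moment_PiM_ge:
  assumes x: "x < n"
  shows "ennreal ((1 / 4 ^ r) ^ k) \<le> (\<integral>\<^sup>+ \<omega>. ennreal ((\<phi> n x (circuit_mat n k (circ \<omega>)))\<^sup>2) \<partial>Pi\<^sub>M I K)"
proof (induction k)
  case 0
  interpret product_prob_space K I by (rule product_K)
  have "1\<^sub>m (2 ^ n) \<in> orthogonal_group (2 ^ n)"
    by (rule orthogonal_groupI) (auto simp: unitary_group_def)
  then have "complex_of_real (\<phi> n x (1\<^sub>m (2 ^ n))) = zmat n x $$ (0, 0)"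
    by (simp add: \<phi>_eq[symmetric] left_mult_one_mat[OF zmat_carrier] right_mult_one_mat[OF zmat_carrier])
  then have "\<phi> n x (1\<^sub>m (2 ^ n)) = 1" by (simp add: zmat_index zsign_def)
  then show ?case by (simp add: P.emeasure_space_1)
next
  case (Suc k)
  let ?\<delta> = "1 / 4 ^ r :: real"
  let ?f = "\<lambda>k \<omega>. ennreal ((\<phi> n x (circuit_mat n k (circ \<omega>)))\<^sup>2)"
  interpret product_prob_space K I by (rule product_K)
  have meas: "?f k \<in> borel_measurable (Pi\<^sub>M I K)" for k
    using measurable_compose[OF circ_measurable \<phi>_measurable[OF G]] by measurable
  have "ennreal (?\<delta> ^ Suc k) = ennreal ?\<delta> * ennreal (?\<delta> ^ k)"
    unfolding power_Suc by (rule ennreal_mult) simp_all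
  also have "\<dots> \<le> ennreal ?\<delta> * (\<integral>\<^sup>+ \<omega>. ?f k \<omega> \<partial>Pi\<^sub>M I K)"
    using Suc.IH by (intro mult_left_mono) auto
  also have "\<dots> = (\<integral>\<^sup>+ \<omega>. ennreal ?\<delta> * ?f k \<omega> \<partial>Pi\<^sub>M I K)"
    using meas by (simp add: nn_integral_cmult)
  also have "\<dots> \<le> (\<integral>\<^sup>+ \<omega>. ?f (Suc k) \<omega> \<partial>Pi\<^sub>M I K)"
  proof (cases "\<exists>a. (k, a) \<in> I \<and> x \<in> a")
    case False
    have "ennreal ?\<delta> * ?f k \<omega> \<le> ?f (Suc k) \<omega>" if "\<omega> \<in> space (Pi\<^sub>M I K)" for \<omega>
    proof -
      have "?f (Suc k) \<omega> = ?f k \<omega>"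
        using \<phi>_step_idle[OF G circ_circuits[OF that] circ_orthogonal[OF that] x, of k] False by auto
      moreover have "ennreal ?\<delta> * ?f k \<omega> \<le> 1 * ?f k \<omega>" by (intro mult_right_mono) auto
      ultimately show ?thesis by simp
    qed
    then show ?thesis by (intro nn_integral_mono)
  next
    case True
    then obtain a where a: "(k, a) \<in> I" "x \<in> a" by blast
    let ?e = "(k, a)" and ?I = "I - {(k, a)}"
    have fin: "finite a"
      using layer_layout(5)[OF a(1)] G finite_subset[of a "{..<n}"] by (simp add: connected_qubits_def architecture_def)
    obtain t where t: "t < card a" "sorted_list_of_set a ! t = x"
      using a(2) fin by (metis in_set_conv_nth length_sorted_list_of_set set_sorted_list_of_set)
    have I: "insert ?e ?I = I" using a(1) by auto
    have split: "(\<integral>\<^sup>+ \<omega>. g \<omega> \<partial>Pi\<^sub>M I K) = (\<integral>\<^sup>+ \<omega>. (\<integral>\<^sup>+ y. g (fun_upd \<omega> ?e y) \<partial>K ?e) \<partial>Pi\<^sub>M ?I K)"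
      if "g \<in> borel_measurable (Pi\<^sub>M I K)" for g
      using product_nn_integral_insert[of ?I ?e g] finite_I that unfolding I by simp
    have "(\<integral>\<^sup>+ y. ennreal ?\<delta> * ?f k (fun_upd \<omega> ?e y) \<partial>K ?e) \<le> (\<integral>\<^sup>+ y. ?f (Suc k) (fun_upd \<omega> ?e y) \<partial>K ?e)"
      if \<omega>: "\<omega> \<in> space (Pi\<^sub>M ?I K)" for \<omega>
    proof -
      let ?\<omega> = "\<lambda>y. fun_upd \<omega> ?e y"
      \<comment> \<open>The identity matrix is an arbitrary filler: the gate at \<open>?e\<close>
        sits in layer \<open>k\<close>, which the first \<open>k\<close> layers do not see.\<close>
      define U where "U = circuit_mat n k (circ (?\<omega> (1\<^sub>m (2 ^ card a))))"
      have U: "circuit_mat n k (circ (?\<omega> y)) = U" for y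
        unfolding U_def by (rule circuit_mat_cong) auto
      let ?X = "gate_marginal n a U"
      have "?\<omega> y \<in> space (Pi\<^sub>M I K)" if "y \<in> space (K ?e)" for y
        using \<omega> that unfolding space_PiM by (subst I[symmetric]) (rule PiE_fun_upd)
      note space = this
      have step: "\<phi> n x (circuit_mat n (Suc k) (circ (?\<omega> y)))
          = (\<Sum>p<2 ^ card a. \<Sum>q<2 ^ card a. ?X p q * haar_conj (2 ^ card a) (zmat (card a) t) y p q)"
        "\<phi> n x U = (\<Sum>p<2 ^ card a. zsign t p * ?X p p)" if "y \<in> space (K ?e)" for y
      proof -
        note w = space[OF that]
        have "(k, a, y) \<in> circ (?\<omega> y)" using a by simp
        note st = \<phi>_step_gate[OF G circ_circuits[OF w] circ_orthogonal[OF w] x this t, unfolded U]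
        show "\<phi> n x (circuit_mat n (Suc k) (circ (?\<omega> y)))
          = (\<Sum>p<2 ^ card a. \<Sum>q<2 ^ card a. ?X p q * haar_conj (2 ^ card a) (zmat (card a) t) y p q)"
          by (rule st(1))
        show "\<phi> n x U = (\<Sum>p<2 ^ card a. zsign t p * ?X p p)" by (rule st(2))
      qed
      have Ke: "prob_space (K ?e)" unfolding K_def using prob_space_haar[OF haar] by simp
      \<comment> \<open>The formula for \<open>\<phi> n x U\<close> was derived in the presence of
        an admissible gate at \<open>?e\<close>; any point of the nonempty space provides
        one.\<close>
      obtain y0 where y0: "y0 \<in> space (K ?e)" using prob_space.not_empty[OF Ke] by blast
      have "(\<integral>\<^sup>+ y. ennreal ?\<delta> * ?f k (fun_upd \<omega> ?e y) \<partial>K ?e) = ennreal ?\<delta> * ennreal ((\<phi> n x U)\<^sup>2)"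
        by (simp add: U prob_space.emeasure_space_1[OF Ke])
      also have "\<dots> = ennreal (?\<delta> * (\<phi> n x U)\<^sup>2)"
        by (rule ennreal_mult[symmetric]) simp_all
      also have "\<dots> = ennreal (?\<delta> * (\<Sum>p<2 ^ card a. zsign t p * ?X p p)\<^sup>2)"
        by (simp add: step(2)[OF y0])
      also have "\<dots> \<le> (\<integral>\<^sup>+ y. ennreal ((\<Sum>p<2 ^ card a. \<Sum>q<2 ^ card a. ?X p q * haar_conj (2 ^ card a) (zmat (card a) t) y p q)\<^sup>2) \<partial>K ?e)"
        unfolding K_def prod.case by (rule gate_second_moment_ge[OF haar t(1) layer_layout(4)[OF a(1)]])
      also have "\<dots> = (\<integral>\<^sup>+ y. ?f (Suc k) (fun_upd \<omega> ?e y) \<partial>K ?e)"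
        using step(1) by (intro nn_integral_cong) simp
      finally show ?thesis .
    qed
    note inner = this
    have "(\<lambda>\<omega>. ennreal ?\<delta> * ?f k \<omega>) \<in> borel_measurable (Pi\<^sub>M I K)"
      using meas[of k] by measurable
    then show ?thesis
      unfolding split[OF meas[of "Suc k"]] by (subst split) (assumption, rule nn_integral_mono, rule inner)
  qed
  finally show ?case .
qed

lemma second_moment_ge:
  assumes "x < n"
  shows "ennreal ((1 / 4 ^ r) ^ k) \<le> (\<integral>\<^sup>+ C. ennreal ((\<phi> n x (circuit_mat n k C))\<^sup>2) \<partial>fixed_brickwork G r d haar b)"
proof -
  have "(\<lambda>C. ennreal ((\<phi> n x (circuit_mat n k C))\<^sup>2)) \<in> borel_measurable (circuit_borel G r d)"
    using \<phi>_measurable[OF G, of x k r d] by measurable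
  then show ?thesis
    unfolding fixed_brickwork_eq using second_moment_PiM_ge[OF assms, of k]
    by (subst nn_integral_distr[OF circ_measurable]) auto
qed

lemma prob_space_fixed_brickwork: "prob_space (fixed_brickwork G r d haar b)"
proof -
  interpret product_prob_space K I by (rule product_K)
  show ?thesis unfolding fixed_brickwork_eq by (rule P.prob_space_distr[OF circ_measurable])
qed

end

text \<open>The second moment is linear in the distribution and the bound is the same for every
  layout, so weights adding up to 1 preserve it.\<close>

lemma generalized_random_brickwork_second_moment_ge:
  assumes G: "architecture n G" and E: "prob_space E" "generalized_random_brickwork G r d E" and x: "x < n"
  shows "ennreal ((1 / 4 ^ r) ^ k) \<le> (\<integral>\<^sup>+ C. ennreal ((\<phi> n x (circuit_mat n k C))\<^sup>2) \<partial>E)"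
proof -
  let ?f = "\<lambda>C. ennreal ((\<phi> n x (circuit_mat n k C))\<^sup>2)"
  obtain haar w where sets: "sets E = sets (circuit_borel G r d)"
    and haar: "\<And>m. is_haar_orthogonal (2 ^ m) (haar m)"
    and w: "\<And>b. b \<in> layouts G r d \<Longrightarrow> 0 \<le> w b" "(\<Sum>b\<in>layouts G r d. w b) = 1"
    and E_eq: "\<And>A. A \<in> sets E \<Longrightarrow> measure E A = (\<Sum>b\<in>layouts G r d. w b * measure (fixed_brickwork G r d haar b) A)"
    using E(2) unfolding generalized_random_brickwork_def by blast
  interpret E: prob_space E by (rule E(1))
  have bw: "brickwork n r d G haar b" if "b \<in> layouts G r d" for b
    by unfold_locales (use G haar that in auto)
  have em: "emeasure E A = (\<Sum>b\<in>layouts G r d. ennreal (w b) * emeasure (fixed_brickwork G r d haar b) A)"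
    if "A \<in> sets E" for A
  proof -
    have "emeasure E A = ennreal (\<Sum>b\<in>layouts G r d. w b * measure (fixed_brickwork G r d haar b) A)"
      using E_eq[OF that] by (simp add: E.emeasure_eq_measure)
    also have "\<dots> = (\<Sum>b\<in>layouts G r d. ennreal (w b * measure (fixed_brickwork G r d haar b) A))"
      using w(1) by (intro sum_ennreal[symmetric]) auto
    also have "\<dots> = (\<Sum>b\<in>layouts G r d. ennreal (w b) * emeasure (fixed_brickwork G r d haar b) A)"
    proof (intro sum.cong refl)
      fix b assume b: "b \<in> layouts G r d"
      interpret B: prob_space "fixed_brickwork G r d haar b"
        by (rule brickwork.prob_space_fixed_brickwork[OF bw[OF b]])
      show "ennreal (w b * measure (fixed_brickwork G r d haar b) A) = ennreal (w b) * emeasure (fixed_brickwork G r d haar b) A"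
        using w(1)[OF b] by (simp add: B.emeasure_eq_measure ennreal_mult)
    qed
    finally show ?thesis .
  qed
  have "(\<lambda>C. \<phi> n x (circuit_mat n k C)) \<in> borel_measurable E"
    by (subst measurable_cong_sets[OF sets refl]) (rule \<phi>_measurable[OF G])
  then have f: "?f \<in> borel_measurable E" by measurable
  have "ennreal ((1 / 4 ^ r) ^ k) = (\<Sum>b\<in>layouts G r d. ennreal (w b)) * ennreal ((1 / 4 ^ r) ^ k)"
    using w by (simp add: sum_ennreal)
  also have "\<dots> \<le> (\<Sum>b\<in>layouts G r d. ennreal (w b) * (\<integral>\<^sup>+ C. ?f C \<partial>fixed_brickwork G r d haar b))"
    unfolding sum_distrib_right using brickwork.second_moment_ge[OF bw x]
    by (intro sum_mono mult_left_mono) auto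
  also have "\<dots> = (\<integral>\<^sup>+ C. ?f C \<partial>E)"
    using em f by (intro nn_integral_mixture[symmetric]) (auto simp: fixed_brickwork_def Let_def sets)
  finally show ?thesis .
qed

text \<open>As 1 + \<epsilon> < 2, comparing both bounds gives 4^(-r d) < 4 / (2^n + 2), that is 2^n
  + 2 < 2^(2 r d + 2). Hence n <= 2 r d + 1, and this is at most (2 r + 1) d as soon as d >=
  1.\<close>

lemma size_le_brickwork_depth:
  assumes G: "architecture n G" and E: "orthogonal_ensemble n G r d E"
    and design: "orthogonal_state_design 2 n \<epsilon> E (\<lambda>C. circuit_mat n d C *\<^sub>v zero_ket n)"
    and brick: "generalized_random_brickwork G r d E" and \<epsilon>: "\<epsilon> < 1"
  shows "real n \<le> (2 * real r + 1) * real d"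
proof (cases "n = 0")
  case False
  then have n: "0 < n" by simp
  let ?N = "2 ^ n :: nat" and ?U = "circuit_mat n d"
  interpret E: prob_space E using E by (simp add: orthogonal_ensemble_def)
  have sets: "sets E = sets (circuit_borel G r d)" using E by (simp add: orthogonal_ensemble_def)
  have orth: "AE C in E. ?U C \<in> orthogonal_group ?N" using E by (simp add: orthogonal_ensemble_def)
  have "ennreal ((1 / 4 ^ r) ^ d) \<le> (\<integral>\<^sup>+ C. ennreal ((\<phi> n 0 (?U C))\<^sup>2) \<partial>E)"
    by (rule generalized_random_brickwork_second_moment_ge[OF G E.prob_space_axioms brick n])
  also have "\<dots> = ennreal (LINT C|E. (\<phi> n 0 (?U C))\<^sup>2)"
  proof (rule nn_integral_eq_integral)
    show "integrable E (\<lambda>C. (\<phi> n 0 (?U C))\<^sup>2)"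
    proof (rule E.integrable_const_bound[where B = 1])
      show "AE C in E. norm ((\<phi> n 0 (?U C))\<^sup>2) \<le> 1"
      proof (use orth in eventually_elim)
        case (elim C)
        then have "\<bar>\<phi> n 0 (?U C)\<bar> \<le> 1"
          using zmat_real zmat_sym by (intro haar_conj_abs_le_1 zmat_square) auto
        then show ?case by (simp add: abs_square_le_1)
      qed
      show "(\<lambda>C. (\<phi> n 0 (?U C))\<^sup>2) \<in> borel_measurable E"
      proof -
        have "(\<lambda>C. \<phi> n 0 (?U C)) \<in> borel_measurable E"
          by (subst measurable_cong_sets[OF sets refl]) (rule \<phi>_measurable[OF G])
        then show ?thesis by measurable
      qed
    qed
  qed simp
  finally have "(1 / 4 ^ r) ^ d \<le> (LINT C|E. (\<phi> n 0 (?U C))\<^sup>2)"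
    by (simp add: ennreal_le_iff)
  also have "\<dots> \<le> (1 + \<epsilon>) * (2 / (2 ^ n + 2))"
  proof (rule orthogonal_state_design_bounds(2)[OF design E.prob_space_axioms _ _ orth zmat_carrier zmat_real zmat_sym zmat_square zmat_trace[OF n]])
    show "(\<lambda>C. ?U C $$ (i, 0)) \<in> borel_measurable E" if "i < ?N" for i
      using circuit_mat_entry_measurable[OF G that, of 0 d r d] by (subst measurable_cong_sets[OF sets refl]) auto
  qed auto
  also have "\<dots> < 2 * (2 / (2 ^ n + 2))"
    using \<epsilon> by (intro mult_strict_right_mono divide_pos_pos add_pos_pos) auto
  finally have "(1 / 4 ^ r) ^ d < (4 / (2 ^ n + 2) :: real)" by simp
  then have "(2 :: real) ^ n + 2 < 4 * 4 ^ (r * d)"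
    by (simp add: power_mult[symmetric] power_divide field_simps add_pos_pos)
  also have "4 * 4 ^ (r * d) = (2 :: real) ^ (2 * (r * d) + 2)"
    by (simp add: power_add power_mult)
  finally have lt: "(2 :: real) ^ n + 2 < 2 ^ (2 * (r * d) + 2)" .
  then have "(2 :: real) ^ n < 2 ^ (2 * (r * d) + 2)" by linarith
  then have le: "n < 2 * (r * d) + 2" by (rule power_less_imp_less_exp[rotated]) simp
  \<comment> \<open>For d = 0 the inequality reads 2^n + 2 < 4, which fails for n >= 1; the summand
    2 on the left, dropped in \<open>le\<close>, is what excludes n = 1 here.\<close>
  have "d \<noteq> 0"
  proof
    assume "d = 0"
    moreover have "(2 :: real) ^ 1 \<le> 2 ^ n" using n by (intro power_increasing) auto
    ultimately show False using lt by simp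
  qed
  then have "n \<le> (2 * r + 1) * d" using le by (simp add: algebra_simps)
  then have "real n \<le> real ((2 * r + 1) * d)" by (rule of_nat_mono)
  then show ?thesis by (simp add: algebra_simps)
qed simp


theorem theoremS17:
  fixes \<epsilon> :: real and r :: nat
  assumes "\<epsilon> < 1"
  shows "(\<exists>c>0. \<forall>(n::nat) G (d::nat) E.
             architecture n G \<and> orthogonal_ensemble n G r d E \<and>
             orthogonal_state_design 2 n \<epsilon> E (\<lambda>C. circuit_mat n d C *\<^sub>v zero_ket n) \<and>
             locally_independent G E
             \<longrightarrow> ereal (real d) \<ge> ereal c * graph_diameter G)
       \<and> (\<exists>c>0. \<forall>(n::nat) G (d::nat) E.
             architecture n G \<and> orthogonal_ensemble n G r d E \<and>
             orthogonal_state_design 2 n \<epsilon> E (\<lambda>C. circuit_mat n d C *\<^sub>v zero_ket n) \<and>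
             generalized_random_brickwork G r d E
             \<longrightarrow> real d \<ge> c * real n)"
proof (rule conjI)
  have c: "0 < 1 / (2 * (real r)\<^sup>2 + 1)" by (intro divide_pos_pos add_nonneg_pos) auto
  show "\<exists>c>0. \<forall>n G d E. architecture n G \<and> orthogonal_ensemble n G r d E \<and>
      orthogonal_state_design 2 n \<epsilon> E (\<lambda>C. circuit_mat n d C *\<^sub>v zero_ket n) \<and>
      locally_independent G E \<longrightarrow> ereal (real d) \<ge> ereal c * graph_diameter G"
    using diameter_le[OF _ _ _ assms] c by (intro exI[of _ "1 / (2 * (real r)\<^sup>2 + 1)"]) blast
  have "1 / (2 * real r + 1) * real n \<le> real d"
    if "architecture n G" "orthogonal_ensemble n G r d E"
      "orthogonal_state_design 2 n \<epsilon> E (\<lambda>C. circuit_mat n d C *\<^sub>v zero_ket n)"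
      "generalized_random_brickwork G r d E" for n G d E
    using size_le_brickwork_depth[OF that assms] by (simp add: pos_divide_le_eq mult.commute add_nonneg_pos)
  then show "\<exists>c>0. \<forall>n G d E. architecture n G \<and> orthogonal_ensemble n G r d E \<and>
      orthogonal_state_design 2 n \<epsilon> E (\<lambda>C. circuit_mat n d C *\<^sub>v zero_ket n) \<and>
      generalized_random_brickwork G r d E \<longrightarrow> real d \<ge> c * real n"
    by (intro exI[of _ "1 / (2 * real r + 1)"]) (auto simp: add_nonneg_pos)
qed

end
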